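(* Let $p$ be a prime, $c=p^\ell$ with $\ell$ a nonnegative integer, and $\chi$ a Dirichlet character modulo $c$ of conductor $\mathfrak c_\chi=p^\gamma$ with $\gamma\le\ell$. Then for all integers $a,b$, \[ |S_\chi(a,b;c)|\le\tau(c)\,(a,b,c)^{1/2}c^{1/2}\mathfrak c_\chi^{1/2}\quad\text{and}\quad|S_\chi(a,b;c)|\le\tau(c)\,(a,b,c)^{1/2}c^{1/2}\mathfrak c_\chi^{1/4}p^{1/4}. \]
   Context: $S_\chi(a,b;c)=\sum_{x\in(\mathbb Z/c\mathbb Z)^*}\overline{\chi(x)}\,e\big(\frac{ax+b\bar x}{c}\big)$ with $x\bar x\equiv1\pmod c$, $e(y)=e^{2\pi iy}$. $\tau(c)$ is the number of positive divisors of $c$, and $(a,b,c)$ is the gcd. *)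

theory Defs
  imports
    Complex_Main
    "HOL-Number_Theory.Number_Theory"
    "HOL-Number_Theory.Modular_Inverse"
begin

text \<open>
  A Dirichlet character modulo \<open>n\<close>, that is, a homomorphism from the unit group of the integers
  modulo \<open>n\<close> to the nonzero complex numbers, is represented in the usual way by its extension
  to the integers by zero. For \<open>n = 1\<close> the only character is the constant function \<open>1\<close>.
\<close>
definition dirichlet_character :: "nat \<Rightarrow> (int \<Rightarrow> complex) \<Rightarrow> bool" where
  "dirichlet_character n chi \<longleftrightarrow>
     n > 0 \<and>
     (\<forall>x y. chi (x * y) = chi x * chi y) \<and>
     (\<forall>x. chi (x + int n) = chi x) \<and>
     (\<forall>x. chi x \<noteq> 0 \<longleftrightarrow> coprime x (int n))"

definition conductor :: "nat \<Rightarrow> (int \<Rightarrow> complex) \<Rightarrow> nat" where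
  "conductor n chi =
     (LEAST d. d dvd n \<and>
        (\<exists>psi. dirichlet_character d psi \<and> (\<forall>x. coprime x (int n) \<longrightarrow> chi x = psi x)))"

definition expi :: "real \<Rightarrow> complex" where
  "expi y = exp (2 * of_real pi * \<i> * of_real y)"

text \<open>
  The summation runs over the representatives of the residue classes coprime to \<open>c\<close> in
  \<open>{0..<c}\<close>; for \<open>c = 1\<close> this is \<open>{0}\<close>.
\<close>
definition kloosterman_sum :: "(int \<Rightarrow> complex) \<Rightarrow> int \<Rightarrow> int \<Rightarrow> nat \<Rightarrow> complex" where
  "kloosterman_sum chi a b c =
     (\<Sum>x \<in> {x \<in> {0..<int c}. coprime x (int c)}.
        cnj (chi x) * expi (real_of_int (a * x + b * modular_inverse (int c) x) / real c))"

definition divisor_count :: "nat \<Rightarrow> nat" where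
  "divisor_count n = card {d. d dvd n}"

end

theory Submission
  imports
    Defs
    "HOL-Algebra.Algebraic_Closure_Type"
    "Berlekamp_Zassenhaus.Finite_Field"
    "HOL-Computational_Algebra.Computational_Algebra"
begin

text \<open>
  For \<open>l \<ge> 2\<close>, replacing \<open>x\<close> by \<open>x (1 + p\<^sup>k t)\<close> with \<open>k = \<lceil>l / 2\<rceil>\<close> shows that only the solutions of a
  quadratic congruence modulo \<open>p\<^sup>l\<^sup>-\<^sup>k\<close> contribute to the sum, and counting them gives both bounds
  (with an additional quadratic Gauss sum if \<open>l\<close> is odd and the character is trivial). A common
  factor of \<open>a\<close>, \<open>b\<close>, \<open>c\<close> either lowers the modulus or makes the sum vanish.

  The remaining case is Weil's bound \<open>2 \<surd>p\<close> for the classical sum modulo a prime. Its companion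
  sums over the extensions of \<open>F\<^sub>p\<close> are \<open>- (\<alpha>\<^sup>n + \<beta>\<^sup>n)\<close> with \<open>\<alpha> \<beta> = p\<close>, because their \<open>L\<close>-function is a
  quadratic polynomial. Bombieri's form of Stepanov's method bounds the number of points of
  \<open>y\<^sup>p - y + c = a x + b / x\<close> over these extensions by \<open>q + O(\<surd>q)\<close>; so the companion sums are
  \<open>O(p\<^sup>n\<^sup>/\<^sup>2)\<close>, which forces \<open>\<bar>\<alpha>\<bar> = \<bar>\<beta>\<bar> = \<surd>p\<close>.
\<close>

hide_const (open) Divisibility.prime

section \<open>Rational points on an Artin--Schreier curve\<close>

text \<open>The conductor exponent \<open>(g + 1) / 4\<close> is dictated by characters with
  \<open>g = l\<close>. Then nothing is known about the linear coefficient of the quadratic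
  congruence, its discriminant may be highly divisible by \<open>p\<close>, and its roots may
  cluster: the count is only \<open>2 * p ^ (l - h)\<close> with \<open>h\<close> about
  \<open>l / 4\<close>. As soon as \<open>g < l\<close>, the linear coefficient is divisible by
  \<open>p\<close>, and for odd \<open>p\<close> the derivative at a root is a unit, so only the
  rounding of \<open>l / 2\<close> is lost. For \<open>p = 2\<close> the derivative is even; the
  extra factor 2 is absorbed by the factor \<open>l + 1\<close> or by the conductor. For a prime
  modulus, the polynomial method gives only upper bounds for point counts, and only over fields with
  \<open>Q\<^sup>2\<close> elements. Upper bounds suffice because the trace fibres partition the
  field; even extension degrees suffice because an inverse root larger than \<open>sqrt p\<close>
  would outgrow any bound whose constant depends on \<open>p\<close> alone.\<close>

lemma homogeneous_system_nontrivial_solution: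
  fixes M :: "'i \<Rightarrow> 'j \<Rightarrow> 'k::field"
  assumes "finite J" "finite I" "card J < card I"
  shows "\<exists>s. (\<exists>i\<in>I. s i \<noteq> 0) \<and> (\<forall>j\<in>J. (\<Sum>i\<in>I. s i * M i j) = 0)"
  using assms
proof (induction J arbitrary: I M rule: finite_induct)
  case empty
  then have "I \<noteq> {}" by auto
  then show ?case by (intro exI[of _ "\<lambda>_. 1"]) auto
next
  case (insert j J)
  show ?case
  proof (cases "\<forall>i\<in>I. M i j = 0")
    case True
    have "card J < card I" using insert by simp
    from insert.IH[OF \<open>finite I\<close> this, of M] obtain s where
      s: "\<exists>i\<in>I. s i \<noteq> 0" "\<forall>j\<in>J. (\<Sum>i\<in>I. s i * M i j) = 0" by blast
    with True show ?thesis by (intro exI[of _ s]) auto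
  next
    case False
    then obtain i0 where i0: "i0 \<in> I" "M i0 j \<noteq> 0" by blast
    define I' where "I' = I - {i0}"
    \<comment> \<open>Gaussian elimination: equation \<open>j\<close> is solved for the unknown
      \<open>i0\<close>, and \<open>M'\<close> is the system left for the other unknowns;
      \<open>t\<close> restores the value at \<open>i0\<close>.\<close>
    define M' where "M' = (\<lambda>i l. M i l - M i j / M i0 j * M i0 l)"
    have fin: "finite I'" and card: "card J < card I'" using insert i0 by (auto simp: I'_def)
    from insert.IH[OF fin card, of M'] obtain s where
      s: "\<exists>i\<in>I'. s i \<noteq> 0" "\<forall>j\<in>J. (\<Sum>i\<in>I'. s i * M' i j) = 0" by blast
    define t where "t = (\<lambda>i. if i = i0 then - (\<Sum>i\<in>I'. s i * (M i j / M i0 j)) else s i)"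
    have split: "(\<Sum>i\<in>I. t i * M i l) = (\<Sum>i\<in>I'. s i * M' i l)" for l
    proof -
      have "(\<Sum>i\<in>I. t i * M i l) = t i0 * M i0 l + (\<Sum>i\<in>I'. t i * M i l)"
        unfolding I'_def using i0 insert.prems by (simp add: sum.remove)
      also have "(\<Sum>i\<in>I'. t i * M i l) = (\<Sum>i\<in>I'. s i * M i l)"
        by (intro sum.cong) (auto simp: t_def I'_def)
      also have "t i0 * M i0 l = (\<Sum>i\<in>I'. - (s i * (M i j / M i0 j) * M i0 l))"
        by (simp add: t_def sum_distrib_right sum_negf)
      finally show ?thesis
        by (simp add: M'_def sum.distrib[symmetric] algebra_simps)
    qed
    have "(\<Sum>i\<in>I. t i * M i j) = 0"
      unfolding split using i0 by (simp add: M'_def)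
    moreover have "\<exists>i\<in>I. t i \<noteq> 0" using s(1) by (auto simp: I'_def t_def)
    ultimately show ?thesis using s(2) split by (intro exI[of _ t]) auto
  qed
qed

section \<open>Roots of polynomials and their multiplicities\<close>

lemma order_eq_1_if_simple_root:
  fixes f :: "'k::field poly"
  assumes "poly f y = 0" "poly (pderiv f) y \<noteq> 0"
  shows "order y f = 1"
proof -
  have f0: "f \<noteq> 0" using assms(2) by auto
  obtain g where g: "f = [:-y, 1:] * g" using assms(1) poly_eq_0_iff_dvd by blast
  have "pderiv f = g + [:-y, 1:] * pderiv g" unfolding g
    by (subst pderiv_mult) (simp add: pderiv_pCons)
  hence "poly g y \<noteq> 0" using assms(2) by simp
  hence "order y g = 0" by (simp add: order_0I)
  moreover have "order y [:-y, 1:] = 1" using order_power_n_n[of y 1] by simp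
  ultimately show ?thesis using f0 unfolding g by (subst order_mult) auto
qed

lemma infinite_UNIV_alg_closed: "infinite (UNIV :: 'k::alg_closed_field set)"
proof
  assume fin: "finite (UNIV :: 'k set)"
  define P :: "'k poly" where "P = (\<Prod>x\<in>UNIV. [:-x, 1:]) + 1"
  have "degree (\<Prod>x\<in>(UNIV::'k set). [:-x, 1:]) = card (UNIV :: 'k set)"
    by (subst degree_prod_eq_sum_degree) auto
  moreover have "card (UNIV :: 'k set) > 0" using fin by (simp add: finite_UNIV_card_ge_0)
  ultimately have "degree P > 0" unfolding P_def by (subst degree_add_eq_left) auto
  then obtain x where "poly P x = 0" using alg_closed_imp_poly_has_root by blast
  moreover have "poly P x = 1"
    using fin by (auto simp: P_def poly_prod intro!: prod_zero bexI[of _ x])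
  ultimately show False by simp
qed

text \<open>Reduces polynomial identities to identities of values, where coordinates of points on
  the curve can be used.\<close>

lemma poly_eqI_alg_closed:
  fixes f g :: "'k::alg_closed_field poly"
  assumes "\<And>y. poly f y = poly g y"
  shows "f = g"
proof (rule ccontr)
  assume "f \<noteq> g"
  hence "finite {y. poly (f - g) y = 0}" by (intro poly_roots_finite) auto
  moreover have "{y. poly (f - g) y = 0} = UNIV" using assms by auto
  ultimately show False using infinite_UNIV_alg_closed[where 'k = 'k] by simp
qed

lemma prod_linear_dvd:
  fixes f :: "'a::field poly"
  assumes "finite S" "\<And>y. y \<in> S \<Longrightarrow> poly f y = 0"
  shows "(\<Prod>y\<in>S. [:- y, 1:]) dvd f"
  using assms
proof (induction S arbitrary: f rule: finite_induct)
  case (insert y S)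
  then obtain g where g: "f = [:- y, 1:] * g" using poly_eq_0_iff_dvd by blast
  have "poly g z = 0" if "z \<in> S" for z
    using insert.prems[of z] insert.hyps that by (auto simp: g)
  hence "(\<Prod>y\<in>S. [:- y, 1:]) dvd g" by (rule insert.IH)
  hence "[:- y, 1:] * (\<Prod>y\<in>S. [:- y, 1:]) dvd [:- y, 1:] * g" by (intro mult_dvd_mono) auto
  thus ?case unfolding g prod.insert[OF insert.hyps] .
qed simp

lemma proots_linear_product: "proots (\<Prod>x\<in>#R. [:- x, 1 :: 'k::field:]) = R"
proof (induction R)
  case (add x R)
  have "proots ([:- x, 1:] * (\<Prod>x\<in>#R. [:- x, 1:])) = {#x#} + R"
    by (subst proots_mult) (auto simp: add prod_mset_zero_iff)
  thus ?case by simp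
qed simp

lemma sum_order_eq_degree:
  fixes f :: "'k::alg_closed_field poly"
  assumes "f \<noteq> 0"
  shows "(\<Sum>x\<in>{x. poly f x = 0}. order x f) = degree f"
proof -
  obtain R where R: "size R = degree f" "f = smult (lead_coeff f) (\<Prod>x\<in>#R. [:-x, 1:])"
    using alg_closed_imp_factorization[OF assms] by blast
  have "proots f = proots (\<Prod>x\<in>#R. [:-x, 1:])"
    by (subst R(2)) (use assms in simp)
  also have "\<dots> = R" by (rule proots_linear_product)
  finally have "size (proots f) = degree f" using R(1) by simp
  thus ?thesis using assms by (simp add: size_multiset_overloaded_eq)
qed

lemma card_roots_simple:
  fixes f :: "'k::alg_closed_field poly"
  assumes "\<And>x. poly f x = 0 \<Longrightarrow> poly (pderiv f) x \<noteq> 0" "f \<noteq> 0"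
  shows "card {x. poly f x = 0} = degree f"
proof -
  have "(\<Sum>x\<in>{x. poly f x = 0}. order x f) = (\<Sum>x\<in>{x. poly f x = 0}. 1)"
    by (intro sum.cong refl order_eq_1_if_simple_root) (use assms in auto)
  thus ?thesis using sum_order_eq_degree[OF assms(2)] by simp
qed

text \<open>The constant \<open>c\<close> gives each trace value its own curve: if \<open>c\<close>
  has trace \<open>d\<close>, the rational points lie above those \<open>x\<close> whose phase has
  trace \<open>d\<close>.\<close>

locale artin_schreier_curve =
  fixes a b c :: "'k::alg_closed_field" and p :: nat
  assumes prime_p: "prime p" and CHAR_p: "CHAR('k) = p" and odd_p: "odd p"
    and a0: "a \<noteq> 0" and b0: "b \<noteq> 0"
begin

lemma p_gt_2: "p > 2"
  using prime_p odd_p by (metis even_numeral le_neq_implies_less prime_ge_2_nat)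

lemma two0: "(2::'k) \<noteq> 0"
proof
  assume "(2::'k) = 0"
  hence "of_nat 2 = (0::'k)" by simp
  hence "p dvd 2" unfolding of_nat_eq_0_iff_char_dvd CHAR_p .
  thus False using p_gt_2 by (auto dest: dvd_imp_le)
qed

section \<open>Functions on the curve with a pole only at infinity\<close>

definition curve :: "('k \<times> 'k) set" where
  "curve = {(x, y). x \<noteq> 0 \<and> a * x\<^sup>2 + b = x * (y ^ p - y + c)}"

text \<open>
  On the Artin--Schreier curve the function \<open>x\<close> has a pole of order \<open>p\<close> and \<open>y\<close> a pole of order 1
  at the point \<open>x = \<infinity>\<close>, so \<open>monomial k\<close> has a pole of order exactly \<open>k\<close> there. It has no
  other pole provided \<open>k\<close> is 0 or at least \<open>p\<close>; the remaining orders are the gaps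
  at that point.
\<close>
definition monomial :: "nat \<Rightarrow> 'k \<Rightarrow> 'k \<Rightarrow> 'k" where
  "monomial k x y = x ^ (k div p) * y ^ (k mod p)"

definition orders :: "nat set" where
  "orders = {k. k = 0 \<or> p \<le> k}"

text \<open>The analogue of a Riemann-Roch space: pole order below \<open>n\<close> at infinity and
  no other pole. Only values on \<open>curve\<close> count, so functions can be rewritten by its
  equation.\<close>

definition filt :: "nat \<Rightarrow> ('k \<Rightarrow> 'k \<Rightarrow> 'k) set" where
  "filt n = {h. \<exists>r. \<forall>(x, y)\<in>curve. h x y = (\<Sum>k\<in>{..<n} \<inter> orders. r k * monomial k x y)}"

lemma filtI:
  "(\<And>x y. (x, y) \<in> curve \<Longrightarrow> h x y = (\<Sum>k\<in>{..<n} \<inter> orders. r k * monomial k x y)) \<Longrightarrow> h \<in> filt n"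
  unfolding filt_def by blast

lemma filtE:
  assumes "h \<in> filt n"
  obtains r where "\<And>x y. (x, y) \<in> curve \<Longrightarrow> h x y = (\<Sum>k\<in>{..<n} \<inter> orders. r k * monomial k x y)"
  using assms unfolding filt_def by blast

lemma filt_cong:
  assumes "h \<in> filt n" "\<And>x y. (x, y) \<in> curve \<Longrightarrow> g x y = h x y"
  shows "g \<in> filt n"
  using assms unfolding filt_def by fastforce

lemma filt_add:
  assumes "h \<in> filt n" "g \<in> filt n"
  shows "(\<lambda>x y. h x y + g x y) \<in> filt n"
proof -
  from assms obtain r s where
    "\<And>x y. (x, y) \<in> curve \<Longrightarrow> h x y = (\<Sum>k\<in>{..<n} \<inter> orders. r k * monomial k x y)"
    "\<And>x y. (x, y) \<in> curve \<Longrightarrow> g x y = (\<Sum>k\<in>{..<n} \<inter> orders. s k * monomial k x y)"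
    by (elim filtE) blast
  thus ?thesis
    by (intro filtI[where r = "\<lambda>k. r k + s k"]) (simp add: sum.distrib algebra_simps)
qed

lemma filt_scale:
  assumes "h \<in> filt n"
  shows "(\<lambda>x y. u * h x y) \<in> filt n"
proof -
  from assms obtain r where
    "\<And>x y. (x, y) \<in> curve \<Longrightarrow> h x y = (\<Sum>k\<in>{..<n} \<inter> orders. r k * monomial k x y)"
    by (elim filtE) blast
  thus ?thesis
    by (intro filtI[where r = "\<lambda>k. u * r k"]) (simp add: sum_distrib_left algebra_simps)
qed

lemma filt_zero: "(\<lambda>x y. 0) \<in> filt n"
  by (rule filtI[where r = "\<lambda>_. 0"]) auto

lemma filt_sum:
  assumes "\<And>i. i \<in> I \<Longrightarrow> h i \<in> filt n"
  shows "(\<lambda>x y. \<Sum>i\<in>I. h i x y) \<in> filt n"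
  using assms
  by (induction I rule: infinite_finite_induct) (auto intro: filt_zero filt_add)

lemma filt_mono:
  assumes "h \<in> filt m" "m \<le> n"
  shows "h \<in> filt n"
proof -
  from assms(1) obtain r where
    r: "\<And>x y. (x, y) \<in> curve \<Longrightarrow> h x y = (\<Sum>k\<in>{..<m} \<inter> orders. r k * monomial k x y)"
    by (elim filtE) blast
  show ?thesis
  proof (rule filtI[where r = "\<lambda>k. if k < m then r k else 0"])
    fix x y assume "(x, y) \<in> curve"
    hence "h x y = (\<Sum>k\<in>{..<m} \<inter> orders. r k * monomial k x y)" by (rule r)
    also have "\<dots> = (\<Sum>k\<in>{..<n} \<inter> orders. (if k < m then r k else 0) * monomial k x y)"
      using assms(2) by (intro sum.mono_neutral_cong_left) auto
    finally show "h x y = \<dots>" .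
  qed
qed

lemma monomial_filt:
  assumes "k \<in> orders" "k < n"
  shows "monomial k \<in> filt n"
proof (rule filtI[where r = "\<lambda>i. if i = k then 1 else 0"])
  fix x y
  have "(\<Sum>i\<in>{..<n} \<inter> orders. (if i = k then 1 else 0) * monomial i x y)
      = (\<Sum>i\<in>{..<n} \<inter> orders. if i = k then monomial k x y else 0)"
    by (intro sum.cong) auto
  also have "\<dots> = monomial k x y" using assms by simp
  finally show "monomial k x y = (\<Sum>i\<in>{..<n} \<inter> orders. (if i = k then 1 else 0) * monomial i x y)"
    by simp
qed

text \<open>At the point \<open>x = 0\<close>, the function \<open>x\<close> has a zero of order
  \<open>p\<close> and \<open>y\<close> a simple pole. So \<open>j \<le> i * p\<close> says that
  \<open>x ^ i * y ^ j\<close> is regular there.\<close>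

lemma orders_memI: "j \<le> i * p \<Longrightarrow> i * p + j \<in> orders"
  by (cases i) (auto simp: orders_def)

lemma ordersD: "k \<in> orders \<Longrightarrow> k mod p \<le> k div p * p"
proof -
  assume k: "k \<in> orders"
  show ?thesis
  proof (cases "k = 0")
    case False
    hence "k div p > 0" using k p_gt_2 by (simp add: orders_def div_greater_zero_iff)
    hence "1 * p \<le> k div p * p" by (intro mult_right_mono) auto
    moreover have "k mod p < p" using p_gt_2 by simp
    ultimately show ?thesis by linarith
  qed auto
qed

text \<open>The equation of the curve exchanges \<open>x * y ^ p\<close> for
  \<open>a * x\<^sup>2\<close>, of the same pole order, plus terms of smaller order. The exponent of
  \<open>y\<close> drops, and the leading coefficient only picks up factors
  \<open>a\<close>.\<close>

lemma power_reduction: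
  assumes "j \<le> i * p"
  shows "\<exists>u g. u \<noteq> 0 \<and> g \<in> filt (i * p + j) \<and>
           (\<forall>(x, y)\<in>curve. x ^ i * y ^ j = u * monomial (i * p + j) x y + g x y)"
  using assms
proof (induction j arbitrary: i rule: less_induct)
  case (less j i)
  show ?case
  proof (cases "j < p")
    case True
    have "monomial (i * p + j) = (\<lambda>x y. x ^ i * y ^ j)"
      using True by (simp add: monomial_def fun_eq_iff)
    thus ?thesis by (intro exI[of _ 1] exI[of _ "\<lambda>x y. 0"]) (auto simp: filt_zero)
  next
    case False
    define j' where "j' = j - p"
    have j: "j = j' + p" using False by (simp add: j'_def)
    have "i \<noteq> 0" using less.prems False p_gt_2 by (cases i) auto
    then obtain i' where i: "i = Suc i'" using not0_implies_Suc by blast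
    have j'i': "j' \<le> i' * p" using less.prems by (simp add: i j)
    \<comment> \<open>All correction terms carry a smaller power of \<open>y\<close>, so the
      induction hypothesis places them in \<open>filt\<close>.\<close>
    have mem: "(\<lambda>x y. x ^ m * y ^ l) \<in> filt n" if "l < j" "l \<le> m * p" "m * p + l < n" for l m n
    proof -
      from less.IH[OF that(1,2)] obtain u g where ug: "g \<in> filt (m * p + l)"
        "\<forall>(x, y)\<in>curve. x ^ m * y ^ l = u * monomial (m * p + l) x y + g x y" by blast
      have "(\<lambda>x y. u * monomial (m * p + l) x y + g x y) \<in> filt n"
        using that ug(1) by (intro filt_add filt_scale monomial_filt orders_memI)
          (auto intro: filt_mono)
      thus ?thesis by (rule filt_cong) (use ug(2) in auto)
    qed
    let ?D = "i * p + j"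
    \<comment> \<open>Trading \<open>y ^ p\<close> for one more \<open>x\<close> leaves the pole
      order unchanged.\<close>
    have D: "(i' + 2) * p + j' = ?D" by (simp add: i j algebra_simps)
    have "j' \<le> (i' + 2) * p" using j'i' by (simp add: algebra_simps)
    from less.IH[OF _ this] obtain u g where u: "u \<noteq> 0" and g: "g \<in> filt ?D"
      and ug: "\<forall>(x, y)\<in>curve. x ^ (i' + 2) * y ^ j' = u * monomial ?D x y + g x y"
      unfolding D using p_gt_2 by (auto simp: j)
    define G where "G = (\<lambda>x y. (a * g x y + x ^ (i' + 1) * y ^ (j' + 1)) +
        (b * (x ^ i' * y ^ j') + (- c) * (x ^ (i' + 1) * y ^ j')))"
    have "G \<in> filt ?D" unfolding G_def
      using p_gt_2 j'i'
      by (intro filt_add filt_scale g mem) (auto simp: i j algebra_simps)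
    moreover have "x ^ i * y ^ j = (a * u) * monomial ?D x y + G x y" if "(x, y) \<in> curve" for x y
    proof -
      have eq: "x * y ^ p = a * x\<^sup>2 + b + x * y - c * x"
        using that by (simp add: curve_def algebra_simps)
      have "x ^ i * y ^ j = x ^ i' * y ^ j' * (x * y ^ p)"
        by (simp add: i j power_add algebra_simps)
      also have "\<dots> = a * (x ^ (i' + 2) * y ^ j') + x ^ (i' + 1) * y ^ (j' + 1) +
          (b * (x ^ i' * y ^ j') + (- c) * (x ^ (i' + 1) * y ^ j'))"
        unfolding eq by (simp add: algebra_simps power2_eq_square)
      also have "x ^ (i' + 2) * y ^ j' = u * monomial ?D x y + g x y" using ug that by blast
      finally show ?thesis by (simp add: G_def algebra_simps)
    qed
    ultimately show ?thesis using u a0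
      by (intro exI[of _ "a * u"] exI[of _ G]) auto
  qed
qed

lemma power_filt:
  assumes "j \<le> i * p" "i * p + j < n"
  shows "(\<lambda>x y. x ^ i * y ^ j) \<in> filt n"
proof -
  from power_reduction[OF assms(1)] obtain u g where ug: "g \<in> filt (i * p + j)"
    "\<forall>(x, y)\<in>curve. x ^ i * y ^ j = u * monomial (i * p + j) x y + g x y" by blast
  have "(\<lambda>x y. u * monomial (i * p + j) x y + g x y) \<in> filt n"
    using assms ug(1) by (intro filt_add filt_scale monomial_filt orders_memI)
      (auto intro: filt_mono)
  thus ?thesis by (rule filt_cong) (use ug(2) in auto)
qed


section \<open>The curve as a double cover of the y-line\<close>

definition trace_poly :: "'k poly" where
  "trace_poly = smult (1 / a) (monom 1 p + [:c, -1:])"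

lemma poly_trace_poly: "poly trace_poly y = (y ^ p - y + c) / a"
  by (simp add: trace_poly_def poly_monom field_simps)

lemma degree_trace_poly: "degree trace_poly = p"
proof -
  have "degree (monom 1 p + [:c, -1:] :: 'k poly) = p"
    using p_gt_2 by (subst degree_add_eq_left) (auto simp: degree_monom_eq)
  thus ?thesis using a0 by (simp add: trace_poly_def)
qed

lemma trace_poly_nz: "trace_poly \<noteq> 0"
  using degree_trace_poly p_gt_2 by auto

lemma pderiv_trace_poly: "pderiv trace_poly = [:- 1 / a:]"
proof -
  have "(of_nat p :: 'k) = 0" using CHAR_p of_nat_CHAR by metis
  thus ?thesis
    by (simp add: trace_poly_def pderiv_smult pderiv_add pderiv_monom pderiv_pCons)
qed

text \<open>The Lucas sequence of \<open>x\<^sup>2 = trace_poly * x - b / a\<close>: the coefficient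
  of \<open>x\<close> when \<open>x ^ n\<close> is reduced to a linear expression in
  \<open>x\<close>.\<close>

fun lucas_u :: "nat \<Rightarrow> 'k poly" where
  "lucas_u 0 = 0"
| "lucas_u (Suc 0) = 1"
| "lucas_u (Suc (Suc n)) = trace_poly * lucas_u (Suc n) + smult (- (b / a)) (lucas_u n)"

text \<open>The companion sequence: \<open>x ^ n + z ^ n\<close> for the conjugate \<open>z\<close>
  of \<open>x\<close>.\<close>

fun lucas_v :: "nat \<Rightarrow> 'k poly" where
  "lucas_v 0 = 2"
| "lucas_v (Suc 0) = trace_poly"
| "lucas_v (Suc (Suc n)) = trace_poly * lucas_v (Suc n) + smult (- (b / a)) (lucas_v n)"

text \<open>The exact degree, rather than a bound, lets \<open>zeros_le_pole_order\<close> recognise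
  the top term of a function.\<close>

lemma lucas_u_degree: "degree (lucas_u (Suc n)) = n * p \<and> lucas_u (Suc n) \<noteq> 0"
proof (induction n rule: less_induct)
  case (less n)
  show ?case
  proof (cases n)
    case (Suc m)
    have m: "degree (lucas_u (Suc m)) = m * p" "lucas_u (Suc m) \<noteq> 0"
      using less[of m] Suc by auto
    have d1: "degree (trace_poly * lucas_u (Suc m)) = n * p"
      using m trace_poly_nz by (subst degree_mult_eq) (auto simp: degree_trace_poly Suc)
    have "degree (smult (- (b / a)) (lucas_u m)) \<le> m * p"
    proof (cases m)
      case (Suc l)
      thus ?thesis using less[of l] \<open>n = Suc m\<close> a0 b0 by simp
    qed auto
    hence d2: "degree (smult (- (b / a)) (lucas_u m)) < n * p"
      using p_gt_2 Suc by simp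
    have "degree (lucas_u (Suc n)) = n * p"
      unfolding Suc lucas_u.simps using d1 d2 by (subst degree_add_eq_left) (auto simp: Suc)
    moreover from this have "lucas_u (Suc n) \<noteq> 0" using p_gt_2 Suc by auto
    ultimately show ?thesis by blast
  qed auto
qed

lemma lucas_v_degree: "degree (lucas_v n) \<le> n * p"
proof (induction n rule: lucas_v.induct)
  case (3 n)
  have "degree (trace_poly * lucas_v (Suc n)) \<le> p + Suc n * p"
    using degree_mult_le[of trace_poly "lucas_v (Suc n)"] 3 degree_trace_poly by linarith
  moreover have "degree (smult (- (b / a)) (lucas_v n)) \<le> n * p"
    using degree_smult_le 3 le_trans by blast
  ultimately show ?case unfolding lucas_v.simps by (intro degree_add_le) auto
qed (auto simp: degree_trace_poly)

lemma curve_quadratic: "(x, y) \<in> curve \<longleftrightarrow> x\<^sup>2 = poly trace_poly y * x - b / a"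
proof
  assume *: "(x, y) \<in> curve"
  hence "x\<^sup>2 * a = (y ^ p - y + c) * x - b"
    by (auto simp: curve_def algebra_simps)
  hence "x\<^sup>2 = ((y ^ p - y + c) * x - b) / a" using a0 by (simp add: eq_divide_eq)
  thus "x\<^sup>2 = poly trace_poly y * x - b / a"
    by (simp add: poly_trace_poly diff_divide_distrib)
next
  assume *: "x\<^sup>2 = poly trace_poly y * x - b / a"
  have "x \<noteq> 0" using * a0 b0 by auto
  have "a * x\<^sup>2 = a * (poly trace_poly y * x - b / a)" using * by simp
  also have "\<dots> = (a * poly trace_poly y) * x - b" using a0 by (simp add: right_diff_distrib)
  also have "a * poly trace_poly y = y ^ p - y + c" using a0 by (simp add: poly_trace_poly)
  finally have "a * x\<^sup>2 + b = x * (y ^ p - y + c)" by (simp add: mult.commute)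
  with \<open>x \<noteq> 0\<close> show "(x, y) \<in> curve" by (simp add: curve_def)
qed

lemma curve_x_nz: "(x, y) \<in> curve \<Longrightarrow> x \<noteq> 0"
  by (simp add: curve_def)

lemma curve_trace:
  assumes "(x, y) \<in> curve"
  shows "x + b / (a * x) = poly trace_poly y"
proof -
  have "x * (x + b / (a * x)) = x * poly trace_poly y"
    using assms curve_x_nz[OF assms] a0 unfolding curve_quadratic
    by (simp add: algebra_simps power2_eq_square)
  thus ?thesis using curve_x_nz[OF assms] by simp
qed

lemma curve_conj:
  assumes "(x, y) \<in> curve"
  shows "(b / (a * x), y) \<in> curve"
proof -
  have "(b / (a * x)) * (x + b / (a * x)) = (b / (a * x)) * poly trace_poly y"
    using curve_trace[OF assms] by simp
  thus ?thesis using curve_x_nz[OF assms] a0 unfolding curve_quadratic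
    by (simp add: algebra_simps power2_eq_square)
qed

lemma curve_fiber:
  assumes "(x, y) \<in> curve" "(z, y) \<in> curve"
  shows "z = x \<or> z = b / (a * x)"
proof -
  define w where "w = b / (a * x)"
  have xw: "x * w = b / a" using curve_x_nz[OF assms(1)] by (simp add: w_def)
  have "(z - x) * (z - w) = z\<^sup>2 - (x + w) * z + x * w"
    by (simp add: algebra_simps power2_eq_square)
  also have "\<dots> = z\<^sup>2 - poly trace_poly y * z + b / a"
    using curve_trace[OF assms(1)] unfolding xw by (simp add: w_def)
  also have "\<dots> = 0" using assms(2) unfolding curve_quadratic by simp
  finally show ?thesis by (auto simp: w_def)
qed

lemma curve_surj: "\<exists>x. (x, y) \<in> curve"
proof -
  have "degree [: b / a, - poly trace_poly y, 1:] > 0" by simp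
  from alg_closed_imp_poly_has_root[OF this] obtain x where
    "poly [: b / a, - poly trace_poly y, 1:] x = 0" by blast
  hence "x\<^sup>2 = poly trace_poly y * x - b / a"
    by (simp add: algebra_simps power2_eq_square eq_diff_eq add_eq_0_iff)
  thus ?thesis using curve_quadratic by blast
qed

lemma power_eq_lucas_u:
  assumes "(x, y) \<in> curve"
  shows "x ^ Suc n = poly (lucas_u (Suc n)) y * x - b / a * poly (lucas_u n) y"
proof (induction n)
  case (Suc n)
  have "x ^ Suc (Suc n) = (poly (lucas_u (Suc n)) y * x - b / a * poly (lucas_u n) y) * x"
    using Suc by simp
  also have "\<dots> = poly (lucas_u (Suc n)) y * x\<^sup>2 - b / a * poly (lucas_u n) y * x"
    by (simp add: algebra_simps power2_eq_square)
  also have "x\<^sup>2 = poly trace_poly y * x - b / a" using assms curve_quadratic by blast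
  finally show ?case by (simp add: algebra_simps)
qed auto

lemma power_sum_eq_lucas_v:
  assumes "x + z = poly trace_poly y" "x * z = b / a"
  shows "x ^ n + z ^ n = poly (lucas_v n) y"
proof (induction n rule: lucas_v.induct)
  case 2
  thus ?case using assms by simp
next
  case (3 n)
  have "x ^ Suc (Suc n) + z ^ Suc (Suc n)
      = (x + z) * (x ^ Suc n + z ^ Suc n) - (x * z) * (x ^ n + z ^ n)"
    by (simp add: algebra_simps)
  also have "\<dots> = poly trace_poly y * poly (lucas_v (Suc n)) y - b / a * poly (lucas_v n) y"
    unfolding assms 3 ..
  finally show ?case by simp
qed auto

text \<open>Factoring out powers of the constant \<open>x * z\<close> leaves a power sum whose index
  is the difference of \<open>i\<close> and \<open>j\<close>. This saving keeps the degree of the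
  norm at most the pole order.\<close>

lemma mixed_power_sum:
  assumes "x + z = poly trace_poly y" "x * z = b / a"
  shows "x ^ i * z ^ j + z ^ i * x ^ j
       = (b / a) ^ min i j * poly (lucas_v (max i j - min i j)) y"
proof -
  have *: "x ^ i * z ^ j + z ^ i * x ^ j = (b / a) ^ i * poly (lucas_v (j - i)) y"
    if "i \<le> j" for i j
  proof -
    from that obtain d where j: "j = i + d" using le_Suc_ex by blast
    have "x ^ i * z ^ j + z ^ i * x ^ j = (x * z) ^ i * (x ^ d + z ^ d)"
      unfolding j power_mult_distrib by (simp add: power_add algebra_simps)
    thus ?thesis unfolding power_sum_eq_lucas_v[OF assms] unfolding assms by (simp add: j)
  qed
  show ?thesis
  proof (cases "i \<le> j")
    case True
    thus ?thesis using *[OF True] by (simp add: min_def max_def)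
  next
    case False
    thus ?thesis using *[of j i] by (simp add: min_def max_def add.commute mult.commute)
  qed
qed

text \<open>
  The curve is a double cover of the \<open>y\<close>-line with conjugation \<open>x \<mapsto> b / (a x)\<close>. The norm of \<open>h\<close>
  to \<open>K[y]\<close> (times 2, to keep the formula symmetric) has degree at most \<open>E\<close> and vanishes below
  the zeros of \<open>h\<close>. It is not zero because \<open>T\<^sup>2 - 4 b / a\<close> has a simple root, so is not a square.
\<close>
theorem zeros_le_pole_order:
  assumes E: "E \<in> orders" and rE: "r E \<noteq> 0"
    and h: "\<And>x y. (x, y) \<in> curve \<Longrightarrow> h x y = (\<Sum>k\<in>{..E} \<inter> orders. r k * monomial k x y)"
  shows "finite {(x, y) \<in> curve. h x y = 0} \<and> card {(x, y) \<in> curve. h x y = 0} \<le> E"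
proof -
  define S where "S = {..E} \<inter> orders"
  have finS: "finite S" and ES: "E \<in> S" using E by (auto simp: S_def)
  \<comment> \<open>Two forms of the norm: \<open>N2\<close>, in symmetric functions, displays the
    degree; \<open>NN\<close> below, the norm of \<open>A + B * x\<close>, displays that it is not
    zero.\<close>
  define N2 where "N2 = (\<Sum>k\<in>S. \<Sum>l\<in>S. smult (r k * r l * (b / a) ^ min (k div p) (l div p))
     (monom 1 (k mod p + l mod p) * lucas_v (max (k div p) (l div p) - min (k div p) (l div p))))"
  \<comment> \<open>\<open>x ^ i\<close> equals \<open>W i + lucas_u i * x\<close> on the curve. The
    value at \<open>i = 0\<close> stands for a Lucas term of index -1.\<close>
  define W where "W = (\<lambda>i. if i = 0 then 1 else smult (- (b / a)) (lucas_u (i - 1)))"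
  define A where "A = (\<Sum>k\<in>S. smult (r k) (monom 1 (k mod p) * W (k div p)))"
  define B where "B = (\<Sum>k\<in>S. smult (r k) (monom 1 (k mod p) * lucas_u (k div p)))"
  define NN where "NN = A\<^sup>2 + A * B * trace_poly + smult (b / a) (B\<^sup>2)"

  have hAB: "h x y = poly A y + poly B y * x" if "(x, y) \<in> curve" for x y
  proof -
    have pw: "x ^ i = poly (W i) y + poly (lucas_u i) y * x" for i
      using power_eq_lucas_u[OF that, of "i - 1"] by (cases i) (auto simp: W_def)
    have "h x y = (\<Sum>k\<in>S. r k * (x ^ (k div p) * y ^ (k mod p)))"
      using h[OF that] by (simp add: S_def monomial_def)
    also have "\<dots> = poly A y + poly B y * x"
      unfolding A_def B_def
      by (simp add: pw poly_sum poly_monom sum_distrib_left sum_distrib_right sum.distrib algebra_simps)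
    finally show ?thesis .
  qed

  have N2_val: "poly N2 y = 2 * (h x y * h (b / (a * x)) y)" if "(x, y) \<in> curve" for x y
  proof -
    define z where "z = b / (a * x)"
    have xz: "x + z = poly trace_poly y" "x * z = b / a"
      using curve_trace[OF that] curve_x_nz[OF that] by (simp_all add: z_def)
    have h1: "h x y = (\<Sum>k\<in>S. r k * (x ^ (k div p) * y ^ (k mod p)))"
      using h[OF that] by (simp add: S_def monomial_def)
    have h2: "h z y = (\<Sum>k\<in>S. r k * (z ^ (k div p) * y ^ (k mod p)))"
      using h[OF curve_conj[OF that]] by (simp add: S_def monomial_def z_def)
    have "poly N2 y = (\<Sum>k\<in>S. \<Sum>l\<in>S. r k * r l * y ^ (k mod p + l mod p) *
       ((b / a) ^ min (k div p) (l div p) * poly (lucas_v (max (k div p) (l div p) - min (k div p) (l div p))) y))"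
      unfolding N2_def by (simp add: poly_sum poly_monom mult_ac)
    also have "\<dots> = (\<Sum>k\<in>S. \<Sum>l\<in>S. r k * r l * y ^ (k mod p + l mod p) *
       (x ^ (k div p) * z ^ (l div p) + z ^ (k div p) * x ^ (l div p)))"
      unfolding mixed_power_sum[OF xz] ..
    also have "\<dots> = h x y * h z y + h z y * h x y"
      unfolding h1 h2 sum_product sum.distrib[symmetric]
      by (intro sum.cong refl) (simp add: power_add algebra_simps)
    finally show ?thesis by (simp add: z_def)
  qed

  have deg: "degree N2 \<le> E"
    unfolding N2_def
  proof (intro degree_sum_le finS)
    fix k l assume kl: "k \<in> S" "l \<in> S"
    let ?i = "k div p" and ?j = "l div p"
    have "k mod p \<le> ?i * p" "l mod p \<le> ?j * p" using kl by (auto simp: S_def intro: ordersD)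
    moreover have "?i * p + k mod p \<le> E" "?j * p + l mod p \<le> E" using kl by (auto simp: S_def)
    \<comment> \<open>For whichever of \<open>k\<close>, \<open>l\<close> has the smaller power of
      \<open>x\<close>, the power of \<open>y\<close> is absorbed by \<open>p\<close> times that
      power of \<open>x\<close>; what remains is at most the other index.\<close>
    ultimately have bd: "k mod p + l mod p + (max ?i ?j - min ?i ?j) * p \<le> E"
      by (cases "?i \<le> ?j") (auto simp: min_def max_def diff_mult_distrib)
    have "degree (monom (1::'k) (k mod p + l mod p) * lucas_v (max ?i ?j - min ?i ?j))
        \<le> k mod p + l mod p + (max ?i ?j - min ?i ?j) * p"
      using degree_mult_le[of "monom (1::'k) (k mod p + l mod p)" "lucas_v (max ?i ?j - min ?i ?j)"]
        lucas_v_degree[of "max ?i ?j - min ?i ?j"] degree_monom_le[of "1::'k" "k mod p + l mod p"]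
      by linarith
    with bd show "degree (smult (r k * r l * (b / a) ^ min ?i ?j)
      (monom 1 (k mod p + l mod p) * lucas_v (max ?i ?j - min ?i ?j))) \<le> E"
      using degree_smult_le order.trans by (metis (no_types, lifting))
  qed

  have N2_NN: "N2 = smult 2 NN"
  proof (rule poly_eqI_alg_closed)
    fix y
    obtain x where x: "(x, y) \<in> curve" using curve_surj by blast
    define z where "z = b / (a * x)"
    have xz: "x + z = poly trace_poly y" "x * z = b / a"
      using curve_trace[OF x] curve_x_nz[OF x] by (simp_all add: z_def)
    have "h x y * h z y = (poly A y)\<^sup>2 + poly A y * poly B y * (x + z) + x * z * (poly B y)\<^sup>2"
      using hAB[OF x] hAB[OF curve_conj[OF x]] by (simp add: z_def[symmetric] algebra_simps power2_eq_square)
    thus "poly N2 y = poly (smult 2 NN) y"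
      using N2_val[OF x] unfolding xz by (simp add: NN_def z_def[symmetric])
  qed

  have AB: "A \<noteq> 0 \<or> B \<noteq> 0"
  proof (cases "E = 0")
    case True
    hence "S = {0}" using E by (auto simp: S_def)
    hence "A = [:r 0:]" by (simp add: A_def W_def monom_0)
    thus ?thesis using rE True by auto
  next
    case False
    hence Ep: "E \<ge> p" using E by (auto simp: orders_def)
    have degk: "degree (monom (1::'k) (k mod p) * lucas_u (k div p)) = k - p" if "p \<le> k" for k
    proof -
      have "k div p > 0" using that p_gt_2 by (simp add: div_greater_zero_iff)
      then obtain i where i: "k div p = Suc i" using gr0_implies_Suc by blast
      have "k = Suc i * p + k mod p" using i by (metis div_mult_mod_eq)
      moreover have "degree (monom (1::'k) (k mod p) * lucas_u (Suc i)) = k mod p + i * p"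
        using lucas_u_degree[of i] by (subst degree_mult_eq) (auto simp: degree_monom_eq)
      ultimately show ?thesis by (simp add: i)
    qed
    \<comment> \<open>The term of \<open>k\<close> in \<open>B\<close> has degree
      \<open>k - p\<close>, so only \<open>k = E\<close> reaches the coefficient
      \<open>E - p\<close>; for \<open>k = 0\<close> the term vanishes since
      \<open>lucas_u 0 = 0\<close>.\<close>
    have "coeff B (E - p) = (\<Sum>k\<in>S. r k * coeff (monom 1 (k mod p) * lucas_u (k div p)) (E - p))"
      unfolding B_def by (simp add: coeff_sum)
    also have "\<dots> = (\<Sum>k\<in>{E}. r k * coeff (monom 1 (k mod p) * lucas_u (k div p)) (E - p))"
    proof (intro sum.mono_neutral_right finS ballI)
      fix k assume k: "k \<in> S - {E}"
      show "r k * coeff (monom 1 (k mod p) * lucas_u (k div p)) (E - p) = 0"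
      proof (cases "k = 0")
        case False
        hence "p \<le> k" "k < E" using k by (auto simp: S_def orders_def)
        hence "degree (monom (1::'k) (k mod p) * lucas_u (k div p)) < E - p"
          using degk[of k] by simp
        thus ?thesis by (simp add: coeff_eq_0)
      qed auto
    qed (use ES in auto)
    also have "\<dots> = r E * lead_coeff (monom 1 (E mod p) * lucas_u (E div p))"
      using degk[OF Ep] by simp
    also have "\<dots> \<noteq> 0"
    proof -
      have "E div p > 0" using Ep p_gt_2 by (simp add: div_greater_zero_iff)
      then obtain i where i: "E div p = Suc i" using gr0_implies_Suc by blast
      have "lucas_u (E div p) \<noteq> 0" using lucas_u_degree[of i] i by simp
      thus ?thesis using rE by simp
    qed
    finally show ?thesis by auto
  qed

  have NN0: "NN \<noteq> 0"
  proof
    assume 0: "NN = 0"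
    obtain t where t: "t\<^sup>2 = b / a" using nth_root_exists[of 2 "b / a"] by auto
    have t0: "t \<noteq> 0" using t a0 b0 by auto
    define D where "D = trace_poly\<^sup>2 - [:4 * (b / a):]"
    obtain y0 where "poly (trace_poly - [:2 * t:]) y0 = 0"
    proof -
      have "degree (trace_poly + [:- (2 * t):]) = p"
        using p_gt_2 degree_trace_poly by (subst degree_add_eq_left) auto
      moreover have "trace_poly + [:- (2 * t):] = trace_poly - [:2 * t:]"
        by (rule poly_eqI_alg_closed) simp
      ultimately have "degree (trace_poly - [:2 * t:]) = p" by simp
      hence "degree (trace_poly - [:2 * t:]) > 0" using p_gt_2 by simp
      thus ?thesis using that alg_closed_imp_poly_has_root by blast
    qed
    hence y0: "poly trace_poly y0 = 2 * t" by simp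
    have D0: "poly D y0 = 0" using y0 t by (simp add: D_def power_mult_distrib)
    \<comment> \<open>As \<open>p = 0\<close> in the field, \<open>trace_poly\<close> has constant
      derivative \<open>- 1 / a\<close>, and the derivative of \<open>D\<close> at \<open>y0\<close>
      is \<open>- 4 * t / a\<close>.\<close>
    have D1: "poly (pderiv D) y0 \<noteq> 0"
      using a0 t0 two0 mult_eq_0_iff[of "2::'k" 2] y0 by (simp add: D_def pderiv_diff power2_eq_square pderiv_mult pderiv_trace_poly pderiv_pCons)
    have ordD: "order y0 D = 1" by (rule order_eq_1_if_simple_root[OF D0 D1])
    \<comment> \<open>Completing the square: \<open>NN = 0\<close> would make
      \<open>B\<^sup>2 * D\<close> a square, although its order at \<open>y0\<close> is odd.\<close>
    have sq: "(smult 2 A + B * trace_poly)\<^sup>2 = B\<^sup>2 * D"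
    proof -
      have "(smult 2 A + B * trace_poly)\<^sup>2 - B\<^sup>2 * D = smult 4 NN"
        by (rule poly_eqI_alg_closed) (simp add: D_def NN_def power2_eq_square algebra_simps)
      thus ?thesis using 0 by simp
    qed
    have B0: "B \<noteq> 0"
    proof
      assume "B = 0"
      hence "A = 0" using 0 by (simp add: NN_def)
      with \<open>B = 0\<close> AB show False by blast
    qed
    have D_nz: "D \<noteq> 0" using D1 by auto
    have "order y0 (B\<^sup>2 * D) = 2 * order y0 B + 1"
      using B0 D_nz ordD by (simp add: order_mult power2_eq_square)
    moreover have "smult 2 A + B * trace_poly \<noteq> 0" using sq B0 D_nz by auto
    hence "order y0 ((smult 2 A + B * trace_poly)\<^sup>2) = 2 * order y0 (smult 2 A + B * trace_poly)"
      by (simp add: order_mult power2_eq_square)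
    ultimately have "2 * order y0 (smult 2 A + B * trace_poly) = 2 * order y0 B + 1"
      using sq by simp
    thus False by presburger
  qed
  have N20: "N2 \<noteq> 0" using NN0 N2_NN two0 by simp

  define R where "R = {y. poly N2 y = 0}"
  have finR: "finite R" unfolding R_def by (rule poly_roots_finite[OF N20])
  define F where "F = (\<lambda>y. {x. (x, y) \<in> curve \<and> h x y = 0})"
  have F: "finite (F y) \<and> card (F y) \<le> order y N2 \<and> (F y \<noteq> {} \<longrightarrow> y \<in> R)" for y
  proof (cases "F y = {}")
    case False
    then obtain x where x: "(x, y) \<in> curve" "h x y = 0" by (auto simp: F_def)
    let ?z = "b / (a * x)"
    have sub: "F y \<subseteq> {x, ?z}" using curve_fiber[OF x(1)] by (auto simp: F_def)
    have root: "poly N2 y = 0" using N2_val[OF x(1)] x(2) by simp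
    hence ord1: "order y N2 \<ge> 1" using N20 order_root[of N2 y] by auto
    show ?thesis
    proof (cases "F y \<subseteq> {x}")
      case True
      hence "card (F y) \<le> 1" using card_mono[of "{x}" "F y"] by simp
      thus ?thesis using ord1 root sub finite_subset by (auto simp: R_def)
    next
      case False
      hence z: "?z \<noteq> x" "h ?z y = 0" using sub by (auto simp: F_def)
      have e1: "poly A y + poly B y * x = 0" using hAB[OF x(1)] x(2) by simp
      have e2: "poly A y + poly B y * ?z = 0" using hAB[OF curve_conj[OF x(1)]] z by simp
      \<comment> \<open>Two distinct zeros above \<open>y\<close> force \<open>A\<close> and
        \<open>B\<close> both to vanish at \<open>y\<close>, so the norm vanishes there to order
        2.\<close>
      have "poly B y * x = poly B y * ?z" using e1 e2 by (metis add_left_cancel)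
      hence B0: "poly B y = 0" using z(1) unfolding mult_cancel_left by simp
      hence A0: "poly A y = 0" using e1 by simp
      obtain A' where A': "A = [:-y, 1:] * A'" using A0 poly_eq_0_iff_dvd by blast
      obtain B' where B': "B = [:-y, 1:] * B'" using B0 poly_eq_0_iff_dvd by blast
      have "NN = [:-y, 1:]\<^sup>2 * (A'\<^sup>2 + A' * B' * trace_poly + smult (b / a) (B'\<^sup>2))"
        by (rule poly_eqI_alg_closed) (simp add: NN_def A' B' power2_eq_square algebra_simps)
      hence "[:-y, 1:] ^ 2 dvd N2" unfolding N2_NN by (simp add: dvd_smult)
      hence "order y N2 \<ge> 2" using N20 order_divides by blast
      moreover have "card (F y) \<le> 2" using card_mono[OF _ sub] card_insert_le_m1[of 2 "{?z}" x] by fastforce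
      ultimately show ?thesis using root sub finite_subset by (auto simp: R_def)
    qed
  qed auto
  have Z: "{(x, y) \<in> curve. h x y = 0} = prod.swap ` (SIGMA y:R. F y)"
    using F by (force simp: F_def image_iff)
  have "finite (SIGMA y:R. F y)" using finR F by auto
  moreover have "card (SIGMA y:R. F y) \<le> E"
  proof -
    have "card (SIGMA y:R. F y) = (\<Sum>y\<in>R. card (F y))" using finR F by (simp add: card_SigmaI)
    also have "\<dots> \<le> (\<Sum>y\<in>R. order y N2)" using F by (intro sum_mono) auto
    also have "\<dots> = size (proots N2)" using N20 by (simp add: size_multiset_overloaded_eq R_def)
    also have "\<dots> \<le> degree N2" by (rule size_proots_le)
    finally show ?thesis using deg by linarith
  qed
  moreover have "card (prod.swap ` (SIGMA y:R. F y)) \<le> card (SIGMA y:R. F y)"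
    by (rule card_image_le) fact
  ultimately show ?thesis unfolding Z by auto
qed

section \<open>The auxiliary function of Stepanov and Bombieri\<close>

lemma card_orders_lessThan: "p \<le> n \<Longrightarrow> card ({..<n} \<inter> orders) = n - p + 1"
proof -
  assume n: "p \<le> n"
  have "{..<n} \<inter> orders = insert 0 {p..<n}"
    using n p_gt_2 by (auto simp: orders_def)
  thus ?thesis using p_gt_2 by simp
qed

lemma monomial_mult_power:
  "monomial k x y ^ m * monomial i x y ^ n =
   x ^ (m * (k div p) + n * (i div p)) * y ^ (m * (k mod p) + n * (i mod p))"
  by (simp add: monomial_def power_mult_distrib power_add power_mult[symmetric] mult_ac)

lemma combined_exponent:
  "(m * (k div p) + n * (i div p)) * p + (m * (k mod p) + n * (i mod p)) = m * k + n * i"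
proof -
  have "m * k + n * i = m * (k div p * p + k mod p) + n * (i div p * p + i mod p)" by simp
  also have "\<dots> = (m * (k div p) + n * (i div p)) * p + (m * (k mod p) + n * (i mod p))"
    by (simp only: algebra_simps)
  finally show ?thesis ..
qed

lemma combined_exponent_le:
  assumes "k \<in> orders" "i \<in> orders"
  shows "m * (k mod p) + n * (i mod p) \<le> (m * (k div p) + n * (i div p)) * p"
proof -
  have "m * (k mod p) + n * (i mod p) \<le> m * (k div p * p) + n * (i div p * p)"
    by (intro add_mono mult_left_mono ordersD assms) auto
  thus ?thesis by (simp add: algebra_simps)
qed

text \<open>
  Bombieri's argument. Write \<open>e\<^sub>k\<close> for \<open>monomial k\<close>. Linear algebra yields \<open>h = \<Sum> s\<^sub>i\<^sub>k e\<^sub>k e\<^sub>i\<^sup>Q\<close> whose \<open>Q\<close>-th power agrees, at points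
  rational over the field with \<open>Q\<^sup>2\<close> elements, with \<open>\<Sum> s\<^sub>i\<^sub>k\<^sup>Q e\<^sub>k\<^sup>Q e\<^sub>i = 0\<close>. As \<open>k < Q\<close>, the pole orders
  \<open>k + Q i\<close> are distinct and \<open>h\<close> is not zero.
\<close>
theorem rational_points_le:
  assumes Q: "Q = p ^ \<mu>" "p\<^sup>2 \<le> Q"
  defines "P \<equiv> {(x, y) \<in> curve. x ^ (Q * Q) = x \<and> y ^ (Q * Q) = y}"
  shows "finite P \<and> card P \<le> Q\<^sup>2 + (2 * p + 1) * Q"
proof -
  have Q0: "Q > 0" using Q p_gt_2 by simp
  have pQ: "p \<le> Q" 
  proof -
    have "p * 1 \<le> p * p" using p_gt_2 by (intro mult_left_mono) auto
    also have "\<dots> \<le> Q" using Q(2) by (simp add: power2_eq_square)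
    finally show ?thesis by simp
  qed
  define ks where "ks = {..<Q} \<inter> orders"
  \<comment> \<open>The range of \<open>i\<close> exceeds \<open>Q\<close> to make up for the gaps:
    there are \<open>(Q + p + 2) * (Q - p + 1)\<close> unknowns, more than the
    \<open>Q\<^sup>2 + p + 2\<close> equations because \<open>p\<^sup>2 \<le> Q\<close>.\<close>
  define js where "js = {..<Q + 2 * p + 1} \<inter> orders"
  \<comment> \<open>The pole orders \<open>Q * k + i\<close> are at most
    \<open>Q * (Q - 1) + Q + 2 * p\<close>, hence below \<open>N\<close>.\<close>
  define N where "N = Q\<^sup>2 + 2 * p + 1"
  define J where "J = {..<N} \<inter> orders"
  define I where "I = js \<times> ks"
  have fin: "finite I" "finite J" by (auto simp: I_def js_def ks_def J_def)
  have "card J = N - p + 1" unfolding J_def by (rule card_orders_lessThan) (simp add: N_def)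
  hence cJ: "card J = Q\<^sup>2 + p + 2" by (simp add: N_def)
  have "card js = Q + p + 2" "card ks = Q - p + 1"
    using pQ by (simp_all add: js_def ks_def card_orders_lessThan)
  hence "card I = (Q + p + 2) * (Q - p + 1)"
    by (simp add: I_def card_cartesian_product)
  moreover have "(Q + p + 2) * (Q - p + 1) > Q\<^sup>2 + p + 2"
  proof -
    obtain d where d: "Q = p + d" using pQ le_Suc_ex by blast
    have "3 * (p * p) \<le> 3 * Q" using Q(2) by (simp add: power2_eq_square)
    moreover have "3 * p \<le> p * p" using p_gt_2 by simp
    ultimately have "p * p + 3 * p < 3 * Q" using p_gt_2 by linarith
    moreover have "(Q + p + 2) * (Q - p + 1) + p * p + p = Q\<^sup>2 + 3 * Q + 2"
      by (simp add: d power2_eq_square algebra_simps)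
    ultimately show ?thesis by linarith
  qed
  ultimately have card_lt: "card J < card I" using cJ by simp

  have "\<exists>r. \<forall>(x, y)\<in>curve. monomial (snd ik) x y ^ Q * monomial (fst ik) x y =
     (\<Sum>j\<in>J. r j * monomial j x y)" if "ik \<in> I" for ik
  proof -
    obtain i k where ik: "ik = (i, k)" by (cases ik)
    have o: "i \<in> orders" "k \<in> orders" and bd: "k + 1 \<le> Q" "i \<le> Q + 2 * p"
      using that by (auto simp: ik I_def js_def ks_def)
    have "Q * k + Q \<le> Q * Q" using bd(1) by (metis mult_le_mono2 mult_Suc_right Suc_eq_plus1 add.commute)
    hence lt: "Q * k + 1 * i < N" using bd by (simp add: N_def power2_eq_square)
    have "(\<lambda>x y. x ^ (Q * (k div p) + 1 * (i div p)) * y ^ (Q * (k mod p) + 1 * (i mod p))) \<in> filt N"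
      using combined_exponent[of Q k 1 i] lt
      by (intro power_filt combined_exponent_le o) simp
    hence "(\<lambda>x y. monomial k x y ^ Q * monomial i x y) \<in> filt N"
      by (rule filt_cong) (use monomial_mult_power[of k _ _ Q i 1] in simp)
    thus ?thesis unfolding filt_def J_def ik by auto
  qed
  note ex = this
  define M where "M = (\<lambda>ik. SOME r. \<forall>(x, y)\<in>curve.
     monomial (snd ik) x y ^ Q * monomial (fst ik) x y = (\<Sum>j\<in>J. r j * monomial j x y))"
  have M: "monomial (snd ik) x y ^ Q * monomial (fst ik) x y = (\<Sum>j\<in>J. M ik j * monomial j x y)"
    if "ik \<in> I" "(x, y) \<in> curve" for ik x y
    using someI_ex[OF ex[OF that(1)]] that(2) unfolding M_def by blast
  from homogeneous_system_nontrivial_solution[OF fin(2,1) card_lt, of M] obtain s where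
    s: "\<exists>ik\<in>I. s ik \<noteq> 0" "\<forall>j\<in>J. (\<Sum>ik\<in>I. s ik * M ik j) = 0" by blast
  have h1: "(\<Sum>ik\<in>I. s ik * (monomial (snd ik) x y ^ Q * monomial (fst ik) x y)) = 0"
    if "(x, y) \<in> curve" for x y
  proof -
    have "(\<Sum>ik\<in>I. s ik * (monomial (snd ik) x y ^ Q * monomial (fst ik) x y))
        = (\<Sum>ik\<in>I. \<Sum>j\<in>J. s ik * M ik j * monomial j x y)"
      using M[OF _ that] by (intro sum.cong) (auto simp: sum_distrib_left mult_ac)
    also have "\<dots> = (\<Sum>j\<in>J. (\<Sum>ik\<in>I. s ik * M ik j) * monomial j x y)"
      by (subst sum.swap) (simp add: sum_distrib_right)
    also have "\<dots> = 0" using s(2) by simp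
    finally show ?thesis .
  qed
  have "\<forall>ik. \<exists>t. t ^ Q = s ik" using nth_root_exists[OF Q0] by blast
  then obtain t where t: "\<And>ik. t ik ^ Q = s ik" by metis
  \<comment> \<open>The linear system determines \<open>s\<close>, the \<open>Q\<close>-th powers of
    the coefficients \<open>t\<close> of \<open>h\<close>; roots exist in an algebraically closed
    field.\<close>
  define h where "h = (\<lambda>x y. \<Sum>ik\<in>I. t ik * (monomial (snd ik) x y * monomial (fst ik) x y ^ Q))"
  have h_zero: "h x y = 0" if "(x, y) \<in> P" for x y
  proof -
    have xy: "(x, y) \<in> curve" "x ^ (Q * Q) = x" "y ^ (Q * Q) = y" using that by (auto simp: P_def)
    have mon: "(monomial i x y ^ Q) ^ Q = monomial i x y" for i
    proof -
      have "(monomial i x y ^ Q) ^ Q = (x ^ (Q * Q)) ^ (i div p) * (y ^ (Q * Q)) ^ (i mod p)"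
        by (simp add: monomial_def power_mult_distrib power_mult[symmetric] mult_ac)
      thus ?thesis using xy by (simp add: monomial_def)
    qed
    have "h x y ^ Q = (\<Sum>ik\<in>I. (t ik * (monomial (snd ik) x y * monomial (fst ik) x y ^ Q)) ^ Q)"
      unfolding h_def by (rule freshmans_dream_sum'[where n = \<mu>]) (use CHAR_p prime_p Q in auto)
    also have "\<dots> = (\<Sum>ik\<in>I. s ik * (monomial (snd ik) x y ^ Q * monomial (fst ik) x y))"
      by (simp add: power_mult_distrib t mon)
    also have "\<dots> = 0" by (rule h1[OF xy(1)])
    finally show ?thesis using Q0 by simp
  qed

  \<comment> \<open>The pole order of a term of \<open>h\<close>. The factor 1 matches the shape of
    \<open>combined_exponent\<close>.\<close>
  define w where "w = (\<lambda>ik. 1 * snd ik + Q * fst ik)"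
  define I' where "I' = {ik \<in> I. t ik \<noteq> 0}"
  have "finite I'" "I' \<noteq> {}" using fin s(1) t Q0 by (auto simp: I'_def) (metis power_eq_0_iff)
  then obtain top where top: "top \<in> I'" "\<And>ik. ik \<in> I' \<Longrightarrow> w ik \<le> w top"
  proof -
    have "finite (w ` I')" "w ` I' \<noteq> {}" using \<open>finite I'\<close> \<open>I' \<noteq> {}\<close> by auto
    from Max_in[OF this] obtain v where "v \<in> I'" "Max (w ` I') = w v" by blast
    with Max_ge[OF \<open>finite (w ` I')\<close>] show ?thesis by (intro that[of v]) auto
  qed
  have inj: "inj_on w I"
  proof (rule inj_onI)
    fix u v assume uv: "u \<in> I" "v \<in> I" "w u = w v"
    have lt: "snd u < Q" "snd v < Q" using uv by (auto simp: I_def ks_def)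
    have "snd u = w u mod Q" "fst u = w u div Q" "snd v = w v mod Q" "fst v = w v div Q"
      using lt by (auto simp: w_def)
    thus "u = v" using uv(3) by (simp add: prod_eq_iff)
  qed
  define E where "E = w top"
  have term_eq: "(\<lambda>x y. monomial (snd ik) x y * monomial (fst ik) x y ^ Q) =
      (\<lambda>x y. x ^ (1 * (snd ik div p) + Q * (fst ik div p)) * y ^ (1 * (snd ik mod p) + Q * (fst ik mod p)))" for ik
    using monomial_mult_power[of "snd ik" _ _ 1 "fst ik" Q] by (simp add: fun_eq_iff)
  have ord: "snd ik \<in> orders" "fst ik \<in> orders" if "ik \<in> I" for ik
    using that by (auto simp: I_def js_def ks_def)
  have topI: "top \<in> I" "t top \<noteq> 0" using top by (auto simp: I'_def)
  have "1 * (snd top mod p) + Q * (fst top mod p) \<le> (1 * (snd top div p) + Q * (fst top div p)) * p"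
    by (rule combined_exponent_le[OF ord[OF topI(1)]])
  note le = this
  from power_reduction[OF le, unfolded combined_exponent] obtain u g where
    ug: "u \<noteq> 0" "g \<in> filt E" "\<forall>(x, y)\<in>curve. monomial (snd top) x y * monomial (fst top) x y ^ Q = u * monomial E x y + g x y"
    unfolding term_eq[of top, THEN fun_cong, THEN fun_cong] E_def w_def by blast
  have E: "E \<in> orders"
    using orders_memI[OF le, unfolded combined_exponent] by (simp add: E_def w_def)
  define G where "G = (\<lambda>x y. t top * g x y +
     (\<Sum>ik\<in>I' - {top}. t ik * (monomial (snd ik) x y * monomial (fst ik) x y ^ Q)))"
  have "G \<in> filt E" unfolding G_def
  proof (intro filt_add filt_scale filt_sum ug(2))
    fix ik assume ik: "ik \<in> I' - {top}"
    hence ikI: "ik \<in> I" by (auto simp: I'_def)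
    have "w ik \<le> w top" using ik top by blast
    moreover have "w ik \<noteq> w top" using ik inj topI(1) ikI by (auto dest: inj_onD)
    ultimately have "w ik < E" by (simp add: E_def)
    thus "(\<lambda>x y. monomial (snd ik) x y * monomial (fst ik) x y ^ Q) \<in> filt E"
      unfolding term_eq by (intro power_filt combined_exponent_le ord ikI, unfold combined_exponent) (simp add: w_def)
  qed
  then obtain r where r: "\<And>x y. (x, y) \<in> curve \<Longrightarrow> G x y = (\<Sum>k\<in>{..<E} \<inter> orders. r k * monomial k x y)"
    by (elim filtE) blast
  define r' where "r' = r(E := t top * u)"
  have h_eq: "h x y = (\<Sum>k\<in>{..E} \<inter> orders. r' k * monomial k x y)" if xy: "(x, y) \<in> curve" for x y
  proof -
    have "h x y = (\<Sum>ik\<in>I'. t ik * (monomial (snd ik) x y * monomial (fst ik) x y ^ Q))"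
      unfolding h_def using fin by (intro sum.mono_neutral_right) (auto simp: I'_def)
    also have "\<dots> = t top * (u * monomial E x y + g x y) +
       (\<Sum>ik\<in>I' - {top}. t ik * (monomial (snd ik) x y * monomial (fst ik) x y ^ Q))"
      using top(1) \<open>finite I'\<close> ug(3) xy by (subst sum.remove[of I' top]) auto
    also have "\<dots> = t top * u * monomial E x y + G x y" by (simp add: G_def algebra_simps)
    also have "G x y = (\<Sum>k\<in>{..<E} \<inter> orders. r' k * monomial k x y)"
      unfolding r[OF xy] by (intro sum.cong) (auto simp: r'_def)
    also have "t top * u * monomial E x y + \<dots> = (\<Sum>k\<in>insert E ({..<E} \<inter> orders). r' k * monomial k x y)"
      by (subst sum.insert) (auto simp: r'_def)
    also have "insert E ({..<E} \<inter> orders) = {..E} \<inter> orders" using E by auto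
    finally show ?thesis .
  qed
  have "r' E \<noteq> 0" using topI ug(1) by (simp add: r'_def)
  from zeros_le_pole_order[OF E this h_eq] have
    Z: "finite {(x, y) \<in> curve. h x y = 0}" "card {(x, y) \<in> curve. h x y = 0} \<le> E" by blast+
  have sub: "P \<subseteq> {(x, y) \<in> curve. h x y = 0}" using h_zero by (auto simp: P_def)
  have "E \<le> Q\<^sup>2 + (2 * p + 1) * Q"
  proof -
    have "snd top \<le> Q" "fst top \<le> Q + 2 * p" using topI(1) by (auto simp: I_def ks_def js_def)
    hence "E \<le> Q + Q * (Q + 2 * p)" unfolding E_def w_def by (intro add_mono mult_left_mono) auto
    thus ?thesis by (simp add: power2_eq_square algebra_simps)
  qed
  thus ?thesis using Z finite_subset[OF sub] card_mono[OF Z(1) sub] by auto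
qed

end

section \<open>Additive characters\<close>

lemma expi_add: "expi (x + y) = expi x * expi y"
  by (simp add: expi_def exp_add[symmetric] algebra_simps)

lemma expi_0 [simp]: "expi 0 = 1"
  by (simp add: expi_def)

lemma expi_conv_cis: "expi x = cis (2 * pi * x)"
  by (simp add: expi_def cis_conv_exp mult_ac)

lemma expi_of_int [simp]: "expi (real_of_int n) = 1"
  unfolding expi_conv_cis by (rule cis_multiple_2pi) simp

lemma norm_expi [simp]: "norm (expi x) = 1"
  by (simp add: expi_def)

lemma expi_eq_1_iff: "expi x = 1 \<longleftrightarrow> x \<in> \<int>"
proof
  assume "expi x = 1"
  hence "cos (2 * pi * x) = 1" by (simp add: expi_conv_cis complex_eq_iff)
  then obtain n :: int where "2 * pi * x = of_int n * 2 * pi"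
    unfolding cos_one_2pi_int by blast
  hence "x = of_int n" by simp
  thus "x \<in> \<int>" by simp
qed (auto elim!: Ints_cases)

definition ephase :: "nat \<Rightarrow> int \<Rightarrow> complex" where
  "ephase c z = expi (real_of_int z / real c)"

lemma ephase_add: "ephase c (x + y) = ephase c x * ephase c y"
  by (simp add: ephase_def add_divide_distrib expi_add)

lemma ephase_0 [simp]: "ephase c 0 = 1"
  by (simp add: ephase_def)

lemma norm_ephase [simp]: "norm (ephase c z) = 1"
  by (simp add: ephase_def)

lemma ephase_eq_1_iff:
  assumes "c > 0"
  shows "ephase c z = 1 \<longleftrightarrow> int c dvd z"
proof
  assume "ephase c z = 1"
  then obtain n :: int where "real_of_int z / real c = of_int n"
    unfolding ephase_def expi_eq_1_iff by (auto elim: Ints_cases)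
  hence "real_of_int z = real_of_int (n * int c)" using assms by (simp add: field_simps)
  hence "z = n * int c" by (simp only: of_int_eq_iff)
  thus "int c dvd z" by simp
next
  assume "int c dvd z"
  then obtain n where "z = int c * n" by blast
  hence "real_of_int z / real c = of_int n" using assms by simp
  thus "ephase c z = 1" by (simp add: ephase_def)
qed

lemma ephase_cong:
  assumes "[x = y] (mod int c)"
  shows "ephase c x = ephase c y"
proof (cases "c = 0")
  case False
  obtain k where "x = y + k * int c"
    using assms by (metis cong_iff_lin cong_sym mult.commute)
  hence "ephase c x = ephase c y * ephase c (k * int c)" by (simp add: ephase_add)
  also have "ephase c (k * int c) = 1" using False by (simp add: ephase_eq_1_iff)
  finally show ?thesis by simp
qed (simp add: ephase_def)

section \<open>The L-function of Kloosterman sums\<close>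

text \<open>All fields with \<open>p ^ n\<close> elements are realised inside one algebraically
  closed field, as fixed points, so that their elements share a type.\<close>

locale frobenius_field =
  fixes a b :: "'k::alg_closed_field" and p :: nat
  assumes prime_p: "prime p" and CHAR_p: "CHAR('k) = p" and odd_p: "odd p"
    and a0: "a \<noteq> 0" and b0: "b \<noteq> 0" and a_rat: "a ^ p = a" and b_rat: "b ^ p = b"
begin

section \<open>Finite fields as fixed points of Frobenius\<close>

lemma p_gt_1: "p > 1"
  using prime_p by (rule prime_gt_1_nat)

lemma p_pos: "p > 0"
  using p_gt_1 by simp

text \<open>For \<open>n > 0\<close> the subfield with \<open>p ^ n\<close> elements;
  \<open>fixed 0\<close> is the whole field.\<close>

definition fixed :: "nat \<Rightarrow> 'k set" where
  "fixed n = {x. x ^ (p ^ n) = x}"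

lemma frob_add: "(x + y :: 'k) ^ (p ^ n) = x ^ (p ^ n) + y ^ (p ^ n)"
  by (rule freshmans_dream') (use prime_p CHAR_p in auto)

lemma frob_sum: "(sum f S :: 'k) ^ (p ^ n) = (\<Sum>i\<in>S. f i ^ (p ^ n))"
  by (rule freshmans_dream_sum') (use prime_p CHAR_p in auto)

lemma frob_uminus: "(- x :: 'k) ^ (p ^ n) = - (x ^ (p ^ n))"
  using odd_p by (simp add: power_minus_odd)

lemma frob_diff: "(x - y :: 'k) ^ (p ^ n) = x ^ (p ^ n) - y ^ (p ^ n)"
  using frob_add[of x "- y" n] frob_uminus[of y n] by simp

lemma frob_inj: "(x :: 'k) ^ (p ^ n) = y ^ (p ^ n) \<Longrightarrow> x = y"
proof -
  assume "x ^ (p ^ n) = y ^ (p ^ n)"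
  hence "(x - y) ^ (p ^ n) = 0" by (simp add: frob_diff)
  thus "x = y" using p_pos by simp
qed

lemma fixed_0: "0 \<in> fixed n" and fixed_1: "1 \<in> fixed n"
  using p_pos by (auto simp: fixed_def)

lemma fixed_add: "x \<in> fixed n \<Longrightarrow> y \<in> fixed n \<Longrightarrow> x + y \<in> fixed n"
  and fixed_diff: "x \<in> fixed n \<Longrightarrow> y \<in> fixed n \<Longrightarrow> x - y \<in> fixed n"
  and fixed_uminus: "x \<in> fixed n \<Longrightarrow> - x \<in> fixed n"
  and fixed_mult: "x \<in> fixed n \<Longrightarrow> y \<in> fixed n \<Longrightarrow> x * y \<in> fixed n"
  and fixed_divide: "x \<in> fixed n \<Longrightarrow> y \<in> fixed n \<Longrightarrow> x / y \<in> fixed n"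
  by (auto simp: fixed_def frob_add frob_diff frob_uminus power_mult_distrib power_divide)

lemma fixed_of_nat: "of_nat i \<in> fixed n"
  by (induction i) (auto intro: fixed_add fixed_0 fixed_1)

lemma fixed_of_int: "of_int i \<in> fixed n"
  by (cases i) (auto intro: fixed_of_nat fixed_uminus simp del: of_nat_Suc)

lemma fixed_Suc0: "x \<in> fixed (Suc 0) \<longleftrightarrow> x ^ p = x"
  by (simp add: fixed_def)

lemma fixed_prime_frob: "x \<in> fixed (Suc 0) \<Longrightarrow> x ^ (p ^ n) = x"
proof (induction n)
  case (Suc n)
  have "x ^ (p ^ Suc n) = (x ^ p) ^ (p ^ n)" by (simp add: power_mult)
  thus ?case using Suc by (simp add: fixed_Suc0)
qed auto

text \<open>The polynomial with these roots has derivative -1, so all its roots are simple.\<close>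

lemma finite_fixed: "n > 0 \<Longrightarrow> finite (fixed n)" and card_fixed: "n > 0 \<Longrightarrow> card (fixed n) = p ^ n"
proof -
  assume n: "n > 0"
  define f :: "'k poly" where "f = monom 1 (p ^ n) - monom 1 1"
  have pn: "p ^ n > 1" by (rule one_less_power[OF p_gt_1 n])
  have deg: "degree f = p ^ n"
  proof -
    have "degree (monom 1 (p ^ n) + (- monom 1 1 :: 'k poly)) = p ^ n"
      using pn by (subst degree_add_eq_left) (auto simp: degree_monom_eq)
    thus ?thesis by (simp add: f_def)
  qed
  hence "degree f > 0" using pn by linarith
  hence f0: "f \<noteq> 0" by auto
  have "(of_nat (p ^ n) :: 'k) = 0"
    using n by (simp add: of_nat_eq_0_iff_char_dvd CHAR_p)
  hence "pderiv f = - 1"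
    by (simp add: f_def pderiv_diff pderiv_monom monom_0 one_pCons del: of_nat_power)
  hence "card {x. poly f x = 0} = degree f" by (intro card_roots_simple f0) auto
  moreover have "{x. poly f x = 0} = fixed n" by (auto simp: f_def fixed_def poly_monom)
  ultimately show "card (fixed n) = p ^ n" using deg by simp
  show "finite (fixed n)"
    using poly_roots_finite[OF f0] by (simp add: f_def fixed_def poly_monom)
qed

lemma of_int_eq_iff: "(of_int z :: 'k) = of_int w \<longleftrightarrow> [z = w] (mod int p)"
  using of_int_eq_iff_cong_CHAR[where 'a = 'k] CHAR_p by simp

lemma inj_of_int: "inj_on (of_int :: int \<Rightarrow> 'k) {0..<int p}"
  by (rule inj_onI) (auto simp: of_int_eq_iff cong_def)

lemma prime_subfield: "fixed (Suc 0) = of_int ` {0..<int p}"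
proof -
  have "of_int ` {0..<int p} \<subseteq> fixed (Suc 0)" using fixed_of_int by auto
  moreover have "card (of_int ` {0..<int p} :: 'k set) = card (fixed (Suc 0))"
    using inj_of_int by (simp add: card_image card_fixed)
  ultimately have "of_int ` {0..<int p} = fixed (Suc 0)"
    by (intro card_subset_eq finite_fixed) auto
  thus ?thesis ..
qed

text \<open>The standard additive character on \<open>fixed (Suc 0)\<close>. The chosen integer is
  determined modulo \<open>p\<close>, which is all that \<open>ephase p\<close> sees.\<close>

definition psi :: "'k \<Rightarrow> complex" where
  "psi t = ephase p (SOME z. of_int z = t)"

lemma psi_of_int: "psi (of_int z) = ephase p z"
proof -
  have "of_int (SOME w. (of_int w :: 'k) = of_int z) = (of_int z :: 'k)" by (rule someI) simp
  thus ?thesis unfolding psi_def of_int_eq_iff by (rule ephase_cong)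
qed

lemma fixed_Suc0_E: "x \<in> fixed (Suc 0) \<Longrightarrow> (\<And>z. z \<in> {0..<int p} \<Longrightarrow> x = of_int z \<Longrightarrow> P) \<Longrightarrow> P"
  unfolding prime_subfield by blast

lemma psi_add: "x \<in> fixed (Suc 0) \<Longrightarrow> y \<in> fixed (Suc 0) \<Longrightarrow> psi (x + y) = psi x * psi y"
  by (elim fixed_Suc0_E) (simp add: psi_of_int ephase_add flip: of_int_add)

lemma norm_psi [simp]: "norm (psi x) = 1"
  by (simp add: psi_def)

lemma psi_0 [simp]: "psi 0 = 1"
  using psi_of_int[of 0] by simp

lemma psi_eq_1: "x \<in> fixed (Suc 0) \<Longrightarrow> psi x = 1 \<Longrightarrow> x = 0"
  using of_int_eq_iff[of _ 0]
  by (elim fixed_Suc0_E) (simp add: psi_of_int ephase_eq_1_iff p_pos cong_0_iff)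

lemma sum_psi:
  assumes "w \<in> fixed (Suc 0)"
  shows "(\<Sum>v\<in>fixed (Suc 0). psi (w * v)) = (if w = 0 then of_nat p else 0)"
proof (cases "w = 0")
  case False
  let ?S = "\<Sum>v\<in>fixed (Suc 0). psi (w * v)"
  have "?S = (\<Sum>v\<in>fixed (Suc 0). psi (w * (v + 1)))"
    by (rule sum.reindex_bij_witness[of _ "\<lambda>v. v + 1" "\<lambda>v. v - 1"])
       (auto intro: fixed_add fixed_diff fixed_1)
  also have "\<dots> = (\<Sum>v\<in>fixed (Suc 0). psi w * psi (w * v))"
    using assms by (intro sum.cong refl) (simp add: distrib_left psi_add fixed_mult mult.commute)
  also have "\<dots> = psi w * ?S" by (simp add: sum_distrib_left)
  finally have "(psi w - 1) * ?S = 0" by (simp add: algebra_simps)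
  moreover have "psi w \<noteq> 1" using psi_eq_1[OF assms] False by blast
  ultimately show ?thesis using False by simp
qed (simp add: card_fixed)

section \<open>Traces and the companion sums\<close>

definition frob_trace :: "nat \<Rightarrow> 'k \<Rightarrow> 'k" where
  "frob_trace n x = (\<Sum>i<n. x ^ (p ^ i))"

text \<open>Link to the Artin-Schreier equation: \<open>y\<close> lies in \<open>fixed n\<close>
  exactly when \<open>y ^ p - y\<close> has trace 0.\<close>

lemma frob_trace_telescope: "frob_trace n (y ^ p - y) = y ^ (p ^ n) - y"
proof -
  have "frob_trace n (y ^ p - y) = (\<Sum>i<n. y ^ (p ^ Suc i) - y ^ (p ^ i))"
    unfolding frob_trace_def frob_diff by (simp add: power_mult[symmetric])
  also have "\<dots> = y ^ (p ^ n) - y" by (subst sum_lessThan_telescope) simp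
  finally show ?thesis .
qed

lemma frob_trace_diff: "frob_trace n (x - y) = frob_trace n x - frob_trace n y"
  by (simp add: frob_trace_def frob_diff sum_subtractf)

lemma frob_trace_add: "frob_trace n (x + y) = frob_trace n x + frob_trace n y"
  by (simp add: frob_trace_def frob_add sum.distrib)

lemma frob_trace_scale: "u \<in> fixed (Suc 0) \<Longrightarrow> frob_trace n (u * x) = u * frob_trace n x"
  by (simp add: frob_trace_def power_mult_distrib fixed_prime_frob sum_distrib_left)

lemma frob_trace_rational: "x \<in> fixed n \<Longrightarrow> frob_trace n x \<in> fixed (Suc 0)"
proof -
  assume "x \<in> fixed n"
  hence "(frob_trace n x) ^ p - frob_trace n x = x ^ (p ^ n) - x"
    using frob_sum[of "\<lambda>i. x ^ (p ^ i)" "{..<n}" 1] frob_trace_telescope[of n x]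
    unfolding frob_trace_diff by (simp add: frob_trace_def power_mult[symmetric] mult.commute)
  thus ?thesis using \<open>x \<in> fixed n\<close> by (simp add: fixed_Suc0 fixed_def)
qed

definition phase :: "'k \<Rightarrow> 'k" where
  "phase x = a * x + b / x"

lemma ab_fixed: "a \<in> fixed (Suc 0)" "b \<in> fixed (Suc 0)"
  using a_rat b_rat by (auto simp: fixed_Suc0)

lemma prime_field_fixed: "x \<in> fixed (Suc 0) \<Longrightarrow> x \<in> fixed n"
  using fixed_prime_frob by (simp add: fixed_def)

lemma phase_fixed: "x \<in> fixed n \<Longrightarrow> phase x \<in> fixed n"
  unfolding phase_def
  by (intro fixed_add fixed_mult fixed_divide prime_field_fixed[OF ab_fixed(1)] prime_field_fixed[OF ab_fixed(2)])

text \<open>For \<open>n > 0\<close> the Kloosterman sum over the field with \<open>p ^ n\<close>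
  elements; \<open>n = 1\<close> is the classical sum.\<close>

definition trace_sum :: "nat \<Rightarrow> complex" where
  "trace_sum n = (\<Sum>x\<in>fixed n - {0}. psi (frob_trace n (phase x)))"

text \<open>The trace minus \<open>d\<close> is a polynomial of positive degree. Its root supplies
  the constant of the curve that singles out the trace value \<open>d\<close>.\<close>

lemma frob_trace_surj: "n > 0 \<Longrightarrow> \<exists>c. frob_trace n c = d"
proof -
  assume n: "n > 0"
  define f where "f = (\<Sum>i<n. monom (1::'k) (p ^ i)) - [:d:]"
  have "coeff f (p ^ (n - 1)) = 1"
  proof -
    have "coeff [:d:] (p ^ (n - 1)) = 0"
      by (rule coeff_eq_0) (use p_pos in simp)
    hence "coeff f (p ^ (n - 1)) = (\<Sum>i<n. if p ^ i = p ^ (n - 1) then 1 else 0)"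
      unfolding f_def by (simp add: coeff_sum)
    also have "\<dots> = (\<Sum>i<n. if i = n - 1 then 1 else 0)"
      by (intro sum.cong refl) (simp only: power_inject_exp[OF p_gt_1])
    finally have "coeff f (p ^ (n - 1)) = (\<Sum>i<n. if i = n - 1 then 1 else 0)" .
    thus ?thesis using n by simp
  qed
  hence "p ^ (n - 1) \<le> degree f" by (intro le_degree) simp
  hence "degree f > 0" using p_pos by (meson less_le_trans zero_less_power)
  then obtain c where "poly f c = 0" using alg_closed_imp_poly_has_root by blast
  thus ?thesis by (intro exI[of _ c]) (simp add: f_def frob_trace_def poly_sum poly_monom)
qed

text \<open>Above each \<open>x\<close> of the fibre lie \<open>p\<close> values of
  \<open>y\<close>, as the equation for \<open>y\<close> is separable, and
  \<open>frob_trace_telescope\<close> makes all of them rational.\<close>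

lemma card_trace_fiber_le:
  assumes Q: "Q = p ^ \<mu>" "\<mu> \<ge> 2"
  shows "p * card {x \<in> fixed (2 * \<mu>) - {0}. frob_trace (2 * \<mu>) (phase x) = d} \<le> Q\<^sup>2 + (2 * p + 1) * Q"
proof -
  let ?n = "2 * \<mu>"
  define fib where "fib = {x \<in> fixed ?n - {0}. frob_trace ?n (phase x) = d}"
  obtain c where c: "frob_trace ?n c = d" using frob_trace_surj[of ?n d] Q by auto
  interpret C: artin_schreier_curve a b c p
    by unfold_locales (use prime_p CHAR_p odd_p a0 b0 in auto)
  have p2: "p\<^sup>2 \<le> Q" unfolding Q(1) using Q(2) p_pos by (intro power_increasing) auto
  have QQ: "Q * Q = p ^ ?n" by (simp add: Q power_add[symmetric] mult_2)
  let ?P = "{(x, y) \<in> C.curve. x ^ (Q * Q) = x \<and> y ^ (Q * Q) = y}"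
  define Y where "Y = (\<lambda>x. {y. y ^ p - y = phase x - c})"
  have Yroots: "Y x = {y. poly (monom 1 p - monom 1 1 - [:phase x - c:]) y = 0}" for x
    by (auto simp: Y_def poly_monom)
  have Y: "finite (Y x) \<and> card (Y x) = p" for x
  proof -
    let ?f = "monom 1 p - monom 1 1 - [:phase x - c:] :: 'k poly"
    have "degree (monom 1 p + (- monom 1 1 - [:phase x - c:]) :: 'k poly) = p"
    proof (subst degree_add_eq_left)
      have "degree (- monom 1 1 - [:phase x - c:] :: 'k poly) \<le> 1"
        by (intro degree_diff_le) (auto simp: degree_monom_eq)
      thus "degree (- monom 1 1 - [:phase x - c:] :: 'k poly) < degree (monom 1 p :: 'k poly)"
        using p_gt_1 by (simp add: degree_monom_eq)
    qed (simp add: degree_monom_eq)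
    hence deg: "degree ?f = p" by (simp add: diff_diff_eq2 algebra_simps)
    have "(of_nat p :: 'k) = 0" using CHAR_p of_nat_CHAR by metis
    hence "pderiv ?f = - 1"
      by (simp add: pderiv_diff pderiv_monom monom_0 one_pCons pderiv_pCons)
    moreover have f0: "?f \<noteq> 0" using deg p_pos by auto
    ultimately have "card {y. poly ?f y = 0} = p"
      using card_roots_simple[of ?f] deg by simp
    thus ?thesis unfolding Yroots using poly_roots_finite[OF f0] by simp
  qed
  have fixed: "Sigma fib Y \<subseteq> ?P"
  proof (safe)
    fix x y assume xy: "x \<in> fib" "y \<in> Y x"
    have x: "x ^ (Q * Q) = x" "x \<noteq> 0" using xy by (auto simp: fib_def fixed_def QQ)
    have yy: "y ^ p - y = phase x - c" using xy by (simp add: Y_def)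
    have "a * x\<^sup>2 + b = x * phase x" using x by (simp add: phase_def algebra_simps power2_eq_square)
    also have "phase x = y ^ p - y + c" using yy by simp
    finally show "(x, y) \<in> C.curve" using x by (simp add: C.curve_def)
    have "y ^ (p ^ ?n) - y = frob_trace ?n (phase x) - frob_trace ?n c"
      unfolding frob_trace_telescope[symmetric] yy frob_trace_diff ..
    also have "\<dots> = 0" using xy c by (simp add: fib_def)
    finally show "y ^ (Q * Q) = y" unfolding QQ by simp
    show "x ^ (Q * Q) = x" by (rule x)
  qed
  have P: "finite ?P" "card ?P \<le> Q\<^sup>2 + (2 * p + 1) * Q"
    using C.rational_points_le[OF Q(1) p2] by auto
  have finX: "finite fib" using finite_fixed[of ?n] Q by (simp add: fib_def)
  have "card (Sigma fib Y) = p * card fib" using Y finX by (simp add: card_SigmaI)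
  thus ?thesis using card_mono[OF P(1) fixed] P(2) by (simp add: fib_def)
qed

text \<open>Every fibre has at most \<open>U\<close> elements, and the deficits add up to
  \<open>p * U - (Q\<^sup>2 - 1)\<close>, where the main terms cancel.\<close>

theorem norm_trace_sum_even_le:
  assumes "\<mu> \<ge> 2"
  shows "norm (trace_sum (2 * \<mu>)) \<le> (2 * real p + 1) * real p ^ \<mu> + 1"
proof -
  let ?n = "2 * \<mu>"
  define Q where "Q = p ^ \<mu>"
  define fib where "fib = (\<lambda>d. {x \<in> fixed ?n - {0}. frob_trace ?n (phase x) = d})"
  define U where "U = (real Q ^ 2 + (2 * real p + 1) * real Q) / real p"
  have n0: "?n > 0" using assms by simp
  have fin: "finite (fixed ?n - {0})" using finite_fixed[OF n0] by simp
  have XU: "real (card (fib d)) \<le> U" for d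
  proof -
    have "real (p * card (fib d)) \<le> real (Q\<^sup>2 + (2 * p + 1) * Q)"
      using card_trace_fiber_le[OF Q_def assms, of d] unfolding fib_def of_nat_le_iff .
    thus ?thesis using p_pos by (simp add: U_def field_simps)
  qed
  have img: "(\<lambda>x. frob_trace ?n (phase x)) ` (fixed ?n - {0}) \<subseteq> fixed (Suc 0)"
    by (auto intro!: frob_trace_rational phase_fixed)
  have fin1: "finite (fixed (Suc 0))" by (rule finite_fixed) simp
  have "trace_sum ?n = (\<Sum>d\<in>fixed (Suc 0). \<Sum>x\<in>fib d. psi (frob_trace ?n (phase x)))"
    unfolding trace_sum_def fib_def by (rule sum.group[symmetric, OF fin fin1 img])
  also have "\<dots> = (\<Sum>d\<in>fixed (Suc 0). of_nat (card (fib d)) * psi d)"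
    by (intro sum.cong refl) (simp add: fib_def)
  \<comment> \<open>The values of \<open>psi\<close> sum to 0, so \<open>U\<close> may be subtracted
    from all fibre sizes; the differences then have one sign.\<close>
  also have "\<dots> = (\<Sum>d\<in>fixed (Suc 0). of_nat (card (fib d)) * psi d) - of_real U * (\<Sum>d\<in>fixed (Suc 0). psi (1 * d))"
    using sum_psi[OF fixed_1] by simp
  also have "\<dots> = (\<Sum>d\<in>fixed (Suc 0). - (of_real (U - real (card (fib d))) * psi d))"
    by (simp add: sum_distrib_left sum_subtractf[symmetric] algebra_simps)
  also have "norm \<dots> \<le> (\<Sum>d\<in>fixed (Suc 0). U - real (card (fib d)))"
    by (rule order.trans[OF norm_sum]) (use XU in \<open>auto intro!: sum_mono simp: norm_mult simp del: of_real_diff\<close>)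
  also have "\<dots> = real p * U - (\<Sum>d\<in>fixed (Suc 0). real (card (fib d)))"
    by (simp add: sum_subtractf card_fixed)
  also have "(\<Sum>d\<in>fixed (Suc 0). real (card (fib d))) = (\<Sum>d\<in>fixed (Suc 0). \<Sum>x\<in>fib d. 1)" by simp
  also have "\<dots> = (\<Sum>x\<in>fixed ?n - {0}. 1)"
    unfolding fib_def by (rule sum.group[OF fin fin1 img])
  also have "\<dots> = real (p ^ ?n - 1)" using fixed_0 finite_fixed[OF n0] by (simp add: card_fixed[OF n0])
  also have "\<dots> = real p ^ ?n - 1" using p_pos by (simp add: of_nat_diff Suc_leI)
  also have "real p * U = real p ^ ?n + (2 * real p + 1) * real p ^ \<mu>"
    using p_pos by (simp add: U_def Q_def power_mult[symmetric] mult.commute[of \<mu>])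
  finally show ?thesis by simp
qed

section \<open>Polynomials over the prime field\<close>

text \<open>
  That is, \<open>f\<close> has coefficients in the prime field (\<open>rational_iff_coeffs\<close>); this form passes to
  products and quotients directly.
\<close>
definition rational :: "'k poly \<Rightarrow> bool" where
  "rational f \<longleftrightarrow> (\<forall>z. poly f (z ^ p) = poly f z ^ p)"

lemma frob_poly_exists:
  fixes f :: "'k poly"
  shows "\<exists>g. (\<forall>z. poly g (z ^ p) = poly f z ^ p) \<and> (\<forall>i. coeff g i = coeff f i ^ p)"
proof -
  define g where "g = map_poly (\<lambda>x. x ^ p) f"
  have cg: "coeff g i = coeff f i ^ p" for i
    unfolding g_def by (rule coeff_map_poly) (use p_pos in simp)
  have dg: "degree g = degree f"
    unfolding g_def by (rule degree_map_poly) (use p_pos in auto)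
  have "poly g (z ^ p) = poly f z ^ p" for z
  proof -
    have "poly g (z ^ p) = (\<Sum>i\<le>degree f. coeff g i * (z ^ p) ^ i)"
      by (simp add: poly_altdef dg)
    also have "\<dots> = (\<Sum>i\<le>degree f. (coeff f i * z ^ i) ^ (p ^ 1))"
      by (intro sum.cong refl) (simp add: cg power_mult_distrib power_mult[symmetric] mult.commute)
    also have "\<dots> = poly f z ^ (p ^ 1)" unfolding frob_sum[symmetric] by (simp add: poly_altdef)
    finally show ?thesis by simp
  qed
  with cg show ?thesis by blast
qed

lemma ex_frob_root: "\<exists>z. z ^ p = (w :: 'k)"
  using nth_root_exists[OF p_pos] by blast

lemma poly_eqI_frob:
  assumes "\<And>z. poly f (z ^ p) = poly g (z ^ p)"
  shows "f = (g :: 'k poly)"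
  using assms ex_frob_root by (intro poly_eqI_alg_closed) metis

lemma rational_iff_coeffs: "rational f \<longleftrightarrow> (\<forall>i. coeff f i \<in> fixed (Suc 0))"
proof -
  obtain g where g: "\<And>z. poly g (z ^ p) = poly f z ^ p" "\<And>i. coeff g i = coeff f i ^ p"
    using frob_poly_exists[of f] by blast
  have "rational f \<longleftrightarrow> g = f"
    unfolding rational_def using g(1) poly_eqI_frob[of g f] by metis
  also have "\<dots> \<longleftrightarrow> (\<forall>i. coeff f i \<in> fixed (Suc 0))"
    by (auto simp: poly_eq_iff g(2) fixed_Suc0)
  finally show ?thesis .
qed

lemma rational_mult: "rational f \<Longrightarrow> rational g \<Longrightarrow> rational (f * g)"
  by (simp add: rational_def power_mult_distrib)

lemma rational_cancel:
  assumes "rational (f * g)" "rational f" "f \<noteq> 0"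
  shows "rational g"
proof -
  obtain h where h: "\<And>z. poly h (z ^ p) = poly g z ^ p" using frob_poly_exists[of g] by blast
  have "f * g = f * h"
    by (rule poly_eqI_frob) (use assms in \<open>simp add: rational_def h power_mult_distrib\<close>)
  hence "g = h" using assms(3) by simp
  thus ?thesis using h by (simp add: rational_def)
qed

text \<open>For \<open>x\<close> in \<open>fixed k\<close> the characteristic polynomial of
  \<open>x\<close> over the prime field: a power of the minimal polynomial when \<open>x\<close>
  lies in a smaller field.\<close>

definition norm_poly :: "nat \<Rightarrow> 'k \<Rightarrow> 'k poly" where
  "norm_poly k x = (\<Prod>i<k. [:- (x ^ (p ^ i)), 1:])"

lemma norm_poly_nz: "norm_poly k x \<noteq> 0"
  by (simp add: norm_poly_def)

lemma degree_norm_poly: "degree (norm_poly k x) = k"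
  unfolding norm_poly_def by (subst degree_prod_eq_sum_degree) auto

lemma monic_norm_poly: "lead_coeff (norm_poly k x) = 1"
  unfolding norm_poly_def lead_coeff_prod by simp

lemma rational_norm_poly:
  assumes "x \<in> fixed k"
  shows "rational (norm_poly k x)"
  unfolding rational_def
proof
  fix z
  have "poly (norm_poly k x) z ^ p = (\<Prod>i<k. (z - x ^ (p ^ i)) ^ (p ^ 1))"
    by (simp add: norm_poly_def poly_prod prod_power_distrib)
  also have "\<dots> = (\<Prod>i<k. z ^ p - x ^ (p ^ Suc i))"
    unfolding frob_diff by (simp add: power_mult[symmetric] mult.commute)
  also have "\<dots> = (\<Prod>i<k. z ^ p - x ^ (p ^ i))"
  proof (cases k)
    case (Suc m)
    have "(\<Prod>i<Suc m. z ^ p - x ^ (p ^ Suc i)) = (\<Prod>i<m. z ^ p - x ^ (p ^ Suc i)) * (z ^ p - x)"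
      using assms Suc by (simp add: fixed_def)
    also have "\<dots> = (\<Prod>i<Suc m. z ^ p - x ^ (p ^ i))"
      unfolding prod.lessThan_Suc_shift by simp
    finally show ?thesis by (simp only: Suc)
  qed simp
  also have "\<dots> = poly (norm_poly k x) (z ^ p)" by (simp add: norm_poly_def poly_prod)
  finally show "poly (norm_poly k x) (z ^ p) = poly (norm_poly k x) z ^ p" ..
qed

lemma root_norm_poly: "k > 0 \<Longrightarrow> poly (norm_poly k x) x = 0"
  unfolding norm_poly_def poly_prod by (rule prod_zero) (auto intro!: bexI[of _ 0])

lemma norm_poly_add:
  assumes "x \<in> fixed d"
  shows "norm_poly (d + k) x = norm_poly d x * norm_poly k x"
proof -
  have eq: "x ^ (p ^ (d + i)) = x ^ (p ^ i)" for i
  proof -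
    have "x ^ (p ^ (d + i)) = (x ^ (p ^ d)) ^ (p ^ i)" by (simp add: power_add power_mult)
    thus ?thesis using assms by (simp add: fixed_def)
  qed
  have "norm_poly (d + k) x = norm_poly d x * (\<Prod>i<k. [:- (x ^ (p ^ (d + i))), 1:])"
    by (induction k) (simp_all only: norm_poly_def add_Suc_right prod.lessThan_Suc mult.assoc
        add_0_right lessThan_0 prod.empty mult_1_right)
  thus ?thesis by (simp add: norm_poly_def eq)
qed

lemma rational_frob_root: "rational f \<Longrightarrow> poly f x = 0 \<Longrightarrow> poly f (x ^ (p ^ i)) = 0"
proof (induction i)
  case (Suc i)
  have "x ^ (p ^ Suc i) = (x ^ (p ^ i)) ^ p" by (simp add: power_mult[symmetric] mult.commute)
  moreover have "poly f ((x ^ (p ^ i)) ^ p) = poly f (x ^ (p ^ i)) ^ p"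
    using Suc.prems unfolding rational_def by blast
  ultimately show ?case using Suc p_pos by simp
qed simp

text \<open>Frobenius maps the finite set of roots into itself, so the orbit of \<open>x\<close>
  repeats; injectivity makes it purely periodic.\<close>

lemma frob_period_exists:
  assumes "rational f" "f \<noteq> 0" "poly f x = 0"
  shows "\<exists>d>0. x \<in> fixed d"
proof -
  have "finite (range (\<lambda>i. x ^ (p ^ i)))"
    using rational_frob_root[OF assms(1,3)]
    by (intro finite_subset[OF _ poly_roots_finite[OF assms(2)]]) auto
  hence "\<not> inj (\<lambda>i. x ^ (p ^ i))" using finite_imageD by blast
  then obtain i j where ij: "i < j" "x ^ (p ^ i) = x ^ (p ^ j)"
    unfolding inj_def by (metis linorder_neqE_nat)
  have "(x ^ (p ^ (j - i))) ^ (p ^ i) = x ^ (p ^ i)"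
    using ij by (simp add: power_mult[symmetric] power_add[symmetric])
  hence "x ^ (p ^ (j - i)) = x" by (rule frob_inj)
  thus ?thesis using ij by (intro exI[of _ "j - i"]) (simp add: fixed_def)
qed

lemma fixed_diff_index:
  assumes "x \<in> fixed d" "d \<le> k"
  shows "x \<in> fixed k \<longleftrightarrow> x \<in> fixed (k - d)"
proof -
  have "x ^ (p ^ k) = (x ^ (p ^ d)) ^ (p ^ (k - d))"
    using assms(2) by (simp add: power_mult[symmetric] power_add[symmetric])
  thus ?thesis using assms(1) by (simp add: fixed_def)
qed

text \<open>For the least period the conjugates are distinct, so this is the minimal polynomial of
  \<open>x\<close> over the prime field.\<close>

lemma norm_poly_least:
  assumes d: "d > 0" "x \<in> fixed d" "\<And>i. 0 < i \<Longrightarrow> i < d \<Longrightarrow> x \<notin> fixed i"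
  shows "order x (norm_poly d x) = 1"
    and "rational f \<Longrightarrow> poly f x = 0 \<Longrightarrow> norm_poly d x dvd f"
proof -
  have inj: "inj_on (\<lambda>i. x ^ (p ^ i)) {..<d}"
  proof (rule inj_onI, rule ccontr)
    fix i j assume *: "i \<in> {..<d}" "j \<in> {..<d}" "x ^ (p ^ i) = x ^ (p ^ j)" "i \<noteq> j"
    have False if ij: "i < j" "j < d" "x ^ (p ^ i) = x ^ (p ^ j)" for i j
    proof -
      have "(x ^ (p ^ (j - i))) ^ (p ^ i) = x ^ (p ^ i)"
        using ij by (simp add: power_mult[symmetric] power_add[symmetric])
      hence "x ^ (p ^ (j - i)) = x" by (rule frob_inj)
      moreover have "0 < j - i" "j - i < d" using ij by auto
      ultimately show False using d(3)[of "j - i"] by (simp add: fixed_def)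
    qed
    from this[of i j] this[of j i] * show False by (cases "i < j") auto
  qed
  define S where "S = (\<lambda>i. x ^ (p ^ i)) ` {..<d}"
  have N: "norm_poly d x = (\<Prod>y\<in>S. [:- y, 1:])"
    unfolding norm_poly_def S_def by (subst prod.reindex[OF inj]) simp
  have "proots (norm_poly d x) = mset_set S"
  proof -
    have "proots (norm_poly d x) = (\<Sum>y\<in>S. {#y#})"
      unfolding N by (subst proots_prod) auto
    thus ?thesis by (simp add: S_def)
  qed
  hence *: "order y (norm_poly d x) = (if y \<in> S then 1 else 0)" for y
    using count_proots[OF norm_poly_nz, of d x y] by (simp add: S_def count_mset_set')
  have "x \<in> S" using d(1) by (auto simp: S_def intro!: image_eqI[of _ _ 0])
  thus "order x (norm_poly d x) = 1" using * by simp
  show "norm_poly d x dvd f" if f: "rational f" "poly f x = 0"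
  proof -
    have "(\<Prod>y\<in>S. [:- y, 1:]) dvd f"
      using rational_frob_root[OF f] by (intro prod_linear_dvd) (auto simp: S_def)
    thus ?thesis unfolding N .
  qed
qed

text \<open>With \<open>d\<close> the degree of \<open>x\<close>, the admissible \<open>k\<close>
  are multiples of \<open>d\<close>, and \<open>norm_poly k x\<close> is the power
  \<open>k div d\<close> of the minimal polynomial. The set thus counts how often that polynomial
  divides \<open>f\<close>, which is the multiplicity of \<open>x\<close> because \<open>x\<close>
  is a simple root of it. The induction cancels one such factor.\<close>

lemma card_norm_poly_dvd:
  assumes "rational f" "f \<noteq> 0"
  shows "finite {k. 0 < k \<and> x \<in> fixed k \<and> norm_poly k x dvd f} \<and>
         card {k. 0 < k \<and> x \<in> fixed k \<and> norm_poly k x dvd f} = order x f"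
  using assms
proof (induction "degree f" arbitrary: f rule: less_induct)
  case (less f)
  let ?S = "\<lambda>f. {k. 0 < k \<and> x \<in> fixed k \<and> norm_poly k x dvd f}"
  show ?case
  proof (cases "poly f x = 0")
    case False
    hence empty: "?S f = {}" using root_norm_poly by (auto simp: dvd_def)
    have "order x f = 0" using False by (rule order_0I)
    thus ?thesis unfolding empty by simp
  next
    case True
    define d where "d = (LEAST d. d > 0 \<and> x \<in> fixed d)"
    have d: "d > 0" "x \<in> fixed d"
      using LeastI_ex[OF frob_period_exists[OF less.prems True, unfolded Bex_def]] by (auto simp: d_def)
    have dmin: "x \<notin> fixed i" if "0 < i" "i < d" for i
      using not_less_Least[of i "\<lambda>d. d > 0 \<and> x \<in> fixed d"] that by (auto simp: d_def)
    obtain g where g: "f = norm_poly d x * g"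
      using norm_poly_least(2)[OF d dmin less.prems(1) True] by blast
    have g0: "g \<noteq> 0" using g less.prems by auto
    have rg: "rational g"
      using rational_cancel[of "norm_poly d x" g] rational_norm_poly[OF d(2)] less.prems g norm_poly_nz by simp
    have "degree f = d + degree g"
      unfolding g using g0 norm_poly_nz by (subst degree_mult_eq) (auto simp: degree_norm_poly)
    hence IH: "finite (?S g)" "card (?S g) = order x g" using less.hyps[OF _ rg g0] d by auto
    have "?S f = insert d ((+) d ` ?S g)"
    proof (intro equalityI subsetI)
      fix k assume k: "k \<in> ?S f"
      hence dk: "d \<le> k" using dmin[of k] by (cases "k < d") auto
      show "k \<in> insert d ((+) d ` ?S g)"
      proof (cases "k = d")
        case False
        define m where "m = k - d"
        have m: "k = d + m" "m > 0" using dk False by (auto simp: m_def)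
        have "x \<in> fixed m" using fixed_diff_index[OF d(2) dk] k by (simp add: m_def)
        moreover have "norm_poly m x dvd g"
        proof -
          have "norm_poly (d + m) x dvd norm_poly d x * g" using k m(1) g by auto
          thus ?thesis
            using norm_poly_nz[of d x] unfolding norm_poly_add[OF d(2)] by simp
        qed
        ultimately show ?thesis using m by auto
      qed simp
    next
      fix k assume "k \<in> insert d ((+) d ` ?S g)"
      then consider "k = d" | m where "m \<in> ?S g" "k = d + m" by blast
      thus "k \<in> ?S f"
      proof cases
        case 1
        thus ?thesis using d by (simp add: g)
      next
        case (2 m)
        hence "x \<in> fixed k" using fixed_diff_index[OF d(2), of k] by simp
        moreover have "norm_poly k x dvd f"
          using 2 unfolding g 2(2) norm_poly_add[OF d(2)] by (auto intro: mult_dvd_mono)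
        ultimately show ?thesis using 2 by simp
      qed
    qed
    moreover have "card (insert d ((+) d ` ?S g)) = Suc (card (?S g))"
      using IH(1) by (subst card_insert_disjoint) (auto simp: card_image)
    moreover have "order x f = 1 + order x g"
      unfolding g using g0 norm_poly_nz by (subst order_mult) (auto simp: norm_poly_least(1)[OF d dmin])
    ultimately show ?thesis using IH by simp
  qed
qed

section \<open>Character sums over monic polynomials\<close>

text \<open>A nonzero constant coefficient excludes the root 0, at which \<open>phase\<close> has
  its pole.\<close>

definition monics :: "nat \<Rightarrow> 'k poly set" where
  "monics n = {f. degree f = n \<and> lead_coeff f = 1 \<and> coeff f 0 \<noteq> 0 \<and> rational f}"

lemma finite_monics: "finite (monics n)"
proof (rule finite_imageD)
  let ?F = "\<lambda>f. map (coeff f) [0..<Suc n]"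
  have "?F ` monics n \<subseteq> {xs. set xs \<subseteq> fixed (Suc 0) \<and> length xs = Suc n}"
    by (auto simp: monics_def rational_iff_coeffs simp del: upt_Suc)
  thus "finite (?F ` monics n)"
    by (rule finite_subset) (intro finite_lists_length_eq finite_fixed, simp)
  show "inj_on ?F (monics n)"
  proof (rule inj_onI)
    fix f g assume fg: "f \<in> monics n" "g \<in> monics n" "?F f = ?F g"
    show "f = g"
    proof (rule poly_eqI)
      fix i
      show "coeff f i = coeff g i"
      proof (cases "i \<le> n")
        case True
        have "?F f ! i = ?F g ! i" unfolding fg(3) ..
        thus ?thesis using True by (simp del: upt_Suc)
      next
        case False
        thus ?thesis using fg by (simp add: monics_def coeff_eq_0)
      qed
    qed
  qed
qed

text \<open>For monic \<open>f\<close>, minus the sum of the roots. Degree 0 is separate because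
  \<open>degree f - 1\<close> would then point at the constant coefficient.\<close>

definition subleading :: "'k poly \<Rightarrow> 'k" where
  "subleading f = (if degree f = 0 then 0 else coeff f (degree f - 1))"

text \<open>
  If \<open>f\<close> is the product of the \<open>T - x\<^sub>i\<close>, the argument of \<open>psi\<close> is \<open>\<Sum> a x\<^sub>i + b / x\<^sub>i\<close>, whence the character
  is multiplicative.
\<close>
definition monic_char :: "'k poly \<Rightarrow> complex" where
  "monic_char f = psi (- (a * subleading f + b * (coeff f 1 / coeff f 0)))"

lemma subleading_linear_mult:
  assumes "lead_coeff g = 1"
  shows "subleading ([:- x, 1:] * g) = subleading g - x"
proof -
  have g0: "g \<noteq> 0" using assms by auto
  have "degree ([:- x, 1:] * g) = Suc (degree g)" using g0 by (subst degree_mult_eq) auto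
  thus ?thesis using assms unfolding subleading_def
    by (cases "degree g") (auto simp: coeff_pCons)
qed

lemma ratio_linear_mult:
  fixes x :: 'k
  assumes "coeff g 0 \<noteq> 0" "x \<noteq> 0"
  shows "coeff ([:- x, 1:] * g) 1 / coeff ([:- x, 1:] * g) 0 = coeff g 1 / coeff g 0 - 1 / x"
proof -
  have "(u - x * v) / - (x * u) = v / u - 1 / x" if "u \<noteq> 0" for u v
    using that assms(2) by (simp add: field_simps)
  from this[OF assms(1), of "coeff g 1"] show ?thesis by simp
qed

lemma norm_poly_mult_coeffs:
  fixes k :: nat
  assumes "lead_coeff g = 1" "coeff g 0 \<noteq> 0" "x \<noteq> 0"
  defines "h \<equiv> \<lambda>k. norm_poly k x * g"
  shows "lead_coeff (h k) = 1 \<and> coeff (h k) 0 \<noteq> 0 \<and> subleading (h k) = subleading g - frob_trace k x \<and>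
         coeff (h k) 1 / coeff (h k) 0 = coeff g 1 / coeff g 0 - frob_trace k (1 / x)"
  unfolding h_def
proof (induction k)
  case (Suc k)
  define h where "h = norm_poly k x * g"
  have eq: "norm_poly (Suc k) x * g = [:- (x ^ (p ^ k)), 1:] * h"
    by (simp add: norm_poly_def h_def mult_ac)
  have "x ^ (p ^ k) \<noteq> 0" using assms by simp
  note l = Suc[folded h_def]
  have "lead_coeff ([:- (x ^ (p ^ k)), 1:] * h) = 1" using l unfolding lead_coeff_mult by simp
  moreover have "coeff ([:- (x ^ (p ^ k)), 1:] * h) 0 \<noteq> 0" using l assms(3) by simp
  ultimately show ?case
    using subleading_linear_mult[of h "x ^ (p ^ k)"] ratio_linear_mult[of h "x ^ (p ^ k)"] l
      \<open>x ^ (p ^ k) \<noteq> 0\<close>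
    unfolding eq by (simp add: frob_trace_def power_one_over del: mult_pCons_left)
qed (use assms in \<open>simp add: norm_poly_def frob_trace_def\<close>)

lemma subleading_fixed: "rational f \<Longrightarrow> subleading f \<in> fixed (Suc 0)"
  by (auto simp: subleading_def rational_iff_coeffs fixed_0)

lemma monic_char_arg_fixed:
  "rational f \<Longrightarrow> - (a * subleading f + b * (coeff f 1 / coeff f 0)) \<in> fixed (Suc 0)"
  by (intro fixed_uminus fixed_add fixed_mult fixed_divide ab_fixed subleading_fixed)
     (auto simp: rational_iff_coeffs)

text \<open>The factor \<open>norm_poly k x\<close> contributes the traces of \<open>x\<close> and
  \<open>1 / x\<close>, so its character is the term of \<open>trace_sum k\<close> at
  \<open>x\<close>.\<close>

lemma monic_char_norm_poly_mult:
  assumes "g \<in> monics n" "x \<in> fixed k - {0}"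
  shows "monic_char (norm_poly k x * g) = psi (frob_trace k (phase x)) * monic_char g"
proof -
  have g: "lead_coeff g = 1" "coeff g 0 \<noteq> 0" "rational g" "x \<noteq> 0" "x \<in> fixed k"
    using assms by (auto simp: monics_def)
  have frob_trace: "frob_trace k (phase x) = a * frob_trace k x + b * frob_trace k (1 / x)"
    using frob_trace_scale[OF ab_fixed(2), of k "1 / x"] by (simp add: phase_def frob_trace_add frob_trace_scale ab_fixed)
  note c = norm_poly_mult_coeffs[OF g(1,2,4), of k]
  have s: "subleading (norm_poly k x * g) = subleading g - frob_trace k x"
    "coeff (norm_poly k x * g) 1 / coeff (norm_poly k x * g) 0 = coeff g 1 / coeff g 0 - frob_trace k (1 / x)"
    using c by blast+
  have "- (a * subleading (norm_poly k x * g) +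
      b * (coeff (norm_poly k x * g) 1 / coeff (norm_poly k x * g) 0))
     = frob_trace k (phase x) + (- (a * subleading g + b * (coeff g 1 / coeff g 0)))"
    unfolding s frob_trace by (simp add: algebra_simps)
  thus ?thesis unfolding monic_char_def
    by (simp only:) (rule psi_add[OF frob_trace_rational[OF phase_fixed[OF g(5)]] monic_char_arg_fixed[OF g(3)]])
qed

lemma norm_poly_mult_bij:
  assumes "x \<in> fixed k - {0}" "k \<le> n"
  shows "bij_betw (\<lambda>g. norm_poly k x * g) (monics (n - k)) {f \<in> monics n. norm_poly k x dvd f}"
proof (rule bij_betw_imageI)
  show "inj_on (\<lambda>g. norm_poly k x * g) (monics (n - k))"
    using norm_poly_nz by (auto intro: inj_onI)
  have x: "x \<noteq> 0" "x \<in> fixed k" using assms by auto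
  show "(\<lambda>g. norm_poly k x * g) ` monics (n - k) = {f \<in> monics n. norm_poly k x dvd f}"
  proof (intro equalityI subsetI)
    fix f assume "f \<in> (\<lambda>g. norm_poly k x * g) ` monics (n - k)"
    then obtain g where g: "g \<in> monics (n - k)" "f = norm_poly k x * g" by blast
    have "g \<noteq> 0" using g by (auto simp: monics_def)
    hence "degree f = k + degree g"
      unfolding g using norm_poly_nz by (subst degree_mult_eq) (auto simp: degree_norm_poly)
    thus "f \<in> {f \<in> monics n. norm_poly k x dvd f}"
      using g norm_poly_mult_coeffs[of g x k] x rational_mult[OF rational_norm_poly[OF x(2)], of g] assms(2)
      by (auto simp: monics_def)
  next
    fix f assume "f \<in> {f \<in> monics n. norm_poly k x dvd f}"
    then obtain g where f: "f \<in> monics n" and g: "f = norm_poly k x * g" by auto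
    have "g \<noteq> 0" using f g by (auto simp: monics_def)
    hence "degree f = k + degree g"
      unfolding g using norm_poly_nz by (subst degree_mult_eq) (auto simp: degree_norm_poly)
    moreover have "lead_coeff g = 1"
    proof -
      have "lead_coeff (norm_poly k x * g) = 1" using f unfolding monics_def g by blast
      thus ?thesis unfolding lead_coeff_mult monic_norm_poly by simp
    qed
    moreover have "coeff g 0 \<noteq> 0" using f by (auto simp: monics_def g coeff_mult)
    moreover have "rational g"
      using rational_cancel[of "norm_poly k x" g] f rational_norm_poly[OF x(2)] norm_poly_nz
      by (simp add: monics_def g)
    ultimately have "g \<in> monics (n - k)" using f by (auto simp: monics_def)
    thus "f \<in> (\<lambda>g. norm_poly k x * g) ` monics (n - k)" using g by blast
  qed
qed

definition char_sum :: "nat \<Rightarrow> complex" where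
  "char_sum n = (\<Sum>f\<in>monics n. monic_char f)"

text \<open>Each root of \<open>f\<close> accounts for as many \<open>k\<close> as its multiplicity,
  and the multiplicities add up to the degree.\<close>

lemma card_norm_divisors:
  assumes "f \<in> monics n"
  shows "card {(k, x). k \<in> {1..n} \<and> x \<in> fixed k - {0} \<and> norm_poly k x dvd f} = n" (is "card ?D = n")
proof -
  have f: "rational f" "f \<noteq> 0" "degree f = n" "coeff f 0 \<noteq> 0" using assms by (auto simp: monics_def)
  let ?R = "{x. poly f x = 0}"
  let ?S = "\<lambda>x. {k. 0 < k \<and> x \<in> fixed k \<and> norm_poly k x dvd f}"
  have finR: "finite ?R" by (rule poly_roots_finite[OF f(2)])
  have "?D = prod.swap ` (SIGMA x:?R. ?S x)"
  proof (intro equalityI subsetI)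
    fix u assume "u \<in> ?D"
    then obtain k x where u: "u = (k, x)" "k \<in> {1..n}" "x \<in> fixed k" "norm_poly k x dvd f" by auto
    have "poly f x = 0" using u root_norm_poly[of k x] by (auto simp: dvd_def)
    thus "u \<in> prod.swap ` (SIGMA x:?R. ?S x)" using u by (auto simp: image_iff)
  next
    fix u assume "u \<in> prod.swap ` (SIGMA x:?R. ?S x)"
    then obtain k x where u: "u = (k, x)" "0 < k" "x \<in> fixed k" "norm_poly k x dvd f" "poly f x = 0" by auto
    have "k \<le> n" using dvd_imp_degree_le[OF u(4) f(2)] f(3) by (simp add: degree_norm_poly)
    moreover have "x \<noteq> 0" using u(5) f(4) by (auto simp: poly_0_coeff_0)
    ultimately show "u \<in> ?D" using u by auto
  qed
  hence "card ?D = card (SIGMA x:?R. ?S x)"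
    by (simp add: card_image)
  also have "\<dots> = (\<Sum>x\<in>?R. card (?S x))"
    by (rule card_SigmaI) (use finR card_norm_poly_dvd[OF f(1,2)] in auto)
  also have "\<dots> = (\<Sum>x\<in>?R. order x f)" using card_norm_poly_dvd[OF f(1,2)] by simp
  also have "\<dots> = n" using sum_order_eq_degree[OF f(2)] f(3) by simp
  finally show ?thesis .
qed

text \<open>
  This is the logarithmic derivative of \<open>L(T) = \<Sum> char_sum n T\<^sup>n\<close>, a polynomial of degree 2 by
  \<open>char_sum_ge_3\<close>. It counts the pairs \<open>(k, x)\<close> with \<open>norm_poly k x dvd f\<close>, of which there are
  \<open>degree f\<close>.
\<close>
theorem newton_identity: "of_nat n * char_sum n = (\<Sum>k=1..n. trace_sum k * char_sum (n - k))"
proof -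
  have fin: "finite (fixed k - {0})" if "k \<in> {1..n}" for k using that finite_fixed[of k] by simp
  define T where "T = (SIGMA k:{1..n}. fixed k - {0})"
  have finT: "finite T" unfolding T_def using fin by auto
  have "(\<Sum>k=1..n. trace_sum k * char_sum (n - k)) =
     (\<Sum>k=1..n. \<Sum>x\<in>fixed k - {0}. \<Sum>g\<in>monics (n - k). psi (frob_trace k (phase x)) * monic_char g)"
    unfolding trace_sum_def char_sum_def sum_product ..
  also have "\<dots> = (\<Sum>k=1..n. \<Sum>x\<in>fixed k - {0}. \<Sum>f\<in>{f \<in> monics n. norm_poly k x dvd f}. monic_char f)"
  proof (rule sum.cong[OF refl], rule sum.cong[OF refl])
    fix k x assume kx: "k \<in> {1..n}" "x \<in> fixed k - {0}"
    have "(\<Sum>g\<in>monics (n - k). psi (frob_trace k (phase x)) * monic_char g) = (\<Sum>g\<in>monics (n - k). monic_char (norm_poly k x * g))"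
      using monic_char_norm_poly_mult kx by (intro sum.cong) auto
    also have "\<dots> = (\<Sum>f\<in>{f \<in> monics n. norm_poly k x dvd f}. monic_char f)"
      by (rule sum.reindex_bij_betw[OF norm_poly_mult_bij]) (use kx in auto)
    finally show "(\<Sum>g\<in>monics (n - k). psi (frob_trace k (phase x)) * monic_char g) =
       (\<Sum>f\<in>{f \<in> monics n. norm_poly k x dvd f}. monic_char f)" .
  qed
  also have "\<dots> = (\<Sum>kx\<in>T. \<Sum>f\<in>{f \<in> monics n. norm_poly (fst kx) (snd kx) dvd f}. monic_char f)"
    unfolding T_def using fin by (subst sum.Sigma) (auto simp: case_prod_beta)
  also have "\<dots> = (\<Sum>f\<in>monics n. \<Sum>kx\<in>{kx \<in> T. norm_poly (fst kx) (snd kx) dvd f}. monic_char f)"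
    by (rule sum.swap_restrict[OF finT finite_monics])
  also have "\<dots> = (\<Sum>f\<in>monics n. of_nat n * monic_char f)"
  proof (intro sum.cong refl)
    fix f assume f: "f \<in> monics n"
    have "{kx \<in> T. norm_poly (fst kx) (snd kx) dvd f} =
       {(k, x). k \<in> {1..n} \<and> x \<in> fixed k - {0} \<and> norm_poly k x dvd f}"
      by (auto simp: T_def)
    thus "(\<Sum>kx\<in>{kx \<in> T. norm_poly (fst kx) (snd kx) dvd f}. monic_char f) = of_nat n * monic_char f"
      using card_norm_divisors[OF f] by simp
  qed
  finally show ?thesis by (simp add: char_sum_def sum_distrib_left)
qed

lemma char_sum_0: "char_sum 0 = 1"
proof -
  have "monics 0 = {1}"
    by (auto simp: monics_def rational_def elim!: degree_eq_zeroE)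
  thus ?thesis by (simp add: char_sum_def monic_char_def subleading_def)
qed

lemma psi_minus_a: "psi (- a) \<noteq> 1"
  using psi_eq_1[of "- a"] a0 ab_fixed fixed_uminus by auto

text \<open>Adding the monomial of degree \<open>n - 1\<close> permutes \<open>monics n\<close>. For
  \<open>n \<ge> 3\<close> it touches neither the linear nor the constant coefficient, so the sum is
  multiplied by \<open>psi (- a)\<close>, which is not 1.\<close>

lemma char_sum_ge_3:
  assumes "n \<ge> 3"
  shows "char_sum n = 0"
proof -
  let ?m = "monom (1::'k) (n - 1)"
  have step: "f + ?m \<in> monics n \<and> f - ?m \<in> monics n \<and> monic_char (f + ?m) = psi (- a) * monic_char f"
    if f: "f \<in> monics n" for f
  proof -
    have f': "degree f = n" "lead_coeff f = 1" "coeff f 0 \<noteq> 0" "rational f"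
      using f by (auto simp: monics_def)
    have dm: "degree ?m < n" using assms degree_monom_le[of "1::'k" "n - 1"] by linarith
    have d1: "degree (f + ?m) = n" using dm f' by (subst degree_add_eq_left) auto
    have "degree (f + (- ?m)) = n" using dm f' by (subst degree_add_eq_left) auto
    hence d2: "degree (f - ?m) = n" by simp
    have rat: "rational (f + ?m)" "rational (f - ?m)"
      using f'(4) by (auto simp: rational_iff_coeffs intro!: fixed_add fixed_diff fixed_0 fixed_1)
    have "f + ?m \<in> monics n" "f - ?m \<in> monics n"
      using d1 d2 rat f' assms by (auto simp: monics_def)
    moreover have "monic_char (f + ?m) = psi (- a + - (a * subleading f + b * (coeff f 1 / coeff f 0)))"
    proof -
      have "subleading (f + ?m) = subleading f + 1"
        using d1 f'(1) assms by (simp add: subleading_def)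
      moreover have "coeff (f + ?m) 1 = coeff f 1" "coeff (f + ?m) 0 = coeff f 0"
        using assms by auto
      ultimately show ?thesis unfolding monic_char_def by (simp add: algebra_simps)
    qed
    moreover have "\<dots> = psi (- a) * monic_char f"
      unfolding monic_char_def by (rule psi_add[OF fixed_uminus[OF ab_fixed(1)] monic_char_arg_fixed[OF f'(4)]])
    ultimately show ?thesis by simp
  qed
  have "char_sum n = (\<Sum>f\<in>monics n. monic_char (f + ?m))"
    unfolding char_sum_def by (rule sum.reindex_bij_witness[of _ "\<lambda>f. f + ?m" "\<lambda>f. f - ?m"]) (use step in auto)
  also have "\<dots> = psi (- a) * char_sum n" using step by (simp add: char_sum_def sum_distrib_left)
  finally have "(psi (- a) - 1) * char_sum n = 0" by (simp add: algebra_simps)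
  thus ?thesis using psi_minus_a by simp
qed

text \<open>In degree 2 the subleading coefficient is the linear one. Summing over it gives 0 unless
  the constant coefficient is \<open>- (b / a)\<close>, and then \<open>p\<close>.\<close>

lemma char_sum_2: "char_sum 2 = of_nat p"
proof -
  have fin: "finite (fixed (Suc 0))" by (rule finite_fixed) simp
  let ?F = "\<lambda>(u, v). [:u, v, 1 :: 'k:]"
  have mon: "monics 2 = ?F ` ((fixed (Suc 0) - {0}) \<times> fixed (Suc 0))"
  proof (intro equalityI subsetI)
    fix f assume f: "f \<in> monics 2"
    have "f = [:coeff f 0, coeff f 1, 1:]"
      using f by (intro poly_eqI)
        (auto simp: monics_def coeff_pCons numeral_2_eq_2 coeff_eq_0 split: nat.splits)
    moreover have "(coeff f 0, coeff f 1) \<in> (fixed (Suc 0) - {0}) \<times> fixed (Suc 0)"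
      using f by (auto simp: monics_def rational_iff_coeffs)
    ultimately show "f \<in> ?F ` ((fixed (Suc 0) - {0}) \<times> fixed (Suc 0))" by (metis (mono_tags, lifting) case_prod_conv image_eqI)
  next
    fix f assume "f \<in> ?F ` ((fixed (Suc 0) - {0}) \<times> fixed (Suc 0))"
    thus "f \<in> monics 2"
      by (auto simp: monics_def rational_iff_coeffs coeff_pCons fixed_0 fixed_1 split: nat.splits)
  qed
  have inj: "inj_on ?F ((fixed (Suc 0) - {0}) \<times> fixed (Suc 0))"
    by (auto intro!: inj_onI)
  have "char_sum 2 = (\<Sum>u\<in>fixed (Suc 0) - {0}. \<Sum>v\<in>fixed (Suc 0). monic_char [:u, v, 1:])"
    unfolding char_sum_def mon sum.reindex[OF inj] by (simp add: sum.cartesian_product case_prod_beta o_def)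
  also have "\<dots> = (\<Sum>u\<in>fixed (Suc 0) - {0}. \<Sum>v\<in>fixed (Suc 0). psi (- (a + b / u) * v))"
    by (intro sum.cong refl) (simp add: monic_char_def subleading_def algebra_simps)
  also have "\<dots> = (\<Sum>u\<in>fixed (Suc 0) - {0}. if - (a + b / u) = 0 then of_nat p else 0)"
    by (intro sum.cong refl sum_psi fixed_uminus fixed_add fixed_divide ab_fixed) auto
  also have "\<dots> = (\<Sum>u\<in>fixed (Suc 0) - {0}. if u = - (b / a) then of_nat p else 0)"
  proof (intro sum.cong refl)
    fix u assume "u \<in> fixed (Suc 0) - {0}"
    hence u: "u \<noteq> 0" by simp
    have "- (a + b / u) = 0 \<longleftrightarrow> u * (a + b / u) = 0"
      using u by (simp only: neg_equal_0_iff_equal mult_eq_0_iff simp_thms)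
    also have "u * (a + b / u) = u * a + b" using u by (simp add: distrib_left)
    also have "u * a + b = 0 \<longleftrightarrow> u * a = - b" by (simp only: eq_neg_iff_add_eq_0)
    also have "\<dots> \<longleftrightarrow> u = - b / a" using a0 by (simp only: nonzero_eq_divide_eq not_False_eq_True)
    finally have "- (a + b / u) = 0 \<longleftrightarrow> u = - (b / a)" by simp
    thus "(if - (a + b / u) = 0 then of_nat p else (0::complex)) = (if u = - (b / a) then of_nat p else 0)"
      by simp
  qed
  also have "\<dots> = of_nat p"
  proof -
    have "- (b / a) \<in> fixed (Suc 0) - {0}" using a0 b0 by (auto intro!: fixed_uminus fixed_divide ab_fixed)
    thus ?thesis using fin by simp
  qed
  finally show ?thesis .
qed

section \<open>The inverse roots of the L-function\<close>

lemma trace_sum_recurrence: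
  assumes "n \<ge> 3"
  shows "trace_sum n = - (trace_sum 1 * trace_sum (n - 1)) - of_nat p * trace_sum (n - 2)"
proof -
  have A1: "char_sum 1 = trace_sum 1" using newton_identity[of 1] by (simp add: char_sum_0)
  have "0 = (\<Sum>k=1..n. trace_sum k * char_sum (n - k))" using newton_identity[of n] char_sum_ge_3[OF assms] by simp
  also have "\<dots> = (\<Sum>k\<in>{n, n - 1, n - 2}. trace_sum k * char_sum (n - k))"
    using assms by (intro sum.mono_neutral_right) (auto intro!: char_sum_ge_3)
  also have "\<dots> = trace_sum n * char_sum 0 + (trace_sum (n - 1) * char_sum 1 + trace_sum (n - 2) * char_sum 2)"
  proof -
    have "n - 1 \<noteq> n - 2" "n \<noteq> n - 1" "n \<noteq> n - 2" "n - (n - 1) = 1" "n - (n - 2) = 2" using assms by auto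
    thus ?thesis by simp
  qed
  finally have "trace_sum n + (trace_sum (n - 1) * trace_sum 1 + trace_sum (n - 2) * of_nat p) = 0" by (simp add: char_sum_0 A1[simplified] char_sum_2)
  hence "trace_sum n = - (trace_sum (n - 1) * trace_sum 1 + trace_sum (n - 2) * of_nat p)" by (simp only: eq_neg_iff_add_eq_0)
  thus ?thesis by (simp add: mult.commute)
qed

text \<open>The L-function is \<open>1 + trace_sum 1 * T + p * T\<^sup>2\<close>, and \<alpha> and
  \<beta> are its inverse roots.\<close>

lemma trace_sum_eq_power_sum:
  assumes "\<alpha> + \<beta> = - trace_sum 1" "\<alpha> * \<beta> = of_nat p" "n > 0"
  shows "trace_sum n = - (\<alpha> ^ n + \<beta> ^ n)"
  using assms(3)
proof (induction n rule: less_induct)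
  case (less n)
  have K1: "trace_sum 1 = - (\<alpha> + \<beta>)" using assms(1) by simp
  consider "n = 1" | "n = 2" | "n \<ge> 3" using less.prems by linarith
  thus ?case
  proof cases
    case 1
    thus ?thesis using K1 by simp
  next
    case 2
    have "2 * char_sum 2 = trace_sum 1 * char_sum 1 + trace_sum 2 * char_sum 0"
      using newton_identity[of 2] by (simp add: numeral_2_eq_2)
    hence "trace_sum 2 = 2 * of_nat p - trace_sum 1 * trace_sum 1"
      using newton_identity[of 1] by (simp add: char_sum_0 char_sum_2 algebra_simps)
    thus ?thesis unfolding 2 K1 assms(2)[symmetric] by (simp add: power2_eq_square algebra_simps)
  next
    case 3
    define m where "m = n - 2"
    have m: "n = m + 2" "m > 0" using 3 by (auto simp: m_def)
    have "trace_sum n = - (trace_sum 1 * trace_sum (m + 1)) - of_nat p * trace_sum m"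
      using trace_sum_recurrence[OF 3] by (simp add: m)
    also have "\<dots> = (\<alpha> + \<beta>) * trace_sum (m + 1) - \<alpha> * \<beta> * trace_sum m"
      by (simp only: K1 assms(2) mult_minus_left minus_minus)
    also have "trace_sum (m + 1) = - (\<alpha> ^ (m + 1) + \<beta> ^ (m + 1))" by (rule less.IH) (use m in auto)
    also have "trace_sum m = - (\<alpha> ^ m + \<beta> ^ m)" by (rule less.IH) (use m in auto)
    finally show ?thesis unfolding m by (simp add: algebra_simps)
  qed
qed

theorem norm_trace_sum_1_le: "norm (trace_sum 1) \<le> 2 * sqrt (real p)"
proof (rule ccontr)
  assume big: "\<not> ?thesis"
  define r where "r = csqrt (trace_sum 1 ^ 2 - 4 * of_nat p)"
  have r2: "r * r = trace_sum 1 ^ 2 - 4 * of_nat p" unfolding r_def power2_eq_square[symmetric] by simp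
  have "\<exists>\<alpha> \<beta>. \<alpha> + \<beta> = - trace_sum 1 \<and> \<alpha> * \<beta> = of_nat p \<and> norm \<beta> \<le> norm \<alpha>"
  proof -
    define u where "u = (- trace_sum 1 + r) / 2"
    define v where "v = (- trace_sum 1 - r) / 2"
    have "u + v = - trace_sum 1" by (simp add: u_def v_def field_simps)
    moreover have "u * v = of_nat p"
    proof -
      have "u * v = (trace_sum 1 ^ 2 - r * r) / 4" by (simp add: u_def v_def power2_eq_square algebra_simps)
      thus ?thesis unfolding r2 by simp
    qed
    ultimately have uv: "u + v = - trace_sum 1 \<and> u * v = of_nat p" "v + u = - trace_sum 1 \<and> v * u = of_nat p"
      by (simp_all add: add.commute mult.commute)
    show ?thesis
    proof (cases "norm v \<le> norm u")
      case True
      with uv(1) show ?thesis by blast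
    next
      case False
      hence "norm u \<le> norm v" by simp
      with uv(2) show ?thesis by blast
    qed
  qed
  then obtain \<alpha> \<beta> where ab: "\<alpha> + \<beta> = - trace_sum 1" "\<alpha> * \<beta> = of_nat p" "norm \<beta> \<le> norm \<alpha>" by blast
  have sp: "sqrt (real p) > 0" using p_pos by simp
  have prod: "norm \<alpha> * norm \<beta> = real p" using ab(2) by (metis norm_mult norm_of_nat)
  have "norm \<alpha> + norm \<beta> > 2 * sqrt (real p)"
    using big norm_triangle_ineq[of \<alpha> \<beta>] ab(1) by (simp add: norm_minus_cancel)
  hence \<alpha>: "norm \<alpha> > sqrt (real p)" using ab(3) by linarith
  hence \<beta>: "norm \<beta> \<le> sqrt (real p)"
  proof -
    have "norm \<alpha> * norm \<beta> = sqrt (real p) * sqrt (real p)" using prod by simp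
    also have "\<dots> \<le> norm \<alpha> * sqrt (real p)" using \<alpha> sp by (intro mult_right_mono) auto
    finally have "norm \<alpha> * norm \<beta> \<le> norm \<alpha> * sqrt (real p)" .
    moreover have "norm \<alpha> > 0" using \<alpha> sp by linarith
    ultimately show ?thesis by (simp only: mult_le_cancel_left_pos)
  qed
  define t where "t = (norm \<alpha>)\<^sup>2 / real p"
  have t: "t > 1"
  proof -
    have "(sqrt (real p))\<^sup>2 < (norm \<alpha>)\<^sup>2" using \<alpha> sp by (intro power_strict_mono) auto
    thus ?thesis using p_pos by (simp add: t_def)
  qed
  \<comment> \<open>After division by \<open>p ^ \<mu>\<close>, the constant
    \<open>2 * p + 3\<close> collects \<open>2 * p + 1\<close> from the point count, its additive 1,
    and 1 for the power of \<beta>.\<close>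
  have bound: "t ^ \<mu> \<le> 2 * real p + 3" if "\<mu> \<ge> 2" for \<mu>
  proof -
    have "trace_sum (2 * \<mu>) = - (\<alpha> ^ (2 * \<mu>) + \<beta> ^ (2 * \<mu>))"
      by (rule trace_sum_eq_power_sum[OF ab(1,2)]) (use that in simp)
    hence "norm (\<alpha> ^ (2 * \<mu>)) - norm (\<beta> ^ (2 * \<mu>)) \<le> norm (trace_sum (2 * \<mu>))"
      using norm_diff_ineq[of "\<alpha> ^ (2 * \<mu>)" "\<beta> ^ (2 * \<mu>)"] by (simp only: norm_minus_cancel)
    moreover have "norm (\<beta> ^ (2 * \<mu>)) \<le> real p ^ \<mu>"
    proof -
      have "norm \<beta> ^ (2 * \<mu>) \<le> sqrt (real p) ^ (2 * \<mu>)" using \<beta> by (intro power_mono) auto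
      thus ?thesis by (simp add: norm_power power_mult)
    qed
    ultimately have "norm (\<alpha> ^ (2 * \<mu>)) \<le> (2 * real p + 1) * real p ^ \<mu> + 1 + real p ^ \<mu>"
      using norm_trace_sum_even_le[OF that] by linarith
    also have "\<dots> \<le> (2 * real p + 3) * real p ^ \<mu>"
      using p_pos one_le_power[of "real p" \<mu>] by (simp add: algebra_simps)
    finally show ?thesis
      using p_pos by (simp add: t_def norm_power power_mult power_divide divide_le_eq)
  qed
  obtain n where n: "2 * real p + 3 < t ^ n" using real_arch_pow[OF t] by blast
  have "t ^ n \<le> t ^ (n + 2)" using t by (intro power_increasing) auto
  moreover have "t ^ (n + 2) \<le> 2 * real p + 3" by (rule bound) simp
  ultimately show False using n by linarith
qed

end

section \<open>Weil's bound\<close>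

definition unit_residues :: "nat \<Rightarrow> int set" where
  "unit_residues c = {x \<in> {0..<int c}. coprime x (int c)}"

lemma coprime_prime_iff:
  assumes "prime p"
  shows "coprime x (int p) \<longleftrightarrow> \<not> int p dvd x"
proof
  assume "coprime x (int p)"
  thus "\<not> int p dvd x"
    using assms coprime_common_divisor[of x "int p" "int p"] by (auto simp: prime_gt_1_nat)
next
  assume "\<not> int p dvd x"
  hence "coprime (int p) x" using assms by (intro prime_imp_coprime) auto
  thus "coprime x (int p)" by (simp add: coprime_commute)
qed

lemma odd_prime_not_dvd_2:
  assumes "prime p" "odd p"
  shows "\<not> int p dvd 2"
proof
  assume "int p dvd 2"
  hence "p dvd 2" by presburger
  hence "p \<le> 2" by (rule dvd_imp_le) simp
  thus False using assms prime_ge_2_nat[of p] by auto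
qed

lemma coprime_one_plus_power:
  assumes "prime p" "k > 0"
  shows "coprime (1 + int p ^ k * t) (int p)"
proof -
  have "\<not> int p dvd 1 + int p ^ k * t"
  proof
    assume "int p dvd 1 + int p ^ k * t"
    moreover have "int p dvd int p ^ k * t" using assms(2) by simp
    ultimately have "int p dvd 1" by (metis dvd_add_left_iff)
    thus False using assms(1) by (simp add: prime_nat_iff)
  qed
  thus ?thesis using coprime_prime_iff[OF assms(1)] by blast
qed

lemma coprime_prime_power_iff:
  assumes "prime p" "l > 0"
  shows "coprime x (int (p ^ l)) \<longleftrightarrow> \<not> int p dvd x"
  using assms coprime_prime_iff[OF assms(1), of x] by simp

lemma unit_residues_prime:
  assumes "prime p"
  shows "unit_residues p = {0..<int p} - {0}"
  unfolding unit_residues_def coprime_prime_iff[OF assms] by (auto dest: zdvd_imp_le)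

definition weil_bound :: "nat \<Rightarrow> bool" where
  "weil_bound p \<longleftrightarrow> (\<forall>a b. \<not> int p dvd a \<longrightarrow> \<not> int p dvd b \<longrightarrow>
     norm (\<Sum>x\<in>unit_residues p. ephase p (a * x + b * modular_inverse (int p) x)) \<le> 2 * sqrt (real p))"

text \<open>Reduction of integers identifies the unit residues with the nonzero elements of
  \<open>fixed (Suc 0)\<close>, where the trace of index 1 is the identity; the sum is therefore
  \<open>trace_sum 1\<close>.\<close>

lemma weil_bound_CHAR:
  assumes p: "prime p" "odd p" "CHAR('k::alg_closed_field) = p"
  shows "weil_bound p"
  unfolding weil_bound_def
proof (intro allI impI)
  fix a b :: int
  assume ab: "\<not> int p dvd a" "\<not> int p dvd b"
  have zero_iff: "of_int z = (0::'k) \<longleftrightarrow> int p dvd z" for z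
    using of_int_eq_0_iff_char_dvd[of z, where 'a = 'k] p(3) by simp
  have frob_nat: "(of_nat n :: 'k) ^ p = of_nat n" for n
    by (induction n) (use p in \<open>auto simp: freshmans_dream prime_gt_0_nat\<close>)
  have frob: "(of_int z :: 'k) ^ p = of_int z" for z
    using frob_nat p(2) by (cases z rule: int_cases2) auto
  interpret frobenius_field "of_int a :: 'k" "of_int b" p
    using p ab frob by unfold_locales (auto simp: zero_iff)
  note ur = unit_residues_prime[OF p(1)]
  have bij: "bij_betw of_int (unit_residues p) (fixed (Suc 0) - {0})"
  proof (rule bij_betw_imageI)
    show "inj_on (of_int :: int \<Rightarrow> 'k) (unit_residues p)"
      using inj_of_int by (rule inj_on_subset) (auto simp: ur)
    have "of_int ` ({0..<int p} - {0}) = (of_int ` {0..<int p} - of_int ` {0} :: 'k set)"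
      by (rule inj_on_image_set_diff[OF inj_of_int]) (use p_pos in auto)
    thus "of_int ` unit_residues p = fixed (Suc 0) - {0}"
      by (simp add: ur prime_subfield)
  qed
  have "trace_sum 1 = (\<Sum>x\<in>unit_residues p. psi (frob_trace 1 (phase (of_int x))))"
    unfolding trace_sum_def using sum.reindex_bij_betw[OF bij, of "\<lambda>x. psi (frob_trace 1 (phase x))"] by simp
  also have "\<dots> = (\<Sum>x\<in>unit_residues p. ephase p (a * x + b * modular_inverse (int p) x))"
  proof (intro sum.cong refl)
    fix x assume x: "x \<in> unit_residues p"
    hence "[x * modular_inverse (int p) x = 1] (mod int p)"
      by (intro cong_modular_inverse1) (simp add: unit_residues_def)
    hence "of_int x * of_int (modular_inverse (int p) x) = (1 :: 'k)"
      unfolding of_int_eq_iff[symmetric] by simp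
    hence "of_int (modular_inverse (int p) x) = 1 / (of_int x :: 'k)"
      by (metis inverse_unique inverse_eq_divide)
    hence "frob_trace 1 (phase (of_int x)) = of_int (a * x + b * modular_inverse (int p) x)"
      by (simp add: frob_trace_def phase_def)
    thus "psi (frob_trace 1 (phase (of_int x))) = ephase p (a * x + b * modular_inverse (int p) x)"
      by (simp only: psi_of_int)
  qed
  finally show "norm (\<Sum>x\<in>unit_residues p. ephase p (a * x + b * modular_inverse (int p) x))
      \<le> 2 * sqrt (real p)"
    using norm_trace_sum_1_le by simp
qed

text \<open>
  \<open>weil_bound_CHAR\<close> needs a type of characteristic \<open>p\<close>, and types cannot depend on the variable
  \<open>p\<close>. It is enough to have such a type for one prime, chosen as a counterexample if there is any.
\<close>
definition exceptional_prime :: nat where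
  "exceptional_prime = (if \<exists>p. prime p \<and> odd p \<and> \<not> weil_bound p
     then SOME p. prime p \<and> odd p \<and> \<not> weil_bound p else 3)"

text \<open>The default 3 makes this hold even without a counterexample, so the type below always
  has odd prime cardinality.\<close>

lemma exceptional_prime: "prime exceptional_prime" "odd exceptional_prime"
proof -
  have "prime exceptional_prime \<and> odd exceptional_prime"
  proof (cases "\<exists>p::nat. prime p \<and> odd p \<and> \<not> weil_bound p")
    case True
    from someI_ex[OF this] show ?thesis using True by (simp add: exceptional_prime_def)
  next
    case False
    thus ?thesis unfolding exceptional_prime_def if_not_P[OF False] by simp
  qed
  thus "prime exceptional_prime" "odd exceptional_prime" by auto
qed

typedef exceptional_index = "{0..<exceptional_prime}"
  using exceptional_prime(1) by (auto intro!: exI[of _ 0] prime_gt_0_nat)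

lemma CARD_exceptional_index: "CARD(exceptional_index) = exceptional_prime"
  using type_definition.card[OF type_definition_exceptional_index] by simp

instance exceptional_index :: prime_card
  by standard (simp add: CARD_exceptional_index exceptional_prime)

theorem weil_bound:
  assumes "prime p" "odd p"
  shows "weil_bound p"
proof (rule ccontr)
  assume "\<not> ?thesis"
  hence *: "\<exists>p. prime p \<and> odd p \<and> \<not> weil_bound p" using assms by blast
  have "\<not> weil_bound exceptional_prime"
    using someI_ex[OF *] * by (simp add: exceptional_prime_def)
  moreover have "weil_bound exceptional_prime"
    by (rule weil_bound_CHAR[where 'k = "exceptional_index mod_ring alg_closure"])
       (simp_all add: exceptional_prime CARD_exceptional_index)
  ultimately show False by contradiction
qed

section \<open>Quadratic congruences modulo prime powers\<close>

lemma finite_unit_residues [simp]: "finite (unit_residues c)"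
  by (rule finite_subset[of _ "{0..<int c}"]) (auto simp: unit_residues_def)

lemma card_unit_residues_le: "card (unit_residues c) \<le> c"
proof -
  have "card (unit_residues c) \<le> card {0..<int c}"
    by (intro card_mono) (auto simp: unit_residues_def)
  thus ?thesis by simp
qed

lemma coprime_mod_iff: "coprime (x mod int c) (int c) \<longleftrightarrow> coprime x (int c)"
  using cong_imp_coprime[of "x mod int c" x "int c"] cong_imp_coprime[of x "x mod int c" "int c"]
  by (auto simp: cong_def)

lemma finite_residues_Collect: "finite {x \<in> {0..<int c}. P x}"
  by (rule finite_subset[of _ "{0..<int c}"]) auto

lemma sum_unit_residues_mult:
  fixes F :: "int \<Rightarrow> complex"
  assumes "c > 0" "\<And>x y. [x = y] (mod int c) \<Longrightarrow> F x = F y" "[u * v = 1] (mod int c)"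
  shows "(\<Sum>x\<in>unit_residues c. F (u * x)) = (\<Sum>x\<in>unit_residues c. F x)"
proof -
  have cop: "coprime u (int c)" "coprime v (int c)"
    using assms(3) by (metis coprime_iff_invertible_int, metis coprime_iff_invertible_int mult.commute)
  have uv: "(u * (v * x mod int c)) mod int c = x" "(v * (u * x mod int c)) mod int c = x"
    if "x \<in> unit_residues c" for x
  proof -
    have "[u * v * x = 1 * x] (mod int c)" by (intro cong_mult assms(3)) auto
    moreover have "x mod int c = x" using that by (simp add: unit_residues_def)
    ultimately show "(u * (v * x mod int c)) mod int c = x" "(v * (u * x mod int c)) mod int c = x"
      by (simp_all add: cong_def mod_mult_right_eq mult_ac)
  qed
  show ?thesis
  proof (rule sum.reindex_bij_witness[of _ "\<lambda>x. (v * x) mod int c" "\<lambda>x. (u * x) mod int c"])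
    fix x assume x: "x \<in> unit_residues c"
    show "(v * ((u * x) mod int c)) mod int c = x" using uv(2)[OF x] .
    show "(u * ((v * x) mod int c)) mod int c = x" using uv(1)[OF x] .
    show "(u * x) mod int c \<in> unit_residues c" "(v * x) mod int c \<in> unit_residues c"
      using x cop assms(1) by (auto simp: unit_residues_def coprime_mod_iff)
    show "F ((u * x) mod int c) = F (u * x)" by (rule assms(2)) (simp add: cong_def)
  qed
qed

lemma sum_residues_shift:
  fixes F :: "int \<Rightarrow> complex"
  assumes "c > 0" "\<And>x y. [x = y] (mod int c) \<Longrightarrow> F x = F y"
  shows "(\<Sum>x\<in>{0..<int c}. F (x + s)) = (\<Sum>x\<in>{0..<int c}. F x)"
proof (rule sum.reindex_bij_witness[of _ "\<lambda>x. (x - s) mod int c" "\<lambda>x. (x + s) mod int c"])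
  fix x assume x: "x \<in> {0..<int c}"
  show "((x + s) mod int c - s) mod int c = x" "((x - s) mod int c + s) mod int c = x"
    using x by (simp_all add: mod_diff_left_eq mod_add_left_eq)
  show "(x + s) mod int c \<in> {0..<int c}" "(x - s) mod int c \<in> {0..<int c}" using assms(1) by auto
  show "F ((x + s) mod int c) = F (x + s)" by (rule assms(2)) (simp add: cong_def)
qed

lemma ephase_cong_mult:
  assumes "[x = y] (mod int c)"
  shows "ephase c (w * x) = ephase c (w * y)"
  by (intro ephase_cong cong_mult assms cong_refl)

lemma sum_ephase:
  assumes "c > 0"
  shows "(\<Sum>t\<in>{0..<int c}. ephase c (w * t)) = (if int c dvd w then of_nat c else 0)"
proof (cases "int c dvd w")
  case True
  hence "ephase c (w * t) = 1" for t using assms by (simp add: ephase_eq_1_iff)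
  thus ?thesis using True by simp
next
  case False
  let ?S = "\<Sum>t\<in>{0..<int c}. ephase c (w * t)"
  have "?S = (\<Sum>t\<in>{0..<int c}. ephase c (w * (t + 1)))"
    by (rule sum_residues_shift[symmetric, OF assms ephase_cong_mult])
  also have "\<dots> = ephase c w * ?S"
    by (simp add: distrib_left ephase_add sum_distrib_left mult.commute)
  finally have "(ephase c w - 1) * ?S = 0" by (simp add: algebra_simps)
  moreover have "ephase c w \<noteq> 1" using False assms by (simp add: ephase_eq_1_iff)
  ultimately show ?thesis using False by simp
qed

lemma ephase_uminus: "ephase c (- x) = cnj (ephase c x)"
proof -
  have "ephase c (- x) * ephase c x = 1" by (simp flip: ephase_add)
  moreover have "cnj (ephase c x) * ephase c x = 1"
    by (simp add: complex_norm_square[symmetric] mult.commute)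
  ultimately show ?thesis
    by (metis mult_right_cancel norm_ephase norm_zero zero_neq_one)
qed

text \<open>In the squared norm, substituting \<open>t = d + s\<close> makes the phase linear in
  \<open>s\<close> with coefficient \<open>2 * v * d\<close>; orthogonality leaves only
  \<open>d = 0\<close>.\<close>

lemma norm_quadratic_gauss_sum:
  assumes p: "prime p" "odd p" and v: "\<not> int p dvd v"
  shows "norm (\<Sum>t\<in>{0..<int p}. ephase p (w * t + v * t\<^sup>2)) = sqrt (real p)"
proof -
  have p0: "p > 0" using p prime_gt_0_nat by blast
  define G where "G = (\<Sum>t\<in>{0..<int p}. ephase p (w * t + v * t\<^sup>2))"
  let ?R = "{0..<int p}"
  have "G * cnj G = (\<Sum>s\<in>?R. cnj (ephase p (w * s + v * s\<^sup>2))) * G"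
    by (simp add: G_def mult.commute)
  also have "\<dots> = (\<Sum>s\<in>?R. cnj (ephase p (w * s + v * s\<^sup>2)) * (\<Sum>t\<in>?R. ephase p (w * t + v * t\<^sup>2)))"
    unfolding G_def by (rule sum_distrib_right)
  also have "\<dots> = (\<Sum>s\<in>?R. cnj (ephase p (w * s + v * s\<^sup>2)) * (\<Sum>d\<in>?R. ephase p (w * (d + s) + v * (d + s)\<^sup>2)))"
  proof (rule sum.cong[OF refl], rule arg_cong2[where f = "(*)", OF refl])
    fix s
    show "(\<Sum>t\<in>?R. ephase p (w * t + v * t\<^sup>2)) = (\<Sum>d\<in>?R. ephase p (w * (d + s) + v * (d + s)\<^sup>2))"
      by (rule sum_residues_shift[symmetric, OF p0])
         (intro ephase_cong cong_add cong_mult cong_pow cong_refl)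
  qed
  also have "\<dots> = (\<Sum>s\<in>?R. \<Sum>d\<in>?R. ephase p (w * d + v * d\<^sup>2) * ephase p ((2 * v * d) * s))"
    unfolding sum_distrib_left
  proof (intro sum.cong refl)
    fix s d
    have "cnj (ephase p (w * s + v * s\<^sup>2)) * ephase p (w * (d + s) + v * (d + s)\<^sup>2) =
      ephase p (- (w * s + v * s\<^sup>2) + (w * (d + s) + v * (d + s)\<^sup>2))"
      by (simp only: ephase_add ephase_uminus)
    also have "- (w * s + v * s\<^sup>2) + (w * (d + s) + v * (d + s)\<^sup>2) = (w * d + v * d\<^sup>2) + (2 * v * d) * s"
      by (simp add: power2_eq_square algebra_simps)
    finally show "cnj (ephase p (w * s + v * s\<^sup>2)) * ephase p (w * (d + s) + v * (d + s)\<^sup>2) =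
      ephase p (w * d + v * d\<^sup>2) * ephase p ((2 * v * d) * s)" by (simp only: ephase_add)
  qed
  also have "\<dots> = (\<Sum>d\<in>?R. ephase p (w * d + v * d\<^sup>2) * (\<Sum>s\<in>?R. ephase p ((2 * v * d) * s)))"
    by (subst sum.swap) (simp add: sum_distrib_left)
  also have "\<dots> = (\<Sum>d\<in>?R. if d = 0 then of_nat p else 0)"
  proof (intro sum.cong refl)
    fix d assume d: "d \<in> ?R"
    have "int p dvd 2 * v * d \<longleftrightarrow> d = 0"
    proof
      assume "int p dvd 2 * v * d"
      moreover have "\<not> int p dvd 2" by (rule odd_prime_not_dvd_2[OF p])
      ultimately have "int p dvd d" using v p(1) by (simp add: prime_dvd_mult_iff)
      thus "d = 0" using d by (auto dest: zdvd_imp_le)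
    qed simp
    thus "ephase p (w * d + v * d\<^sup>2) * (\<Sum>s\<in>?R. ephase p ((2 * v * d) * s)) = (if d = 0 then of_nat p else 0)"
      unfolding sum_ephase[OF p0] by simp
  qed
  also have "\<dots> = of_nat p" using p0 by simp
  finally have "of_real ((norm G)\<^sup>2) = (of_real (real p) :: complex)"
    unfolding complex_norm_square by simp
  hence "(norm G)\<^sup>2 = real p" by (simp only: of_real_eq_iff)
  thus ?thesis unfolding G_def[symmetric] by (metis norm_ge_zero real_sqrt_unique)
qed

lemma ephase_prime_power_scale:
  assumes "p > 0"
  shows "ephase (p ^ (k + n)) (int p ^ k * y) = ephase (p ^ n) y"
  using assms by (simp add: ephase_def power_add)

lemma modular_inverse_eqI_cong:
  assumes "coprime x (int c)" "[x * y = 1] (mod int c)"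
  shows "[ modular_inverse (int c) x = y] (mod int c)"
proof -
  have "[x * modular_inverse (int c) x = x * y] (mod int c)"
    using cong_modular_inverse1[OF assms(1)] cong_sym[OF assms(2)] by (rule cong_trans)
  thus ?thesis using assms(1) by (simp add: cong_mult_lcancel)
qed

lemma modular_inverse_cong:
  assumes "[x = y] (mod int c)"
  shows "[ modular_inverse (int c) x = modular_inverse (int c) y] (mod int c)"
proof (cases "coprime x (int c)")
  case True
  hence cy: "coprime y (int c)" using assms cong_imp_coprime by blast
  have "[x * modular_inverse (int c) y = y * modular_inverse (int c) y] (mod int c)"
    by (intro cong_mult assms cong_refl)
  hence "[x * modular_inverse (int c) y = 1] (mod int c)"
    using cong_modular_inverse1[OF cy] by (rule cong_trans)
  thus ?thesis by (rule modular_inverse_eqI_cong[OF True])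
next
  case False
  hence "\<not> coprime y (int c)" using assms cong_imp_coprime cong_sym by blast
  thus ?thesis using False by simp
qed

lemma modular_inverse_mult_cong:
  assumes "coprime x (int c)" "[u * v = 1] (mod int c)"
  shows "[ modular_inverse (int c) (u * x) = v * modular_inverse (int c) x] (mod int c)"
proof (rule modular_inverse_eqI_cong)
  have "coprime u (int c)" using assms(2) coprime_iff_invertible_int by blast
  thus "coprime (u * x) (int c)" using assms(1) by simp
  have "[(u * v) * (x * modular_inverse (int c) x) = 1 * 1] (mod int c)"
    by (intro cong_mult assms(2) cong_modular_inverse1 assms(1))
  thus "[(u * x) * (v * modular_inverse (int c) x) = 1] (mod int c)" by (simp add: mult_ac)
qed

section \<open>Counting roots through p-adic valuations\<close>

lemma prime_power_dvd_mult_split: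
  fixes p u v :: int
  assumes "prime p" "p ^ n dvd u * v" "\<not> p ^ Suc i dvd u"
  shows "p ^ (n - i) dvd v"
  using assms(2,3)
proof (induction i arbitrary: u n)
  case 0
  have "coprime (p ^ n) u" using 0 assms(1) by (simp add: prime_imp_coprime)
  thus ?case using 0 by (simp add: coprime_dvd_mult_right_iff)
next
  case (Suc i)
  show ?case
  proof (cases "p dvd u")
    case True
    then obtain w where w: "u = p * w" by blast
    have p0: "p \<noteq> 0" using assms(1) by auto
    have nw: "\<not> p ^ Suc i dvd w" using Suc.prems(2) p0 by (simp add: w)
    show ?thesis
    proof (cases n)
      case (Suc m)
      have "p ^ m dvd w * v" using Suc.prems(1) p0 by (simp add: w Suc mult.assoc)
      from Suc.IH[OF this nw] show ?thesis by (simp add: Suc)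
    qed simp
  next
    case False
    hence "coprime (p ^ n) u" using assms(1) by (simp add: prime_imp_coprime)
    hence "p ^ n dvd v" using Suc.prems(1) by (simp add: coprime_dvd_mult_right_iff)
    thus ?thesis by (rule dvd_trans[OF le_imp_power_dvd[OF diff_le_self]])
  qed
qed

text \<open>If both valuations were at most \<open>h - 1\<close>, their sum would be at most
  \<open>2 * h - 2\<close>, which is below \<open>n\<close>.\<close>

lemma prime_power_dvd_mult_half:
  fixes p u v :: int
  assumes "prime p" "p ^ n dvd u * v" "2 * h \<le> n + 1"
  shows "p ^ h dvd u \<or> p ^ h dvd v"
proof (cases h)
  case (Suc i)
  show ?thesis
  proof (cases "p ^ h dvd u")
    case False
    hence "p ^ (n - i) dvd v"
      using prime_power_dvd_mult_split[OF assms(1,2), of i] by (simp add: Suc)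
    moreover have "h \<le> n - i" using assms(3) Suc by simp
    ultimately show ?thesis using le_imp_power_dvd dvd_trans by blast
  qed simp
qed simp

text \<open>Not both \<open>u\<close> and \<open>v\<close> can have valuation above
  \<open>s\<close>; the one that does not leaves at least \<open>n - s\<close> to the other.\<close>

lemma prime_power_dvd_mult_diff:
  fixes p u v :: int
  assumes "prime p" "p ^ n dvd u * v" "\<not> p ^ Suc s dvd v - a * u"
  shows "p ^ (n - s) dvd u \<or> p ^ (n - s) dvd v"
proof (cases "p ^ Suc s dvd u")
  case True
  hence "\<not> p ^ Suc s dvd v" using assms(3) by (metis dvd_diff dvd_mult)
  moreover have "p ^ n dvd v * u" using assms(2) by (simp add: mult.commute)
  ultimately show ?thesis using prime_power_dvd_mult_split[OF assms(1)] by blast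
next
  case False
  thus ?thesis using prime_power_dvd_mult_split[OF assms(1,2)] by blast
qed

lemma int_div_less:
  fixes x m d :: int
  assumes "0 < m" "x < m * d"
  shows "x div m < d"
proof (rule ccontr)
  assume "\<not> ?thesis"
  hence "m * d \<le> m * (x div m)" using assms(1) by (intro mult_left_mono) auto
  also have "\<dots> \<le> x" using assms(1) by (simp add: minus_mod_eq_mult_div[symmetric])
  finally show False using assms(2) by simp
qed

lemma card_pairwise_cong_le:
  assumes "S \<subseteq> {0..<int (m * d)}" "m > 0" "\<And>x y. x \<in> S \<Longrightarrow> y \<in> S \<Longrightarrow> int m dvd x - y"
  shows "card S \<le> d"
proof -
  have "inj_on (\<lambda>x. x div int m) S"
  proof (rule inj_onI)
    fix x y assume xy: "x \<in> S" "y \<in> S" "x div int m = y div int m"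
    have "x mod int m = y mod int m" using assms(3)[OF xy(1,2)] by (simp add: mod_eq_dvd_iff)
    with xy(3) show "x = y" by (metis div_mult_mod_eq)
  qed
  moreover have "(\<lambda>x. x div int m) ` S \<subseteq> {0..<int d}"
  proof
    fix z assume "z \<in> (\<lambda>x. x div int m) ` S"
    then obtain x where x: "x \<in> S" "z = x div int m" by blast
    hence "0 \<le> x" "x < int m * int d" using assms(1) by auto
    have "x div int m < int d" using assms(2) \<open>x < int m * int d\<close> by (intro int_div_less) auto
    thus "z \<in> {0..<int d}" using x(2) assms(2) \<open>0 \<le> x\<close>
      by (simp add: pos_imp_zdiv_nonneg_iff)
  qed
  ultimately have "card S \<le> card {0..<int d}" by (intro card_inj_on_le) auto
  thus ?thesis by simp
qed

lemma card_linear_residues_le: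
  assumes "prime p" "h \<le> l" "\<not> int p dvd \<alpha>"
  shows "card {x \<in> {0..<int (p ^ l)}. int p ^ h dvd \<alpha> * x + \<beta>} \<le> p ^ (l - h)"
proof (rule card_pairwise_cong_le[where m = "p ^ h"])
  show "{x \<in> {0..<int (p ^ l)}. int p ^ h dvd \<alpha> * x + \<beta>} \<subseteq> {0..<int (p ^ h * p ^ (l - h))}"
    using assms(2) by (auto simp: power_add[symmetric])
  show "p ^ h > 0" using assms(1) prime_gt_0_nat by simp
  fix x y assume "x \<in> {x \<in> {0..<int (p ^ l)}. int p ^ h dvd \<alpha> * x + \<beta>}"
    "y \<in> {x \<in> {0..<int (p ^ l)}. int p ^ h dvd \<alpha> * x + \<beta>}"
  hence "int p ^ h dvd (\<alpha> * x + \<beta>) - (\<alpha> * y + \<beta>)" by (intro dvd_diff) auto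
  hence "int p ^ h dvd \<alpha> * (x - y)" by (simp add: algebra_simps)
  moreover have "coprime (int p ^ h) \<alpha>" using assms by (simp add: prime_imp_coprime)
  ultimately have "int p ^ h dvd x - y" by (simp add: coprime_dvd_mult_right_iff)
  thus "int (p ^ h) dvd x - y" by simp
qed

text \<open>The congruence is modulo \<open>p ^ n\<close>, but the roots are counted modulo
  \<open>p ^ l\<close>.\<close>

definition quadratic_roots :: "nat \<Rightarrow> nat \<Rightarrow> nat \<Rightarrow> int \<Rightarrow> int \<Rightarrow> int \<Rightarrow> int set" where
  "quadratic_roots p l n a B b =
     {x \<in> {0..<int (p ^ l)}. \<not> int p dvd x \<and> int p ^ n dvd a * x\<^sup>2 + B * x - b}"

lemma quadratic_roots_factor:
  assumes "x \<in> quadratic_roots p l n a B b" "x0 \<in> quadratic_roots p l n a B b"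
  shows "int p ^ n dvd (x - x0) * (a * (x + x0) + B)"
proof -
  have "int p ^ n dvd (a * x\<^sup>2 + B * x - b) - (a * x0\<^sup>2 + B * x0 - b)"
    using assms by (intro dvd_diff[of _ "a * x\<^sup>2 + B * x - b"]) (simp_all add: quadratic_roots_def)
  also have "(a * x\<^sup>2 + B * x - b) - (a * x0\<^sup>2 + B * x0 - b) = (x - x0) * (a * (x + x0) + B)"
    by (simp add: power2_eq_square algebra_simps)
  finally show ?thesis .
qed

text \<open>Relative to one root \<open>x0\<close>, any root \<open>x\<close> gives factors
  \<open>u = x - x0\<close> and \<open>v = a * (x + x0) + B\<close>, and \<open>v - a * u\<close> is
  the derivative at \<open>x0\<close>. Divisibility of either factor puts \<open>x\<close> in one
  class modulo \<open>p ^ h\<close>.\<close>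

lemma card_quadratic_roots_split:
  assumes p: "prime p" "h \<le> l" "\<not> int p dvd a"
    and x0: "x0 \<in> quadratic_roots p l n a B b"
    and split: "\<And>u v. int p ^ n dvd u * v \<Longrightarrow> v - a * u = 2 * a * x0 + B \<Longrightarrow>
      int p ^ h dvd u \<or> int p ^ h dvd v"
  shows "card (quadratic_roots p l n a B b) \<le> 2 * p ^ (l - h)"
proof -
  let ?A = "{x \<in> {0..<int (p ^ l)}. int p ^ h dvd 1 * x + (- x0)}"
  let ?B = "{x \<in> {0..<int (p ^ l)}. int p ^ h dvd a * x + (a * x0 + B)}"
  have "quadratic_roots p l n a B b \<subseteq> ?A \<union> ?B"
  proof
    fix x assume x: "x \<in> quadratic_roots p l n a B b"
    have "int p ^ h dvd x - x0 \<or> int p ^ h dvd a * (x + x0) + B"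
      by (rule split[OF quadratic_roots_factor[OF x x0]]) (simp add: algebra_simps)
    thus "x \<in> ?A \<union> ?B" using x by (auto simp: quadratic_roots_def algebra_simps)
  qed
  hence "card (quadratic_roots p l n a B b) \<le> card (?A \<union> ?B)"
    by (intro card_mono finite_UnI finite_residues_Collect)
  also have "\<dots> \<le> card ?A + card ?B" by (rule card_Un_le)
  also have "\<dots> \<le> p ^ (l - h) + p ^ (l - h)"
    using p prime_gt_1_nat[OF p(1)] by (intro add_mono card_linear_residues_le) auto
  finally show ?thesis by simp
qed

text \<open>The count that holds without control of the derivative: one of the two factors takes at
  least half of the divisibility.\<close>

lemma card_quadratic_roots_half:
  assumes p: "prime p" "n > 0" "n \<le> l" "2 * h \<le> n + 1" and ab: "\<not> (int p dvd a \<and> int p dvd b)"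
  shows "card (quadratic_roots p l n a B b) \<le> 2 * p ^ (l - h)"
proof (cases "quadratic_roots p l n a B b = {}")
  case False
  then obtain x0 where x0: "x0 \<in> quadratic_roots p l n a B b" by blast
  have hn: "h \<le> n" using p by auto
  show ?thesis
  proof (cases "int p dvd a")
    case False
    show ?thesis
      by (rule card_quadratic_roots_split[OF p(1) _ False x0])
         (use hn p prime_power_dvd_mult_half in auto)
  next
    case True
    have pn: "int p dvd int p ^ n" using p(2) by simp
    \<comment> \<open>With \<open>p\<close> dividing \<open>a\<close> the congruence is linear
      modulo \<open>p\<close>. Then \<open>B\<close> is a unit, hence also the second factor, and
      all roots agree modulo \<open>p ^ n\<close>.\<close>
    have nB: "\<not> int p dvd B"
    proof
      assume "int p dvd B"
      hence "int p dvd a * x0\<^sup>2 + B * x0" using True by auto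
      moreover have "int p dvd a * x0\<^sup>2 + B * x0 - b"
        using x0 pn dvd_trans unfolding quadratic_roots_def by blast
      ultimately have "int p dvd b" by (metis dvd_diff minus_diff_eq diff_diff_eq2 add_diff_cancel_left' dvd_minus_iff)
      thus False using ab True by simp
    qed
    have "quadratic_roots p l n a B b \<subseteq> {x \<in> {0..<int (p ^ l)}. int p ^ n dvd 1 * x + (- x0)}"
    proof
      fix x assume x: "x \<in> quadratic_roots p l n a B b"
      have "\<not> int p dvd a * (x + x0) + B" using True nB by (simp add: dvd_add_right_iff)
      hence "\<not> int p ^ Suc 0 dvd a * (x + x0) + B" by simp
      moreover have "int p ^ n dvd (a * (x + x0) + B) * (x - x0)"
        using quadratic_roots_factor[OF x x0] by (simp add: mult.commute)
      ultimately have "int p ^ (n - 0) dvd x - x0"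
        using p(1) by (intro prime_power_dvd_mult_split) auto
      thus "x \<in> {x \<in> {0..<int (p ^ l)}. int p ^ n dvd 1 * x + (- x0)}"
        using x by (simp add: quadratic_roots_def)
    qed
    hence "card (quadratic_roots p l n a B b)
        \<le> card {x \<in> {0..<int (p ^ l)}. int p ^ n dvd 1 * x + (- x0)}"
      by (intro card_mono finite_residues_Collect)
    also have "\<dots> \<le> p ^ (l - n)"
      using p prime_gt_1_nat[OF p(1)] by (intro card_linear_residues_le) auto
    also have "\<dots> \<le> p ^ (l - h)"
      using hn prime_gt_0_nat[OF p(1)] by (intro power_increasing) auto
    finally show ?thesis by simp
  qed
qed simp

text \<open>When the derivative at a root has valuation at most \<open>s\<close>, the two factors
  cannot share more than that. Since \<open>p\<close> divides \<open>B\<close>, a coefficient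
  \<open>a\<close> divisible by \<open>p\<close> would force \<open>p\<close> to divide
  \<open>b\<close> too.\<close>

lemma card_quadratic_roots_deriv:
  assumes p: "prime p" "n > 0" "n \<le> l" and ab: "\<not> (int p dvd a \<and> int p dvd b)"
    and B: "int p dvd B"
    and s: "\<And>x. \<not> int p dvd x \<Longrightarrow> \<not> int p ^ Suc s dvd 2 * x + B"
  shows "card (quadratic_roots p l n a B b) \<le> 2 * p ^ (l - (n - s))"
proof (cases "quadratic_roots p l n a B b = {}")
  case False
  then obtain x0 where x0: "x0 \<in> quadratic_roots p l n a B b" by blast
  have px0: "\<not> int p dvd x0" using x0 by (simp add: quadratic_roots_def)
  have "int p dvd int p ^ n" using p(2) by simp
  hence *: "int p dvd a * x0\<^sup>2 + B * x0 - b"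
    using x0 dvd_trans unfolding quadratic_roots_def by blast
  have na: "\<not> int p dvd a"
  proof
    assume a: "int p dvd a"
    hence "int p dvd a * x0\<^sup>2 + B * x0" using B by auto
    hence "int p dvd b" using * by (metis add_diff_cancel_left' diff_add_cancel dvd_diff minus_diff_eq dvd_minus_iff)
    thus False using ab a by simp
  qed
  have "\<not> int p dvd a * x0" using na px0 p(1) by (simp add: prime_dvd_mult_iff)
  \<comment> \<open>The hypothesis is used at the unit \<open>a * x0\<close>, not at
    \<open>x0\<close>.\<close>
  hence d: "\<not> int p ^ Suc s dvd 2 * a * x0 + B" using s[of "a * x0"] by (simp add: mult.assoc)
  show ?thesis
  proof (rule card_quadratic_roots_split[OF p(1) _ na x0])
    show "n - s \<le> l" using p(3) by simp
    fix u v assume uv: "int p ^ n dvd u * v" "v - a * u = 2 * a * x0 + B"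
    show "int p ^ (n - s) dvd u \<or> int p ^ (n - s) dvd v"
      by (rule prime_power_dvd_mult_diff[OF _ uv(1), of s a]) (use p(1) d uv(2) in auto)
  qed
qed simp

section \<open>Stationary phase\<close>

lemma dirichlet_character_mult: "dirichlet_character c chi \<Longrightarrow> chi (x * y) = chi x * chi y"
  by (simp add: dirichlet_character_def)

lemma dirichlet_character_nz: "dirichlet_character c chi \<Longrightarrow> chi x \<noteq> 0 \<longleftrightarrow> coprime x (int c)"
  by (simp add: dirichlet_character_def)

lemma dirichlet_character_one: "dirichlet_character c chi \<Longrightarrow> chi 1 = 1"
  using dirichlet_character_mult[of c chi 1 1] dirichlet_character_nz[of c chi 1] by simp

lemma dirichlet_character_cong:
  assumes "dirichlet_character c chi" "[x = y] (mod int c)"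
  shows "chi x = chi y"
proof -
  have per: "chi (x + int n * int c) = chi x" for x n
  proof (induction n)
    case (Suc n)
    have "chi (x + int (Suc n) * int c) = chi (x + int n * int c + int c)"
      by (simp add: algebra_simps)
    also have "\<dots> = chi (x + int n * int c)"
      using assms(1) by (simp add: dirichlet_character_def)
    finally show ?case using Suc by simp
  qed simp
  have "chi (x + z * int c) = chi x" for x z
    using per[of x "nat z"] per[of "x + z * int c" "nat (- z)"] by (cases "z \<ge> 0") auto
  moreover obtain z where "y = x + z * int c"
    using assms(2) by (metis cong_iff_lin mult.commute)
  ultimately show ?thesis by simp
qed

lemma dirichlet_character_power: "dirichlet_character c chi \<Longrightarrow> chi (x ^ n) = chi x ^ n"
  by (induction n) (simp_all add: dirichlet_character_one dirichlet_character_mult)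

lemma norm_dirichlet_character_le:
  assumes "dirichlet_character c chi"
  shows "norm (chi x) \<le> 1"
proof (cases "coprime x (int c)")
  case True
  have c0: "c > 0" using assms by (simp add: dirichlet_character_def)
  define y where "y = nat (x mod int c)"
  have y: "int y = x mod int c" using c0 by (simp add: y_def)
  have "coprime (int y) (int c)" using True unfolding y coprime_mod_iff .
  hence "coprime y c" by simp
  hence "[y ^ totient c = 1] (mod c)" by (rule euler_theorem)
  hence "[int y ^ totient c = 1] (mod int c)" by (metis cong_int_iff of_nat_1 of_nat_power)
  hence "chi (int y) ^ totient c = 1"
    using dirichlet_character_cong[OF assms] dirichlet_character_power[OF assms]
      dirichlet_character_one[OF assms] by metis
  hence "norm (chi (int y)) ^ totient c = 1" by (metis norm_one norm_power)
  moreover have "totient c > 0" using c0 by simp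
  ultimately have "norm (chi (int y)) = 1" 
    by (intro power_eq_imp_eq_base[where n = "totient c" and b = 1]) simp_all
  moreover have "chi (int y) = chi x"
    by (rule dirichlet_character_cong[OF assms]) (simp add: y cong_def)
  ultimately show ?thesis by simp
next
  case False
  hence "chi x = 0" using dirichlet_character_nz[OF assms] by blast
  thus ?thesis by simp
qed

definition kl_term :: "(int \<Rightarrow> complex) \<Rightarrow> int \<Rightarrow> int \<Rightarrow> nat \<Rightarrow> int \<Rightarrow> complex" where
  "kl_term chi a b c x = cnj (chi x) * ephase c (a * x + b * modular_inverse (int c) x)"

lemma kloosterman_sum_alt: "kloosterman_sum chi a b c = (\<Sum>x\<in>unit_residues c. kl_term chi a b c x)"
  by (simp add: kloosterman_sum_def unit_residues_def kl_term_def ephase_def)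

lemma kl_term_cong:
  assumes "dirichlet_character c chi" "[x = y] (mod int c)"
  shows "kl_term chi a b c x = kl_term chi a b c y"
proof -
  have "ephase c (a * x + b * modular_inverse (int c) x) = ephase c (a * y + b * modular_inverse (int c) y)"
    by (intro ephase_cong cong_add cong_mult cong_refl assms(2) modular_inverse_cong)
  thus ?thesis unfolding kl_term_def by (simp only: dirichlet_character_cong[OF assms])
qed

lemma norm_kl_term_le:
  assumes "dirichlet_character c chi"
  shows "norm (kl_term chi a b c x) \<le> 1"
  using norm_dirichlet_character_le[OF assms] by (simp add: kl_term_def norm_mult)

lemma norm_sum_kl_term_le:
  assumes "dirichlet_character c chi"
  shows "norm (\<Sum>x\<in>S. kl_term chi a b c x) \<le> real (card S)"
proof -
  have "norm (\<Sum>x\<in>S. kl_term chi a b c x) \<le> (\<Sum>x\<in>S. 1)"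
    by (rule order.trans[OF norm_sum sum_mono]) (rule norm_kl_term_le[OF assms])
  thus ?thesis by simp
qed

lemma kl_term_mult:
  assumes chi: "dirichlet_character c chi" and x: "coprime x (int c)" and uv: "[u * v = 1] (mod int c)"
  shows "kl_term chi a b c (u * x) =
    cnj (chi u) * cnj (chi x) * ephase c (a * (u * x) + b * (v * modular_inverse (int c) x))"
proof -
  have "ephase c (a * (u * x) + b * modular_inverse (int c) (u * x)) =
        ephase c (a * (u * x) + b * (v * modular_inverse (int c) x))"
    by (intro ephase_cong cong_add cong_mult cong_refl modular_inverse_mult_cong x uv)
  thus ?thesis by (simp add: kl_term_def dirichlet_character_mult[OF chi])
qed

lemma cong_1_minus_power:
  assumes "l \<le> 2 * k"
  shows "[(1 + int p ^ k * t) * (1 - int p ^ k * t) = 1] (mod int (p ^ l))"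
proof -
  have "int p ^ l dvd int p ^ (2 * k) * t\<^sup>2" using assms by (intro dvd_mult2 le_imp_power_dvd)
  moreover have "(1 + int p ^ k * t) * (1 - int p ^ k * t) - 1 = - (int p ^ (2 * k) * t\<^sup>2)"
    by (simp only: mult_2 power_add) (simp add: algebra_simps power2_eq_square)
  ultimately show ?thesis by (simp add: cong_iff_dvd_diff)
qed

text \<open>Because \<open>l \<le> 2 * k\<close>, multiplying the elements
  \<open>1 + p ^ k * t\<close> adds their \<open>t\<close>, so the character is additive in
  \<open>t\<close> modulo \<open>p ^ n\<close>. The value at \<open>t\<close> arises as a power,
  hence nonnegative \<open>t\<close>.\<close>

lemma character_linearization:
  assumes p: "prime p" and chi: "dirichlet_character (p ^ l) chi"
    and kn: "l = k + n" "n \<le> k" "k > 0"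
  shows "\<exists>B. \<forall>t\<in>{0..}. cnj (chi (1 + int p ^ k * t)) = ephase (p ^ n) (B * t)"
proof -
  have l2: "l \<le> 2 * k" using kn by simp
  define z where "z = cnj (chi (1 + int p ^ k))"
  have pow: "cnj (chi (1 + int p ^ k * int t)) = z ^ t" for t
  proof (induction t)
    case 0
    thus ?case using dirichlet_character_one[OF chi] by simp
  next
    case (Suc t)
    have "[(1 + int p ^ k) * (1 + int p ^ k * int t) = 1 + int p ^ k * int (Suc t)] (mod int (p ^ l))"
    proof -
      have "(1 + int p ^ k) * (1 + int p ^ k * int t) - (1 + int p ^ k * int (Suc t))
          = int p ^ (2 * k) * int t"
        by (simp only: mult_2 power_add) (simp add: algebra_simps)
      moreover have "int p ^ l dvd int p ^ (2 * k) * int t"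
        using l2 by (intro dvd_mult2 le_imp_power_dvd)
      ultimately show ?thesis by (simp add: cong_iff_dvd_diff)
    qed
    hence "chi (1 + int p ^ k * int (Suc t)) = chi (1 + int p ^ k) * chi (1 + int p ^ k * int t)"
      using dirichlet_character_cong[OF chi] dirichlet_character_mult[OF chi] by metis
    thus ?case using Suc by (simp add: z_def)
  qed
  have "[1 + int p ^ k * int (p ^ n) = 1] (mod int (p ^ l))"
    by (simp add: cong_iff_dvd_diff kn power_add)
  hence "chi (1 + int p ^ k * int (p ^ n)) = 1"
    using dirichlet_character_cong[OF chi] dirichlet_character_one[OF chi] by metis
  hence "z ^ (p ^ n) = 1" unfolding pow[symmetric] by simp
  moreover have pn: "p ^ n > 0" using p prime_gt_0_nat by simp
  ultimately obtain B where B: "z = cis (2 * pi * real B / real (p ^ n))"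
    using bij_betw_roots_unity[OF pn] unfolding bij_betw_def by blast
  have "z = ephase (p ^ n) (int B)"
    by (simp add: B ephase_def expi_conv_cis)
  hence "z ^ t = ephase (p ^ n) (int B * int t)" for t
    by (induction t) (simp_all add: distrib_left ephase_add mult.commute)
  hence "cnj (chi (1 + int p ^ k * t)) = ephase (p ^ n) (int B * t)" if "t \<ge> 0" for t
    using pow[of "nat t"] that by simp
  thus ?thesis by (intro exI[of _ "int B"]) auto
qed

text \<open>Modulo \<open>p ^ l\<close> the inverse of \<open>1 + p ^ k * t\<close> is
  \<open>1 - p ^ k * t\<close>, so the phase changes by a term linear in \<open>t\<close>.\<close>

lemma kl_term_stationary:
  assumes p: "prime p" and chi: "dirichlet_character (p ^ l) chi"
    and kn: "l = k + n" "n \<le> k" "k > 0"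
    and B: "cnj (chi (1 + int p ^ k * t)) = ephase (p ^ n) (B * t)"
    and x: "coprime x (int (p ^ l))"
  defines "c \<equiv> p ^ l"
  shows "kl_term chi a b c ((1 + int p ^ k * t) * x) =
    kl_term chi a b c x * ephase (p ^ n) ((a * x - b * modular_inverse (int c) x + B) * t)"
proof -
  have p0: "p > 0" using p prime_gt_0_nat by blast
  let ?y = "modular_inverse (int c) x"
  have "kl_term chi a b c ((1 + int p ^ k * t) * x) =
     ephase (p ^ n) (B * t) * cnj (chi x) *
     ephase c (a * ((1 + int p ^ k * t) * x) + b * ((1 - int p ^ k * t) * ?y))"
    unfolding c_def B[symmetric]
    by (rule kl_term_mult[OF chi x cong_1_minus_power]) (use kn in simp)
  also have "a * ((1 + int p ^ k * t) * x) + b * ((1 - int p ^ k * t) * ?y)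
     = (a * x + b * ?y) + int p ^ k * ((a * x - b * ?y) * t)"
    by (simp add: algebra_simps)
  also have "ephase c \<dots> = ephase c (a * x + b * ?y) * ephase (p ^ n) ((a * x - b * ?y) * t)"
    unfolding ephase_add c_def kn(1) ephase_prime_power_scale[OF p0] ..
  finally show ?thesis
    unfolding kl_term_def by (simp add: distrib_right ephase_add)
qed

text \<open>Averaging the substitution over all \<open>t\<close> modulo \<open>p ^ n\<close> turns
  the linear phase into the indicator of its coefficient vanishing modulo
  \<open>p ^ n\<close>.\<close>

theorem kloosterman_stationary:
  assumes p: "prime p" and chi: "dirichlet_character (p ^ l) chi"
    and kn: "l = k + n" "n \<le> k" "k > 0"
    and B: "\<And>t. t \<ge> 0 \<Longrightarrow> cnj (chi (1 + int p ^ k * t)) = ephase (p ^ n) (B * t)"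
  defines "c \<equiv> p ^ l"
  shows "kloosterman_sum chi a b c =
    (\<Sum>x\<in>{x \<in> unit_residues c. int p ^ n dvd a * x - b * modular_inverse (int c) x + B}. kl_term chi a b c x)"
proof -
  let ?w = "\<lambda>x. a * x - b * modular_inverse (int c) x + B"
  have c0: "c > 0" and pn: "p ^ n > 0" using p prime_gt_0_nat by (simp_all add: c_def)
  let ?S = "kloosterman_sum chi a b c"
  have inst: "?S = (\<Sum>x\<in>unit_residues c. kl_term chi a b c x * ephase (p ^ n) (?w x * t))"
    if t: "t \<ge> 0" for t
  proof -
    have "?S = (\<Sum>x\<in>unit_residues c. kl_term chi a b c ((1 + int p ^ k * t) * x))"
      unfolding kloosterman_sum_alt
    proof (rule sum_unit_residues_mult[symmetric, OF c0])
      show "[(1 + int p ^ k * t) * (1 - int p ^ k * t) = 1] (mod int c)"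
        unfolding c_def by (rule cong_1_minus_power) (use kn in simp)
    qed (rule kl_term_cong[OF chi[folded c_def]])
    also have "\<dots> = (\<Sum>x\<in>unit_residues c. kl_term chi a b c x * ephase (p ^ n) (?w x * t))"
      using kl_term_stationary[OF p chi kn B[OF t]] by (intro sum.cong) (auto simp: unit_residues_def c_def)
    finally show ?thesis .
  qed
  have "of_nat (p ^ n) * ?S = (\<Sum>t\<in>{0..<int (p ^ n)}. ?S)" by simp
  also have "\<dots> = (\<Sum>t\<in>{0..<int (p ^ n)}. \<Sum>x\<in>unit_residues c. kl_term chi a b c x * ephase (p ^ n) (?w x * t))"
    using inst by (intro sum.cong) auto
  also have "\<dots> = (\<Sum>x\<in>unit_residues c. kl_term chi a b c x * (\<Sum>t\<in>{0..<int (p ^ n)}. ephase (p ^ n) (?w x * t)))"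
    by (subst sum.swap) (simp add: sum_distrib_left)
  also have "\<dots> = (\<Sum>x\<in>unit_residues c. if int p ^ n dvd ?w x then of_nat (p ^ n) * kl_term chi a b c x else 0)"
    unfolding sum_ephase[OF pn] by (intro sum.cong) auto
  also have "\<dots> = of_nat (p ^ n) * (\<Sum>x\<in>{x \<in> unit_residues c. int p ^ n dvd ?w x}. kl_term chi a b c x)"
    by (subst sum.inter_filter) (auto simp: sum_distrib_left intro!: sum.cong)
  finally show ?thesis using prime_gt_0_nat[OF p] by simp
qed

text \<open>Multiplication by \<open>x\<close> clears the inverse from the stationary
  condition.\<close>

lemma stationary_set_subset:
  assumes "prime p" "l > 0" "n \<le> l"
  defines "c \<equiv> p ^ l"
  shows "{x \<in> unit_residues c. int p ^ n dvd a * x - b * modular_inverse (int c) x + B}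
    \<subseteq> quadratic_roots p l n a B b"
proof
  fix x assume x: "x \<in> {x \<in> unit_residues c. int p ^ n dvd a * x - b * modular_inverse (int c) x + B}"
  let ?y = "modular_inverse (int c) x"
  have cop: "coprime x (int c)" using x by (simp add: unit_residues_def)
  have "int c dvd x * ?y - 1" using cong_modular_inverse1[OF cop] by (simp add: cong_iff_dvd_diff)
  moreover have "int p ^ n dvd int c" unfolding c_def using assms(3) by (simp add: le_imp_power_dvd)
  ultimately have "int p ^ n dvd x * ?y - 1" by (rule dvd_trans[rotated])
  hence "int p ^ n dvd b * (x * ?y - 1) + x * (a * x - b * ?y + B)" 
    using x by (intro dvd_add[of _ "b * (x * ?y - 1)"] dvd_mult) simp_all
  also have "b * (x * ?y - 1) + x * (a * x - b * ?y + B) = a * x\<^sup>2 + B * x - b"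
    by (simp add: power2_eq_square algebra_simps)
  finally show "x \<in> quadratic_roots p l n a B b"
    using x coprime_prime_power_iff[OF assms(1,2)] by (auto simp: quadratic_roots_def unit_residues_def c_def)
qed

lemma finite_quadratic_roots: "finite (quadratic_roots p l n a B b)"
  unfolding quadratic_roots_def by (rule finite_residues_Collect)

lemma norm_kloosterman_le_card_roots:
  assumes p: "prime p" and chi: "dirichlet_character (p ^ l) chi"
    and kn: "l = k + n" "n \<le> k" "k > 0"
    and B: "\<And>t. t \<ge> 0 \<Longrightarrow> cnj (chi (1 + int p ^ k * t)) = ephase (p ^ n) (B * t)"
  shows "norm (kloosterman_sum chi a b (p ^ l)) \<le> real (card (quadratic_roots p l n a B b))"
proof -
  have "norm (kloosterman_sum chi a b (p ^ l)) \<le>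
     real (card {x \<in> unit_residues (p ^ l). int p ^ n dvd a * x - b * modular_inverse (int (p ^ l)) x + B})"
    by (subst kloosterman_stationary[OF p chi kn B]) (simp, rule norm_sum_kl_term_le[OF chi])
  also have "\<dots> \<le> real (card (quadratic_roots p l n a B b))"
    unfolding of_nat_le_iff
    by (rule card_mono[OF finite_quadratic_roots stationary_set_subset]) (use p kn in auto)
  finally show ?thesis .
qed

text \<open>At \<open>t = p ^ (n - s)\<close> the argument is 1 modulo \<open>p ^ (l - s)\<close>,
  where the character is trivial as \<open>g + s \<le> l\<close>. So \<open>p ^ n\<close> divides
  \<open>B * p ^ (n - s)\<close>.\<close>

lemma linearization_dvd:
  assumes p: "prime p" and kn: "l = k + n"
    and B: "\<And>t. t \<ge> 0 \<Longrightarrow> cnj (chi (1 + int p ^ k * t)) = ephase (p ^ n) (B * t)"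
    and triv: "\<And>x. coprime x (int p) \<Longrightarrow> [x = 1] (mod int p ^ g) \<Longrightarrow> chi x = 1"
    and s: "s \<le> n" "g + s \<le> l" "k > 0"
  shows "int p ^ s dvd B"
proof -
  have p0: "p > 0" using p prime_gt_0_nat by blast
  have "chi (1 + int p ^ k * int p ^ (n - s)) = 1"
  proof (rule triv)
    show "coprime (1 + int p ^ k * int p ^ (n - s)) (int p)"
      by (rule coprime_one_plus_power[OF p s(3)])
    have "int p ^ g dvd int p ^ (k + (n - s))" using s kn by (intro le_imp_power_dvd) auto
    thus "[1 + int p ^ k * int p ^ (n - s) = 1] (mod int p ^ g)"
      by (simp add: cong_iff_dvd_diff power_add)
  qed
  hence "ephase (p ^ n) (B * int p ^ (n - s)) = 1" using B[of "int p ^ (n - s)"] by simp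
  hence "int (p ^ n) dvd B * int p ^ (n - s)" using p0 by (simp add: ephase_eq_1_iff)
  moreover have "int (p ^ n) = int p ^ s * int p ^ (n - s)" using s(1) by (simp add: power_add[symmetric])
  ultimately show ?thesis using p0 by simp
qed

text \<open>If \<open>p\<close> divides one coefficient, the sum is a complete linear sum without
  its term at 0, hence -1. For \<open>p = 2\<close> there is a single term; the rest is
  \<open>weil_bound\<close>.\<close>

lemma kloosterman_prime_trivial_character:
  assumes p: "prime p" and triv: "\<And>x. coprime x (int p) \<Longrightarrow> chi x = 1"
    and ab: "\<not> (int p dvd a \<and> int p dvd b)"
  shows "norm (kloosterman_sum chi a b p) \<le> 2 * sqrt (real p)"
proof -
  have p0: "p > 0" and p1: "p > 1" using p prime_gt_1_nat[OF p] by auto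
  have sq: "sqrt (real p) \<ge> 1" using p1 by simp
  have R: "unit_residues p = {0..<int p} - {0}" by (rule unit_residues_prime[OF p])
  have linear: "norm (\<Sum>x\<in>unit_residues p. ephase p (w * x)) \<le> 2 * sqrt (real p)"
    if "\<not> int p dvd w" for w
  proof -
    have "(\<Sum>x\<in>{0..<int p}. ephase p (w * x)) = ephase p (w * 0) + (\<Sum>x\<in>unit_residues p. ephase p (w * x))"
      unfolding R using p0 by (intro sum.remove) auto
    hence "(\<Sum>x\<in>unit_residues p. ephase p (w * x)) = - 1"
      using that unfolding sum_ephase[OF p0] by (simp add: eq_neg_iff_add_eq_0 add.commute)
    hence "norm (\<Sum>x\<in>unit_residues p. ephase p (w * x)) = 1" by simp
    thus ?thesis using sq by linarith
  qed
  have S: "kloosterman_sum chi a b p = (\<Sum>x\<in>unit_residues p. ephase p (a * x + b * modular_inverse (int p) x))"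
    unfolding kloosterman_sum_alt
    by (intro sum.cong) (auto simp: kl_term_def unit_residues_def triv)
  consider "int p dvd b" | "int p dvd a" "\<not> int p dvd b" | "\<not> int p dvd a" "\<not> int p dvd b" by blast
  thus ?thesis
  proof cases
    case 1
    have "ephase p (a * x + b * modular_inverse (int p) x) = ephase p (a * x)" for x
      by (rule ephase_cong) (use 1 in \<open>simp add: cong_iff_dvd_diff\<close>)
    thus ?thesis unfolding S using linear[of a] 1 ab by simp
  next
    case 2
    have inv: "modular_inverse (int p) (modular_inverse (int p) x) = x \<and>
        modular_inverse (int p) x \<in> unit_residues p" if x: "x \<in> unit_residues p" for x
    proof -
      have cx: "coprime x (int p)" "x \<in> {0..<int p}" using x by (auto simp: unit_residues_def)
      have "modular_inverse (int p) (modular_inverse (int p) x) = x"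
        by (rule modular_inverse_int_eqI[OF cx(2)])
           (use cong_modular_inverse1[OF cx(1)] in \<open>simp add: mult.commute\<close>)
      moreover have "modular_inverse (int p) x \<in> unit_residues p"
        using cx p0 by (simp add: unit_residues_def modular_inverse_int_nonneg modular_inverse_int_less)
      ultimately show ?thesis by blast
    qed
    have "ephase p (a * x + b * modular_inverse (int p) x) = ephase p (b * modular_inverse (int p) x)" for x
      by (rule ephase_cong) (use 2 in \<open>simp add: cong_iff_dvd_diff\<close>)
    hence "kloosterman_sum chi a b p = (\<Sum>x\<in>unit_residues p. ephase p (b * modular_inverse (int p) x))"
      unfolding S by simp
    also have "\<dots> = (\<Sum>x\<in>unit_residues p. ephase p (b * x))"
      by (rule sum.reindex_bij_witness[of _ "modular_inverse (int p)" "modular_inverse (int p)"])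
         (use inv in auto)
    finally show ?thesis using linear[OF 2(2)] by simp
  next
    case 3
    show ?thesis
    proof (cases "p = 2")
      case True
      have "unit_residues p = {1}" unfolding R by (auto simp: True)
      hence "norm (kloosterman_sum chi a b p) = 1" unfolding S by simp
      thus ?thesis using sq by linarith
    next
      case False
      hence "odd p" using p prime_odd_nat[OF p] prime_ge_2_nat[OF p] by auto
      thus ?thesis using weil_bound[OF p] 3 unfolding weil_bound_def S by blast
    qed
  qed
qed

text \<open>For odd exponents the stationary points come in cosets of \<open>1 + p\<^sup>n \<int>\<close>, on which the phase is
  a quadratic polynomial modulo \<open>p\<close>; its Gauss sum saves a factor \<open>\<surd>p\<close>.\<close>

lemma kloosterman_odd_exponent:
  assumes p: "prime p" "odd p" and n: "n \<ge> 1" and ab: "\<not> int p dvd a" "\<not> int p dvd b"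
    and triv: "\<And>x. coprime x (int p) \<Longrightarrow> chi x = 1"
    and chi: "dirichlet_character (p ^ (2 * n + 1)) chi"
  shows "norm (kloosterman_sum chi a b (p ^ (2 * n + 1))) * sqrt (real p)
     \<le> 2 * real p ^ (n + 1)"
proof -
  define l where "l = 2 * n + 1"
  define c where "c = p ^ l"
  have l: "l = (n + 1) + n" by (simp add: l_def)
  have p0: "p > 0" using p prime_gt_0_nat by blast
  have c0: "c > 0" using p0 by (simp add: c_def)
  have chi': "dirichlet_character (p ^ l) chi" using chi by (simp add: l_def)
  let ?inv = "modular_inverse (int c)"
  have lin: "cnj (chi (1 + int p ^ (n + 1) * t)) = ephase (p ^ n) (0 * t)" for t
    using triv[OF coprime_one_plus_power[OF p(1), of "n + 1" t]] by simp
  define w where "w = (\<lambda>x. a * x - b * ?inv x)"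
  define Y where "Y = {x \<in> unit_residues c. int p ^ n dvd w x}"
  define F where "F = (\<lambda>x. if int p ^ n dvd w x then kl_term chi a b c x else 0)"
  have S: "kloosterman_sum chi a b c = (\<Sum>x\<in>Y. kl_term chi a b c x)"
    using kloosterman_stationary[OF p(1) chi' l _ _ lin, of a b] by (simp add: c_def Y_def w_def)
  have SF: "kloosterman_sum chi a b c = (\<Sum>x\<in>unit_residues c. F x)"
    unfolding S Y_def F_def by (rule sum.inter_filter) simp
  have pnc: "int p ^ n dvd int c" by (simp add: c_def l le_imp_power_dvd)
  have wcong: "[w x = w y] (mod int c)" if "[x = y] (mod int c)" for x y
    unfolding w_def by (intro cong_diff cong_mult cong_refl modular_inverse_cong that)
  have wdvd: "int p ^ n dvd w x \<longleftrightarrow> int p ^ n dvd w y" if "[w x = w y] (mod int p ^ n)" for x y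
    using that by (simp add: cong_dvd_iff)
  have Fcong: "F x = F y" if "[x = y] (mod int c)" for x y
    using wdvd[OF cong_dvd_modulus[OF wcong[OF that] pnc]] kl_term_cong[OF chi'[folded c_def] that]
    by (simp add: F_def)
  \<comment> \<open>Now \<open>p ^ n\<close> replaces \<open>p ^ (n + 1)\<close>, so the inverse
    \<open>v\<close> needs a quadratic term; the error has order \<open>p ^ (3 * n)\<close>, which
    the modulus divides since \<open>n \<ge> 1\<close>.\<close>
  define u where "u = (\<lambda>t. 1 + int p ^ n * t)"
  define v where "v = (\<lambda>t. 1 - int p ^ n * t + int p ^ (2 * n) * t\<^sup>2)"
  have uv: "[u t * v t = 1] (mod int c)" for t
  proof -
    have "u t * v t - 1 = int p ^ n * int p ^ (2 * n) * t ^ 3"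
      unfolding u_def v_def by (simp only: mult_2 power_add) (simp add: algebra_simps power2_eq_square power3_eq_cube)
    moreover have "int c dvd int p ^ n * int p ^ (2 * n) * t ^ 3"
      unfolding c_def of_nat_power power_add[symmetric] using n
      by (intro dvd_mult2 le_imp_power_dvd) (simp add: l)
    ultimately show ?thesis by (simp add: cong_iff_dvd_diff)
  qed
  \<comment> \<open>Off the stationary points both sides are 0, so the quotient
    \<open>w x div p ^ n\<close> is exact wherever it matters.\<close>
  have Fu: "F (u t * x) = F x * ephase p ((w x div int p ^ n) * t + (b * ?inv x) * t\<^sup>2)"
    if x: "x \<in> unit_residues c" for x t
  proof -
    let ?y = "?inv x"
    have cx: "coprime x (int c)" using x by (simp add: unit_residues_def)
    have cxp: "coprime x (int p)"
      using cx by (simp add: c_def l)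
    have invux: "[ ?inv (u t * x) = v t * ?y] (mod int c)"
      by (rule modular_inverse_mult_cong[OF cx uv])
    have "[w (u t * x) = a * (u t * x) - b * (v t * ?y)] (mod int p ^ n)"
      unfolding w_def by (intro cong_diff cong_mult cong_refl cong_dvd_modulus[OF invux pnc])
    also have "[a * (u t * x) - b * (v t * ?y) = w x] (mod int p ^ n)"
    proof -
      have "a * (u t * x) - b * (v t * ?y) - w x =
        int p ^ n * (a * t * x + b * t * ?y - b * (int p ^ n * t\<^sup>2) * ?y)"
        unfolding u_def v_def w_def by (simp only: mult_2 power_add) (simp add: algebra_simps power2_eq_square)
      thus ?thesis by (simp add: cong_iff_dvd_diff)
    qed
    finally have dvd: "int p ^ n dvd w (u t * x) \<longleftrightarrow> int p ^ n dvd w x" by (rule wdvd)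
    show ?thesis
    proof (cases "int p ^ n dvd w x")
      case True
      then obtain w' where w': "w x = int p ^ n * w'" by blast
      have wd: "w x div int p ^ n = w'" using p0 by (simp add: w')
      have chiu: "chi (u t) = 1" unfolding u_def by (rule triv[OF coprime_one_plus_power[OF p(1)]]) (use n in simp)
      have "kl_term chi a b c (u t * x) = cnj (chi (u t)) * cnj (chi x) *
         ephase c (a * (u t * x) + b * (v t * ?y))"
        by (rule kl_term_mult[OF chi'[folded c_def] cx uv])
      also have "a * (u t * x) + b * (v t * ?y) =
         (a * x + b * ?y) + int p ^ n * t * w x + int p ^ (2 * n) * (b * ?y * t\<^sup>2)"
        unfolding u_def v_def w_def by (simp add: algebra_simps)
      also have "\<dots> = (a * x + b * ?y) + int p ^ (2 * n) * (w' * t + (b * ?y) * t\<^sup>2)"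
        unfolding w' by (simp only: mult_2 power_add) (simp add: algebra_simps)
      also have "ephase c \<dots> = ephase c (a * x + b * ?y) * ephase p (w' * t + (b * ?y) * t\<^sup>2)"
        using ephase_prime_power_scale[OF p0, of "2 * n" 1] by (simp add: ephase_add c_def l_def)
      finally show ?thesis unfolding F_def using True dvd chiu by (simp add: kl_term_def wd)
    next
      case False
      thus ?thesis using dvd by (simp add: F_def)
    qed
  qed
  let ?G = "\<lambda>x. \<Sum>t\<in>{0..<int p}. ephase p ((w x div int p ^ n) * t + (b * ?inv x) * t\<^sup>2)"
  \<comment> \<open>Averaging over the multipliers \<open>u t\<close>, with \<open>t\<close> modulo
    \<open>p\<close>, attaches a Gauss sum to each stationary point.\<close>
  have "of_nat p * kloosterman_sum chi a b c = (\<Sum>t\<in>{0..<int p}. kloosterman_sum chi a b c)" by simp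
  also have "\<dots> = (\<Sum>t\<in>{0..<int p}. \<Sum>x\<in>unit_residues c. F (u t * x))"
    unfolding SF by (intro sum.cong refl sum_unit_residues_mult[symmetric, OF c0 Fcong uv]) auto
  also have "\<dots> = (\<Sum>t\<in>{0..<int p}. \<Sum>x\<in>unit_residues c. F x * ephase p ((w x div int p ^ n) * t + (b * ?inv x) * t\<^sup>2))"
    using Fu by (intro sum.cong) auto
  also have "\<dots> = (\<Sum>x\<in>unit_residues c. F x * ?G x)"
    by (subst sum.swap) (simp add: sum_distrib_left)
  also have "\<dots> = (\<Sum>x\<in>Y. kl_term chi a b c x * ?G x)"
    unfolding Y_def by (subst sum.inter_filter) (auto simp: F_def intro!: sum.cong)
  finally have "norm (of_nat p * kloosterman_sum chi a b c) = norm (\<Sum>x\<in>Y. kl_term chi a b c x * ?G x)"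
    by simp
  also have "\<dots> \<le> (\<Sum>x\<in>Y. sqrt (real p))"
  proof (rule order.trans[OF norm_sum sum_mono])
    fix x assume x: "x \<in> Y"
    hence cx: "coprime x (int c)" by (simp add: Y_def unit_residues_def)
    have "coprime (?inv x) (int c)" by (rule coprime_modular_inverse[OF cx])
    hence "\<not> int p dvd ?inv x"
      using coprime_prime_power_iff[OF p(1), of l "?inv x"] by (simp add: c_def l_def)
    hence "\<not> int p dvd b * ?inv x" using ab p(1) by (simp add: prime_dvd_mult_iff)
    hence "norm (?G x) = sqrt (real p)" by (rule norm_quadratic_gauss_sum[OF p])
    thus "norm (kl_term chi a b c x * ?G x) \<le> sqrt (real p)"
      using norm_kl_term_le[OF chi'[folded c_def], of a b x]
      by (simp only: norm_mult) (rule mult_left_le_one_le, auto)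
  qed
  also have "\<dots> = real (card Y) * sqrt (real p)" by simp
  also have "\<dots> \<le> real (2 * p ^ (n + 1)) * sqrt (real p)"
  proof (intro mult_right_mono)
    have "Y \<subseteq> quadratic_roots p l n a 0 b"
      using stationary_set_subset[OF p(1), of l n a b 0] by (simp add: Y_def w_def c_def l)
    hence "card Y \<le> card (quadratic_roots p l n a 0 b)" by (rule card_mono[OF finite_quadratic_roots])
    also have "\<dots> \<le> 2 * p ^ (l - (n - 0))"
    proof (rule card_quadratic_roots_deriv)
      fix x assume "\<not> int p dvd x"
      moreover have "\<not> int p dvd 2" by (rule odd_prime_not_dvd_2[OF p])
      ultimately show "\<not> int p ^ Suc 0 dvd 2 * x + 0" using p(1) by (simp add: prime_dvd_mult_iff)
    qed (use p n ab l in auto)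
    also have "l - (n - 0) = n + 1" by (simp add: l)
    finally show "real (card Y) \<le> real (2 * p ^ (n + 1))" by (simp only: of_nat_le_iff)
  qed simp
  finally have "real p * norm (kloosterman_sum chi a b c) \<le> 2 * real p ^ (n + 1) * sqrt (real p)"
    by (simp add: norm_mult)
  moreover have "real p = sqrt (real p) * sqrt (real p)" by simp
  ultimately have "(norm (kloosterman_sum chi a b c) * sqrt (real p)) * sqrt (real p)
      \<le> 2 * real p ^ (n + 1) * sqrt (real p)"
    by (metis mult.assoc mult.commute)
  hence "norm (kloosterman_sum chi a b c) * sqrt (real p) \<le> 2 * real p ^ (n + 1)"
    using p0 by (simp only: mult_le_cancel_right_pos real_sqrt_gt_0_iff of_nat_0_less_iff)
  thus ?thesis by (simp add: c_def l_def)
qed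

section \<open>The general bound\<close>

text \<open>Modulo \<open>p\<close> the congruence reads \<open>a * x\<^sup>2 = b\<close> with
  \<open>x\<close> a unit.\<close>

lemma quadratic_roots_empty:
  assumes "n > 0" "int p dvd B" "prime p" "(int p dvd a) \<noteq> (int p dvd b)"
  shows "quadratic_roots p l n a B b = {}"
proof -
  have False if x: "x \<in> quadratic_roots p l n a B b" for x
  proof -
    have "int p dvd int p ^ n" using assms(1) by simp
    hence 1: "int p dvd a * x\<^sup>2 + B * x - b"
      using x dvd_trans unfolding quadratic_roots_def by blast
    have "int p dvd (a * x\<^sup>2 + B * x - b) - B * x" 
      using 1 assms(2) by (intro dvd_diff[of _ "a * x\<^sup>2 + B * x - b"] dvd_mult2)
    hence 2: "int p dvd a * x\<^sup>2 - b" by (simp add: algebra_simps)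
    have "int p dvd a * x\<^sup>2 \<longleftrightarrow> int p dvd b" using 2 by (metis dvd_diff_left_iff dvd_diff_right_iff)
    moreover have "int p dvd a * x\<^sup>2 \<longleftrightarrow> int p dvd a"
      using x assms(3) by (auto simp: quadratic_roots_def prime_dvd_mult_iff power2_eq_square)
    ultimately show False using assms(4) by blast
  qed
  thus ?thesis by blast
qed

text \<open>One bound serves both claims: for \<open>g \<ge> 1\<close> it is the second conductor
  term itself, and \<open>(g + 1) / 4 \<le> g / 2\<close> gives the first.\<close>

definition conductor_factor :: "nat \<Rightarrow> nat \<Rightarrow> real" where
  "conductor_factor p g = (if g = 0 then 1 else real p powr ((real g + 1) / 4))"

lemma conductor_factor_ge_1: "p > 0 \<Longrightarrow> conductor_factor p g \<ge> 1"
  by (simp add: conductor_factor_def ge_one_powr_ge_zero)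

lemma conductor_factor_mono: "p > 0 \<Longrightarrow> g \<le> g' \<Longrightarrow> conductor_factor p g \<le> conductor_factor p g'"
  by (auto simp: conductor_factor_def ge_one_powr_ge_zero intro!: powr_mono)

lemma mult_powr_le:
  fixes P :: real
  assumes "P \<ge> 1" "real j \<le> e" "C \<le> D" "0 \<le> C"
  shows "C * P ^ j \<le> D * P powr e"
proof -
  have "P ^ j = P powr real j" using assms(1) by (simp add: powr_realpow)
  also have "\<dots> \<le> P powr e" using assms by (intro powr_mono) auto
  finally show ?thesis using assms by (intro mult_mono) auto
qed

lemma sqrt_power_eq_powr: "p > 0 \<Longrightarrow> sqrt (real p) ^ l = real p powr (real l / 2)"
  by (simp add: powr_half_sqrt[symmetric] powr_powr flip: powr_realpow)

text \<open>For \<open>g = l\<close> only the half count is available. For \<open>g < l\<close> the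
  derivative is a unit if \<open>p\<close> is odd; if \<open>p = 2\<close>, its valuation is known
  once \<open>B\<close> vanishes modulo 4, which \<open>g + 2 \<le> l\<close> and
  \<open>n \<ge> 2\<close> provide. The leftover dyadic cases have room in the exponent or a small
  modulus.\<close>

theorem kloosterman_coprime_bound:
  assumes p: "prime p" and chi: "dirichlet_character (p ^ l) chi" and l: "l \<ge> 1"
    and triv: "\<And>x. coprime x (int p) \<Longrightarrow> [x = 1] (mod int p ^ g) \<Longrightarrow> chi x = 1"
    and g: "g \<le> l" and ab: "\<not> (int p dvd a \<and> int p dvd b)"
  shows "norm (kloosterman_sum chi a b (p ^ l))
    \<le> (real l + 1) * sqrt (real p) ^ l * conductor_factor p g"
proof -
  let ?S = "norm (kloosterman_sum chi a b (p ^ l))"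
  define P where "P = real p"
  have p0: "p > 0" and p2: "p \<ge> 2" using p prime_ge_2_nat by (auto simp: prime_gt_0_nat)
  have P1: "P \<ge> 1" and P2: "P \<ge> 2" using p2 by (auto simp: P_def)
  have E1: "conductor_factor p g \<ge> 1" by (rule conductor_factor_ge_1[OF p0])
  have Eg: "conductor_factor p g = P powr ((real g + 1) / 4)" if "g \<noteq> 0"
    using that by (simp add: conductor_factor_def P_def)
  have sq: "sqrt (real p) ^ l = P powr (real l / 2)" by (simp add: P_def sqrt_power_eq_powr p0)
  have trivial: "?S \<le> P ^ l"
  proof -
    have "?S \<le> real (card (unit_residues (p ^ l)))"
      unfolding kloosterman_sum_alt by (rule norm_sum_kl_term_le[OF chi])
    also have "\<dots> \<le> real (p ^ l)" unfolding of_nat_le_iff by (rule card_unit_residues_le)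
    finally show ?thesis by (simp add: P_def)
  qed
  have drop_E: ?thesis if "?S \<le> (real l + 1) * P powr (real l / 2)"
  proof -
    have "?S * 1 \<le> ((real l + 1) * P powr (real l / 2)) * conductor_factor p g"
      using that E1 by (intro mult_mono) auto
    thus ?thesis by (simp add: sq)
  qed
  have keep_E: ?thesis if "g \<noteq> 0" "?S \<le> (real l + 1) * P powr (real l / 2 + (real g + 1) / 4)"
    using that by (simp add: sq Eg powr_add mult.assoc)
  show ?thesis
  proof (cases "l = 1")
    case True
    show ?thesis
    proof (cases "g = 0")
      case g0: True
      have "?S \<le> 2 * sqrt (real p)"
        unfolding True power_one_right
        by (rule kloosterman_prime_trivial_character[OF p _ ab]) (use triv g0 in auto)
      thus ?thesis by (simp add: True g0 conductor_factor_def)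
    next
      case False
      hence g1: "g = 1" using g True by simp
      \<comment> \<open>For \<open>g = l = 1\<close> the allowed exponent is
        \<open>1 / 2 + 1 / 2\<close>, so the trivial bound is enough.\<close>
      have "1 * P ^ 1 \<le> (real l + 1) * P powr (real l / 2 + (real g + 1) / 4)"
        by (rule mult_powr_le[OF P1]) (simp_all add: True g1)
      with trivial show ?thesis by (intro keep_E False) (simp add: True)
    qed
  next
    case False
    define n where "n = l div 2"
    define k where "k = l - n"
    have kn: "l = k + n" "n \<le> k" "k > 0" and n0: "n > 0" "n \<le> l" using False l by (auto simp: n_def k_def)
    define h where "h = (n + 1) div 2"
    have h: "2 * h \<le> n + 1" "n \<le> 2 * h" by (auto simp: h_def)
    have hl: "h \<le> l" using h n0 by linarith
    obtain B where B: "\<And>t. t \<ge> 0 \<Longrightarrow> cnj (chi (1 + int p ^ k * t)) = ephase (p ^ n) (B * t)"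
      using character_linearization[OF p chi kn] by (metis atLeast_iff)
    define nroots where "nroots = card (quadratic_roots p l n a B b)"
    have SX: "?S \<le> real nroots"
      unfolding nroots_def by (rule norm_kloosterman_le_card_roots[OF p chi kn B])
    have Xh: "real nroots \<le> 2 * P ^ (l - h)"
    proof -
      have "nroots \<le> 2 * p ^ (l - h)"
        unfolding nroots_def by (rule card_quadratic_roots_half[OF p n0 h(1) ab])
      hence "real nroots \<le> real (2 * p ^ (l - h))" by (simp only: of_nat_le_iff)
      thus ?thesis by (simp add: P_def)
    qed
    have n2: "2 * n \<le> l" "l \<le> 2 * n + 1" by (auto simp: n_def)
    have lh: "real (l - h) \<le> 3 * real l / 4 + 1 / 4"
    proof -
      have "4 * l \<le> 3 * l + 1 + 4 * h" using h n2 by linarith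
      hence "real (4 * l) \<le> real (3 * l + 1 + 4 * h)" by (simp only: of_nat_le_iff)
      hence "4 * real l \<le> 3 * real l + 1 + 4 * real h" by simp
      thus ?thesis using hl by (simp add: of_nat_diff)
    qed
    consider "g = l" | "g < l" "odd p" | "g < l" "p = 2"
      using g p prime_odd_nat[OF p] p2 by fastforce
    thus ?thesis
    proof cases
      case 1
      \<comment> \<open>At \<open>g = l\<close> the exponent \<open>l / 2 + (g + 1) / 4\<close> is
        exactly the \<open>3 * l / 4 + 1 / 4\<close> of \<open>lh\<close>.\<close>
      have "2 * P ^ (l - h) \<le> (real l + 1) * P powr (real l / 2 + (real g + 1) / 4)"
        by (rule mult_powr_le[OF P1]) (use lh 1 l in \<open>auto simp: field_simps\<close>)
      thus ?thesis using SX Xh 1 l by (intro keep_E) auto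
    next
      case 2
      have pB: "int p dvd B"
        using linearization_dvd[where g = g and s = 1, OF p kn(1) B triv] n0 2 kn by simp
      have p_not_2: "\<not> int p dvd 2" by (rule odd_prime_not_dvd_2[OF p 2(2)])
      have Xn: "real nroots \<le> 2 * P ^ (l - n)"
      proof -
        have "nroots \<le> 2 * p ^ (l - (n - 0))"
          unfolding nroots_def
        proof (rule card_quadratic_roots_deriv[OF p n0 ab pB])
          fix x assume "\<not> int p dvd x"
          hence "\<not> int p dvd 2 * x" using p_not_2 p by (simp add: prime_dvd_mult_iff)
          thus "\<not> int p ^ Suc 0 dvd 2 * x + B" using pB by (simp add: dvd_add_left_iff)
        qed
        hence "real nroots \<le> real (2 * p ^ (l - n))" by (simp only: of_nat_le_iff diff_zero)
        thus ?thesis by (simp add: P_def)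
      qed
      show ?thesis
      proof (cases "g = 0")
        case g0: True
        show ?thesis
        proof (cases "even l")
          case True
          hence "real (l - n) \<le> real l / 2" by (auto simp: n_def elim!: evenE)
          hence "2 * P ^ (l - n) \<le> (real l + 1) * P powr (real l / 2)"
            using l by (intro mult_powr_le[OF P1]) auto
          thus ?thesis using SX Xn by (intro drop_E) linarith
        next
          case False
          hence ln: "l = 2 * n + 1" using n2 by (auto elim!: oddE)
          \<comment> \<open>The count \<open>2 * p ^ (n + 1)\<close> is too large by a factor of
            order \<open>sqrt p\<close>. The Gauss sum recovers it when \<open>a\<close> and
            \<open>b\<close> are units; otherwise there is no stationary point.\<close>
          show ?thesis
          proof (cases "(int p dvd a) = (int p dvd b)")
            case True
            hence "\<not> int p dvd a" "\<not> int p dvd b" using ab by auto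
            hence "?S * sqrt (real p) \<le> 2 * real p ^ (n + 1)"
              using kloosterman_odd_exponent[OF p 2(2), of n a b chi] n0 chi triv g0 by (simp add: ln)
            also have "\<dots> = (2 * sqrt (real p) ^ l) * sqrt (real p)"
            proof -
              have "sqrt (real p) ^ l * sqrt (real p) = sqrt (real p) ^ (2 * (n + 1))"
                by (simp add: ln mult_ac)
              also have "\<dots> = (sqrt (real p) ^ 2) ^ (n + 1)" by (rule power_mult)
              also have "\<dots> = real p ^ (n + 1)" by simp
              finally show ?thesis by (simp only: mult.assoc)
            qed
            finally have "?S \<le> 2 * sqrt (real p) ^ l"
              using p0 by (simp only: mult_le_cancel_right_pos real_sqrt_gt_0_iff of_nat_0_less_iff)
            also have "\<dots> \<le> (real l + 1) * P powr (real l / 2)"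
              unfolding sq using l by (intro mult_right_mono) auto
            finally show ?thesis by (rule drop_E)
          next
            case False
            hence "nroots = 0" unfolding nroots_def using quadratic_roots_empty[OF n0(1) pB p] by simp
            thus ?thesis using SX by (intro drop_E) simp
          qed
        qed
      next
        case False
        \<comment> \<open>The rounding loss of at most \<open>1 / 2\<close> in the exponent is
          covered by \<open>(g + 1) / 4\<close>, as \<open>g \<ge> 1\<close>.\<close>
        have "4 * (l - n) \<le> 2 * l + g + 1" using n2 False by arith
        hence "real (4 * (l - n)) \<le> real (2 * l + g + 1)" by (simp only: of_nat_le_iff)
        hence "4 * real (l - n) \<le> 2 * real l + real g + 1"
          by (simp only: of_nat_mult of_nat_add of_nat_numeral of_nat_1)
        moreover have "u \<le> v / 2 + (w + 1) / 4" if "4 * u \<le> 2 * v + w + 1" for u v w :: real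
          using that by (simp add: field_simps)
        ultimately have "real (l - n) \<le> real l / 2 + (real g + 1) / 4" by blast
        hence "2 * P ^ (l - n) \<le> (real l + 1) * P powr (real l / 2 + (real g + 1) / 4)"
          using l by (intro mult_powr_le[OF P1]) auto
        thus ?thesis using SX Xn False by (intro keep_E) linarith+
      qed
    next
      case 3
      have P: "P = 2" using 3 by (simp add: P_def)
      show ?thesis
      proof (cases "g + 1 = l")
        case True
        hence gl: "real g + 1 = real l" by linarith
        \<comment> \<open>The target exponent is now \<open>3 * l / 4\<close>. For even
          \<open>l\<close> the half count has no rounding loss; for odd \<open>l\<close> one factor
          \<open>P = 2\<close> moves into the constant, and \<open>4 \<le> l + 1\<close>.\<close>
        show ?thesis
        proof (cases "even l")
          case True
          hence "2 * n = l" by (simp add: n_def)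
          hence "4 * l \<le> 3 * l + 4 * h" using h by linarith
          hence "real (4 * l) \<le> real (3 * l + 4 * h)" by (simp only: of_nat_le_iff)
          hence "4 * real l \<le> 3 * real l + 4 * real h" by simp
          hence "real (l - h) \<le> real l / 2 + (real g + 1) / 4" using hl by (simp add: gl of_nat_diff)
          hence "2 * P ^ (l - h) \<le> (real l + 1) * P powr (real l / 2 + (real g + 1) / 4)"
            using l by (intro mult_powr_le[OF P1]) auto
          thus ?thesis using SX Xh \<open>g + 1 = l\<close> False l by (intro keep_E) linarith+
        next
          case odd: False
          hence l3: "l \<ge> 3" using False l by (cases "l = 2") auto
          have "l - h \<ge> 1" using h n2 n0 by linarith
          hence eq: "2 * P ^ (l - h) = 4 * P ^ (l - h - 1)"
          proof -
            have "0 < l - h" using \<open>l - h \<ge> 1\<close> by linarith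
            hence "P ^ (l - h - 1) * P = P ^ (l - h)" by (rule power_minus_mult)
            thus ?thesis unfolding P by linarith
          qed
          have "real (l - h - 1) \<le> real l / 2 + (real g + 1) / 4"
            using lh \<open>l - h \<ge> 1\<close> by (simp add: gl)
          hence "4 * P ^ (l - h - 1) \<le> (real l + 1) * P powr (real l / 2 + (real g + 1) / 4)"
            using l3 by (intro mult_powr_le[OF P1]) auto
          thus ?thesis using SX Xh \<open>g + 1 = l\<close> False l eq by (intro keep_E) linarith+
        qed
      next
        case gl: False
        hence g2: "g + 2 \<le> l" using 3 by linarith
        \<comment> \<open>For \<open>n = 1\<close> the congruence is only modulo 2; the modulus is
          then 4 or 8, and the trivial bound works.\<close>
        show ?thesis
        proof (cases "n = 1")
          case True
          hence "l = 2 \<or> l = 3" using n2 False l by auto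
          thus ?thesis
          proof
            assume "l = 2"
            thus ?thesis using trivial by (intro drop_E) (simp add: P)
          next
            assume l3: "l = 3"
            have "2 * P ^ 2 \<le> 4 * sqrt 2 ^ 3"
            proof -
              have "(1.4::real) \<le> sqrt 2" by (rule real_le_rsqrt) (simp add: power2_eq_square)
              moreover have "sqrt 2 ^ 3 = 2 * sqrt (2::real)" by (simp add: power3_eq_cube)
              ultimately show ?thesis by (simp add: P)
            qed
            also have "sqrt 2 ^ 3 = P powr (real l / 2)" using sq 3 l3 by simp
            finally show ?thesis using trivial l3 by (intro drop_E) (simp add: P)
          qed
        next
          case False
          hence nn: "n \<ge> 2" using n0 by linarith
          \<comment> \<open>With \<open>B\<close> divisible by 4 and \<open>x\<close> odd,
            \<open>2 * x + B\<close> has valuation exactly 1; the count loses one factor 2, which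
            \<open>l + 1\<close> absorbs.\<close>
          have B4: "int p ^ 2 dvd B"
            using linearization_dvd[where g = g and s = 2, OF p kn(1) B triv] nn g2 kn by simp
          have pB: "int p dvd B" using B4 by (metis dvd_trans dvd_triv_left power2_eq_square)
          have "nroots \<le> 2 * p ^ (l - (n - 1))"
            unfolding nroots_def
          proof (rule card_quadratic_roots_deriv[OF p n0 ab pB])
            fix x assume "\<not> int p dvd x"
            hence "\<not> int p ^ 2 dvd 2 * x" using 3 by auto
            thus "\<not> int p ^ Suc 1 dvd 2 * x + B" using B4 by (simp add: dvd_add_left_iff numeral_2_eq_2)
          qed
          also have "l - (n - 1) = Suc (l - n)" using nn n2 by linarith
          finally have "real nroots \<le> real (2 * p ^ Suc (l - n))" by (simp only: of_nat_le_iff)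
          also have "real (2 * p ^ Suc j) = 4 * P ^ j" for j by (simp add: P_def 3)
          finally have X4: "real nroots \<le> 4 * P ^ (l - n)" .
          show ?thesis
          proof (cases "even l")
            case True
            hence "real (l - n) \<le> real l / 2" by (auto simp: n_def elim!: evenE)
            hence "4 * P ^ (l - n) \<le> (real l + 1) * P powr (real l / 2)"
              using nn n2 by (intro mult_powr_le[OF P1]) auto
            thus ?thesis using SX X4 by (intro drop_E) linarith
          next
            case False
            hence ln: "l = 2 * n + 1" using n2 by (auto elim!: oddE)
            have s14: "(1.4::real) \<le> sqrt 2" by (rule real_le_rsqrt) (simp add: power2_eq_square)
            have "P powr (real l / 2) = sqrt 2 ^ l" using sq 3 by simp
            also have "\<dots> = 2 ^ n * sqrt 2" by (simp add: ln power_mult)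
            finally have e: "P powr (real l / 2) = 2 ^ n * sqrt 2" .
            \<comment> \<open>Here \<open>l \<ge> 5\<close>, and \<open>6 * 1.4 = 8.4\<close> just
              exceeds 8.\<close>
            have "8 \<le> 6 * (1.4 :: real)" by simp
            also have "\<dots> \<le> (real l + 1) * sqrt 2" using nn s14 by (intro mult_mono) (auto simp: ln)
            finally have "8 * 2 ^ n \<le> ((real l + 1) * sqrt 2) * (2 ^ n :: real)" by (intro mult_right_mono) auto
            hence "4 * P ^ (l - n) \<le> (real l + 1) * P powr (real l / 2)"
              unfolding e by (simp add: ln P mult_ac)
            thus ?thesis using SX X4 by (intro drop_E) linarith
          qed
        qed
      qed
    qed
  qed
qed

section \<open>Common factors of the coefficients and the modulus\<close>

lemma sum_unit_residues_lift:
  fixes G :: "int \<Rightarrow> complex"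
  assumes p: "prime p" and L: "L > 0"
    and G: "\<And>x y. [x = y] (mod int (p ^ L)) \<Longrightarrow> G x = G y"
  shows "(\<Sum>x\<in>unit_residues (p ^ (L + m)). G x) = of_nat (p ^ m) * (\<Sum>x\<in>unit_residues (p ^ L). G x)"
proof -
  let ?q = "int (p ^ L)"
  have q0: "?q > 0" using prime_gt_0_nat[OF p] by simp
  have dq: "int p dvd ?q" using L by simp
  \<comment> \<open>As \<open>L > 0\<close>, both moduli have the prime factor \<open>p\<close>, so
    every lift of a unit is a unit.\<close>
  have cop: "coprime x (int (p ^ (L + m))) \<longleftrightarrow> coprime x ?q" for x
    using coprime_prime_power_iff[OF p] L by simp
  have "(\<Sum>x\<in>unit_residues (p ^ (L + m)). G x) =
     (\<Sum>z\<in>unit_residues (p ^ L) \<times> {0..<int (p ^ m)}. G (fst z))"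
  proof (rule sum.reindex_bij_witness[of _ "\<lambda>z. fst z + ?q * snd z" "\<lambda>x. (x mod ?q, x div ?q)"])
    fix x assume x: "x \<in> unit_residues (p ^ (L + m))"
    hence x': "0 \<le> x" "x < ?q * int (p ^ m)" "coprime x ?q"
      using cop by (auto simp: unit_residues_def power_add)
    have "x div ?q < int (p ^ m)" by (rule int_div_less[OF q0 x'(2)])
    moreover have "x div ?q \<ge> 0" using x' q0 by (simp add: pos_imp_zdiv_nonneg_iff)
    ultimately show "(x mod ?q, x div ?q) \<in> unit_residues (p ^ L) \<times> {0..<int (p ^ m)}"
      using x' q0 coprime_mod_iff[of x "p ^ L"] by (auto simp: unit_residues_def)
    show "fst (x mod ?q, x div ?q) + ?q * snd (x mod ?q, x div ?q) = x" by simp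
    show "G (fst (x mod ?q, x div ?q)) = G x" by (rule G) (simp add: cong_def)
  next
    fix z assume z: "z \<in> unit_residues (p ^ L) \<times> {0..<int (p ^ m)}"
    obtain y s where ys: "z = (y, s)" by (cases z)
    have y: "0 \<le> y" "y < ?q" "coprime y ?q" and s: "0 \<le> s" "s < int (p ^ m)"
      using z by (auto simp: ys unit_residues_def)
    show "((fst z + ?q * snd z) mod ?q, (fst z + ?q * snd z) div ?q) = z"
      using y q0 by (simp add: ys)
    have "(y + ?q * s) mod ?q = y" using y by simp
    hence "coprime (y + ?q * s) ?q" using coprime_mod_iff[of "y + ?q * s" "p ^ L"] y by simp
    moreover have "y + ?q * s < ?q * int (p ^ m)"
    proof -
      have "y + ?q * s < ?q + ?q * s" using y by simp
      also have "\<dots> = ?q * (s + 1)" by (simp add: algebra_simps)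
      also have "\<dots> \<le> ?q * int (p ^ m)" using s q0 by (intro mult_left_mono) auto
      finally show ?thesis .
    qed
    ultimately show "fst z + ?q * snd z \<in> unit_residues (p ^ (L + m))"
      using y s cop q0 by (simp add: ys unit_residues_def power_add)
  qed
  also have "\<dots> = (\<Sum>y\<in>unit_residues (p ^ L). \<Sum>s\<in>{0..<int (p ^ m)}. G y)"
    unfolding sum.cartesian_product by (simp add: case_prod_beta)
  also have "\<dots> = of_nat (p ^ m) * (\<Sum>x\<in>unit_residues (p ^ L). G x)"
    by (simp add: sum_distrib_left)
  finally show ?thesis .
qed

text \<open>If \<open>chi u\<close> is not 1 for some unit \<open>u\<close> congruent to 1 modulo
  \<open>p ^ (l - m)\<close>, replacing \<open>x\<close> by \<open>u * x\<close> keeps the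
  exponentials and multiplies the sum by a number other than 1. Otherwise \<open>chi\<close> has
  period \<open>p ^ (l - m)\<close>, and the sum is \<open>p ^ m\<close> copies of one to that
  modulus.\<close>

theorem kloosterman_bound:
  assumes p: "prime p" and chi: "dirichlet_character (p ^ l) chi"
    and triv: "\<And>x. coprime x (int p) \<Longrightarrow> [x = 1] (mod int p ^ g) \<Longrightarrow> chi x = 1"
    and gcd: "gcd (gcd a b) (int (p ^ l)) = int (p ^ m)" and m: "m \<le> l"
  shows "norm (kloosterman_sum chi a b (p ^ l))
    \<le> (real l + 1) * sqrt (real p) ^ m * sqrt (real p) ^ l * conductor_factor p g"
proof -
  have p0: "p > 0" using prime_gt_0_nat[OF p] .
  have c0: "p ^ l > 0" using p0 by simp
  have E1: "conductor_factor p g \<ge> 1" by (rule conductor_factor_ge_1[OF p0])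
  show ?thesis
  proof (cases "m = l")
    case True
    \<comment> \<open>For \<open>m = l\<close> the trivial bound \<open>p ^ l\<close> already equals
      \<open>sqrt p ^ m * sqrt p ^ l\<close>.\<close>
    have "norm (kloosterman_sum chi a b (p ^ l)) \<le> real (card (unit_residues (p ^ l)))"
      unfolding kloosterman_sum_alt by (rule norm_sum_kl_term_le[OF chi])
    also have "\<dots> \<le> real (p ^ l)" unfolding of_nat_le_iff by (rule card_unit_residues_le)
    also have "\<dots> = 1 * (sqrt (real p) ^ m * sqrt (real p) ^ l) * 1"
      by (simp add: True power_mult_distrib[symmetric])
    also have "\<dots> \<le> (real l + 1) * (sqrt (real p) ^ m * sqrt (real p) ^ l) * conductor_factor p g"
      using E1 by (intro mult_mono) auto
    finally show ?thesis by (simp add: mult.assoc)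
  next
    case False
    define L where "L = l - m"
    have L: "l = L + m" "L > 0" using False m by (auto simp: L_def)
    have dvd: "int (p ^ m) dvd a" "int (p ^ m) dvd b"
      using gcd by (metis gcd_dvd1 gcd_dvd2 dvd_trans)+
    then obtain a' b' where a': "a = int (p ^ m) * a'" and b': "b = int (p ^ m) * b'" by (auto elim!: dvdE)
    have ab: "\<not> (int p dvd a' \<and> int p dvd b')"
    proof
      assume "int p dvd a' \<and> int p dvd b'"
      hence "int (p ^ Suc m) dvd a" "int (p ^ Suc m) dvd b"
        unfolding a' b' by (auto simp: mult.commute intro: mult_dvd_mono)
      moreover have "int (p ^ Suc m) dvd int (p ^ l)"
        using L by (simp only: int_dvd_int_iff) (rule le_imp_power_dvd, simp)
      ultimately have "int (p ^ Suc m) dvd gcd (gcd a b) (int (p ^ l))" by (intro gcd_greatest)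
      hence "p ^ Suc m dvd p ^ m" unfolding gcd int_dvd_int_iff .
      thus False using power_dvd_imp_le[of p "Suc m" m] prime_gt_1_nat[OF p] by simp
    qed
    have qc: "int (p ^ L) dvd int (p ^ l)" by (simp add: L power_add)
    have cop: "coprime x (int (p ^ l)) \<longleftrightarrow> coprime x (int (p ^ L))" for x
      using coprime_prime_power_iff[OF p] L by simp
    show ?thesis
    proof (cases "\<exists>u. coprime u (int (p ^ l)) \<and> [u = 1] (mod int (p ^ L)) \<and> chi u \<noteq> 1")
      case True
      then obtain u where u: "coprime u (int (p ^ l))" "[u = 1] (mod int (p ^ L))" "chi u \<noteq> 1" by blast
      define v where "v = modular_inverse (int (p ^ l)) u"
      have uv: "[u * v = 1] (mod int (p ^ l))" unfolding v_def by (rule cong_modular_inverse1[OF u(1)])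
      have v1: "[v = 1] (mod int (p ^ L))"
      proof -
        have "[1 * v = u * v] (mod int (p ^ L))" by (intro cong_mult cong_refl cong_sym[OF u(2)])
        also have "[u * v = 1] (mod int (p ^ L))" by (rule cong_dvd_modulus[OF uv qc])
        finally show ?thesis by simp
      qed
      have scale: "[int (p ^ m) * y * (w * x) = int (p ^ m) * y * x] (mod int (p ^ l))"
        if w: "[w = 1] (mod int (p ^ L))" for w x y
      proof -
        have "int (p ^ m) * int (p ^ L) dvd int (p ^ m) * (w - 1)"
          using w by (intro mult_dvd_mono dvd_refl) (simp add: cong_iff_dvd_diff)
        hence "int (p ^ l) dvd int (p ^ m) * (w - 1) * (y * x)" by (simp add: L power_add mult.commute)
        thus ?thesis by (simp add: cong_iff_dvd_diff algebra_simps)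
      qed
      let ?S = "kloosterman_sum chi a b (p ^ l)"
      have "?S = (\<Sum>x\<in>unit_residues (p ^ l). kl_term chi a b (p ^ l) (u * x))"
        unfolding kloosterman_sum_alt
        by (rule sum_unit_residues_mult[symmetric, OF c0 kl_term_cong[OF chi] uv])
      also have "\<dots> = (\<Sum>x\<in>unit_residues (p ^ l). cnj (chi u) * kl_term chi a b (p ^ l) x)"
      proof (intro sum.cong refl)
        fix x assume "x \<in> unit_residues (p ^ l)"
        hence x: "coprime x (int (p ^ l))" by (simp add: unit_residues_def)
        have "ephase (p ^ l) (a * (u * x) + b * (v * modular_inverse (int (p ^ l)) x)) =
              ephase (p ^ l) (a * x + b * modular_inverse (int (p ^ l)) x)"
          unfolding a' b' by (intro ephase_cong cong_add scale u(2) v1)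
        thus "kl_term chi a b (p ^ l) (u * x) = cnj (chi u) * kl_term chi a b (p ^ l) x"
          unfolding kl_term_mult[OF chi x uv] by (simp add: kl_term_def)
      qed
      also have "\<dots> = cnj (chi u) * ?S" by (simp add: kloosterman_sum_alt sum_distrib_left)
      finally have "(cnj (chi u) - 1) * ?S = 0" by (simp add: algebra_simps)
      moreover have "cnj (chi u) \<noteq> 1" using u(3) by (metis complex_cnj_cnj complex_cnj_one)
      ultimately have "?S = 0" by simp
      thus ?thesis using E1 by simp
    next
      case False
      hence trivL: "chi u = 1" if "coprime u (int p)" "[u = 1] (mod int (p ^ L))" for u
        using that by (metis coprime_power_right_iff of_nat_power)
      have chiL: "dirichlet_character (p ^ L) chi"
        unfolding dirichlet_character_def
      proof (intro conjI allI)
        show "p ^ L > 0" using p0 by simp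
        show "chi (x * y) = chi x * chi y" for x y by (rule dirichlet_character_mult[OF chi])
        show nz: "chi x \<noteq> 0 \<longleftrightarrow> coprime x (int (p ^ L))" for x
          using dirichlet_character_nz[OF chi] cop by simp
        show "chi (x + int (p ^ L)) = chi x" for x
        proof (cases "coprime x (int (p ^ l))")
          case True
          define y where "y = modular_inverse (int (p ^ l)) x"
          \<comment> \<open>Chosen so that \<open>x * u\<close> is congruent to
            \<open>x + p ^ L\<close> modulo \<open>p ^ l\<close>, while \<open>u\<close> is 1 modulo
            \<open>p ^ L\<close>.\<close>
          define u where "u = 1 + y * int (p ^ L)"
          have "[x * y = 1] (mod int (p ^ l))" unfolding y_def by (rule cong_modular_inverse1[OF True])
          hence "[x + x * y * int (p ^ L) = x + 1 * int (p ^ L)] (mod int (p ^ l))"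
            by (intro cong_add cong_mult cong_refl)
          hence "[x * u = x + int (p ^ L)] (mod int (p ^ l))" by (simp add: u_def algebra_simps)
          hence "chi (x + int (p ^ L)) = chi x * chi u"
            using dirichlet_character_cong[OF chi] dirichlet_character_mult[OF chi] by metis
          moreover have u1: "[u = 1] (mod int (p ^ L))" by (simp add: u_def cong_iff_dvd_diff)
          hence "coprime u (int (p ^ L))" using cong_imp_coprime[OF cong_sym[OF u1]] by simp
          hence "coprime u (int p)" using L by simp
          ultimately show ?thesis using trivL u1 by simp
        next
          case False
          hence "chi x = 0" using dirichlet_character_nz[OF chi] by blast
          moreover have "\<not> coprime (x + int (p ^ L)) (int (p ^ L))"
            using False cop coprime_mod_iff[of "x + int (p ^ L)" "p ^ L"] coprime_mod_iff[of x "p ^ L"]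
            L(2) by simp
          hence "chi (x + int (p ^ L)) = 0" using nz by blast
          ultimately show ?thesis by simp
        qed
      qed
      have term_eq: "kl_term chi a b (p ^ l) x = kl_term chi a' b' (p ^ L) x" if "x \<in> unit_residues (p ^ l)" for x
      proof -
        have x: "coprime x (int (p ^ l))" using that by (simp add: unit_residues_def)
        have "ephase (p ^ l) (a * x + b * modular_inverse (int (p ^ l)) x) =
              ephase (p ^ (m + L)) (int p ^ m * (a' * x + b' * modular_inverse (int (p ^ l)) x))"
          by (simp add: a' b' L add.commute algebra_simps)
        also have "\<dots> = ephase (p ^ L) (a' * x + b' * modular_inverse (int (p ^ l)) x)"
          by (rule ephase_prime_power_scale[OF p0])
        also have "\<dots> = ephase (p ^ L) (a' * x + b' * modular_inverse (int (p ^ L)) x)"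
        proof (intro ephase_cong cong_add cong_mult cong_refl)
          show "[ modular_inverse (int (p ^ l)) x = modular_inverse (int (p ^ L)) x] (mod int (p ^ L))"
            by (rule cong_sym, rule modular_inverse_eqI_cong)
               (use x cop cong_dvd_modulus[OF cong_modular_inverse1[OF x] qc] in auto)
        qed
        finally show ?thesis by (simp add: kl_term_def)
      qed
      have "kloosterman_sum chi a b (p ^ l) = (\<Sum>x\<in>unit_residues (p ^ (L + m)). kl_term chi a' b' (p ^ L) x)"
        unfolding kloosterman_sum_alt using term_eq by (intro sum.cong) (auto simp: L)
      also have "\<dots> = of_nat (p ^ m) * kloosterman_sum chi a' b' (p ^ L)"
        unfolding kloosterman_sum_alt by (rule sum_unit_residues_lift[OF p L(2) kl_term_cong[OF chiL]])
      finally have S: "norm (kloosterman_sum chi a b (p ^ l)) = real p ^ m * norm (kloosterman_sum chi a' b' (p ^ L))"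
        by (simp add: norm_mult norm_power)
      \<comment> \<open>The level \<open>g\<close> may exceed the lowered exponent \<open>L\<close>;
        then triviality modulo \<open>p ^ L\<close> takes its place.\<close>
      have "norm (kloosterman_sum chi a' b' (p ^ L))
          \<le> (real L + 1) * sqrt (real p) ^ L * conductor_factor p (min g L)"
      proof (rule kloosterman_coprime_bound[OF p chiL _ _ _ ab])
        fix x assume "coprime x (int p)" "[x = 1] (mod int p ^ min g L)"
        thus "chi x = 1" using triv[of x] trivL[of x] by (cases "g \<le> L") (auto simp: min_def)
      qed (use L in auto)
      also have "\<dots> \<le> (real l + 1) * sqrt (real p) ^ L * conductor_factor p g"
        using conductor_factor_mono[OF p0, of "min g L" g] conductor_factor_ge_1[OF p0, of "min g L"]
        by (intro mult_mono) (auto simp: L)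
      finally have "real p ^ m * norm (kloosterman_sum chi a' b' (p ^ L))
        \<le> real p ^ m * ((real l + 1) * sqrt (real p) ^ L * conductor_factor p g)"
        by (intro mult_left_mono) auto
      also have "\<dots> = (real l + 1) * sqrt (real p) ^ m * sqrt (real p) ^ l * conductor_factor p g"
      proof -
        have "real p ^ m = sqrt (real p) ^ m * sqrt (real p) ^ m"
          by (simp add: power_mult_distrib[symmetric])
        thus ?thesis by (simp add: L power_add mult_ac)
      qed
      finally show ?thesis unfolding S .
    qed
  qed
qed

section \<open>Divisor count and conductor\<close>

lemma divisor_count_prime_power:
  assumes "prime p"
  shows "divisor_count (p ^ l) = l + 1"
proof -
  have "{d. d dvd p ^ l} = (\<lambda>i. p ^ i) ` {..l}"
    using assms by (auto simp: divides_primepow_nat le_imp_power_dvd)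
  moreover have "inj_on (\<lambda>i. p ^ i) {..l}"
    using prime_gt_1_nat[OF assms] by (auto intro!: inj_onI)
  ultimately show ?thesis unfolding divisor_count_def by (simp add: card_image)
qed

lemma conductor_trivial:
  assumes chi: "dirichlet_character c chi" and x: "coprime x (int c)" "[x = 1] (mod int (conductor c chi))"
  shows "chi x = 1"
proof -
  have "c dvd c \<and> (\<exists>psi. dirichlet_character c psi \<and> (\<forall>x. coprime x (int c) \<longrightarrow> chi x = psi x))"
    using chi by (intro conjI exI[of _ chi]) auto
  from LeastI[of "\<lambda>d. d dvd c \<and> (\<exists>psi. dirichlet_character d psi \<and> (\<forall>x. coprime x (int c) \<longrightarrow> chi x = psi x))", OF this]
  obtain psi where psi: "dirichlet_character (conductor c chi) psi"
    "\<And>x. coprime x (int c) \<Longrightarrow> chi x = psi x"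
    unfolding conductor_def by blast
  show ?thesis
    using psi(2)[OF x(1)] dirichlet_character_cong[OF psi(1) x(2)] dirichlet_character_one[OF psi(1)] by simp
qed

theorem theorem9p3:
  fixes p l c \<gamma> :: nat and chi :: "int \<Rightarrow> complex" and a b :: int
  assumes "prime p"
    and "c = p ^ l"
    and "dirichlet_character c chi"
    and "conductor c chi = p ^ \<gamma>"
    and "\<gamma> \<le> l"
  shows "norm (kloosterman_sum chi a b c)
           \<le> real (divisor_count c) * real_of_int (gcd (gcd a b) (int c)) powr (1/2)
               * real c powr (1/2) * real (conductor c chi) powr (1/2)
         \<and> norm (kloosterman_sum chi a b c)
           \<le> real (divisor_count c) * real_of_int (gcd (gcd a b) (int c)) powr (1/2)
               * real c powr (1/2) * real (conductor c chi) powr (1/4) * real p powr (1/4)"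
proof -
  have p0: "p > 0" using prime_gt_0_nat[OF assms(1)] .
  have P1: "real p \<ge> 1" using p0 by simp
  have "gcd (gcd a b) (int c) = int (nat (gcd (gcd a b) (int c)))" by simp
  moreover have "nat (gcd (gcd a b) (int c)) dvd p ^ l"
  proof -
    have "int (nat (gcd (gcd a b) (int c))) dvd int c" by simp
    thus ?thesis unfolding int_dvd_int_iff assms(2) .
  qed
  then obtain m where m: "m \<le> l" "nat (gcd (gcd a b) (int c)) = p ^ m"
    using divides_primepow_nat[OF assms(1)] by blast
  ultimately have g: "gcd (gcd a b) (int c) = int (p ^ m)" by simp
  have "chi x = 1" if "coprime x (int p)" "[x = 1] (mod int p ^ \<gamma>)" for x
    using conductor_trivial[OF assms(3)] that assms(2,4) by simp
  from kloosterman_bound[OF assms(1) assms(3)[unfolded assms(2)] this g[unfolded assms(2)] m(1)]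
  have bound: "norm (kloosterman_sum chi a b c)
      \<le> (real l + 1) * sqrt (real p) ^ m * sqrt (real p) ^ l * conductor_factor p \<gamma>"
    unfolding assms(2) .
  have half: "real (p ^ j) powr (1/2) = sqrt (real p) ^ j" for j
    using p0 by (simp add: powr_half_sqrt real_sqrt_power)
  have quarter: "real (p ^ \<gamma>) powr e = real p powr (real \<gamma> * e)" for e
    using p0 by (simp add: powr_realpow[symmetric] powr_powr)
  \<comment> \<open>At \<open>\<gamma> = 0\<close> the right side is 1, which is why
    \<open>conductor_factor\<close> is 1 there and not \<open>p powr (1/4)\<close>.\<close>
  have f1: "conductor_factor p \<gamma> \<le> real (p ^ \<gamma>) powr (1/2)"
    unfolding quarter conductor_factor_def using P1 by (auto intro!: powr_mono)
  have f2: "conductor_factor p \<gamma> \<le> real (p ^ \<gamma>) powr (1/4) * real p powr (1/4)"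
    unfolding quarter powr_add[symmetric] conductor_factor_def
    using P1 by (auto intro!: powr_mono ge_one_powr_ge_zero simp: field_simps)
  have pre: "real (divisor_count c) * real_of_int (gcd (gcd a b) (int c)) powr (1/2) * real c powr (1/2)
      = (real l + 1) * sqrt (real p) ^ m * sqrt (real p) ^ l"
    unfolding g using divisor_count_prime_power[OF assms(1), of l] half[of m] half[of l]
    by (simp add: assms(2))
  have nonneg: "0 \<le> (real l + 1) * sqrt (real p) ^ m * sqrt (real p) ^ l" by simp
  show ?thesis
    unfolding pre assms(4) mult.assoc[of _ _ "real p powr (1/4)"]
    using order.trans[OF bound mult_left_mono[OF f1 nonneg]]
      order.trans[OF bound mult_left_mono[OF f2 nonneg]] by blast
qed

end
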